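(* Let $d\in\mathbb{N}$, let $D$ be either $\mathbb{R}^d$ or the torus $\mathbb{T}^d$, let $T>0$ and $v_0\in L^2(D;\mathbb{R}^d)$. Let $v\in L^\infty\big((0,T);L^2(D;\mathbb{R}^d)\big)\cap L^3\big((0,T)\times D;\mathbb{R}^d\big)$ be a weak solution of the incompressible Euler equations with initial data $v_0$ and with corresponding scalar pressure $p\in L^{3/2}\big((0,T)\times D\big)$. Assume that $$\liminf_{\varepsilon\to0}\frac{1}{\varepsilon}\int_0^T\int_D\frac{1}{|B_\varepsilon(x)|}\int_{B_\varepsilon(x)}\big|v(t,x)-v(t,y)\big|^3\,dy\,dx\,dt=0 .$$ Then $(v,p)$ satisfies the local energy identity $$\partial_t\frac{|v|^2}{2}+\sum_{k=1}^d\partial_{x^k}\left(v^k\left(\frac{|v|^2}{2}+p\right)\right)=0$$ in the sense of distributions on $(0,T)\times D$.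
   Context: A weak solution of the incompressible Euler equations on $[0,T]\times D$ with initial data $v_0$ and pressure $p$ is a function $v=(v^1,\dots,v^d)\in L^2_{\mathrm{loc}}([0,T]\times D;\mathbb{R}^d)$ such that $$\int_0^T\int_D \Big(v\,\partial_t\phi+\sum_{k=1}^d v\,v^k\,\partial_{x^k}\phi+p\,\nabla\phi\Big)\,dx\,dt+\int_D v_0(x)\phi(0,x)\,dx=0$$ (an identity in $\mathbb{R}^d$) for all scalar $\phi\in C_c^\infty([0,T)\times D)$, and such that $\nabla\cdot v=0$ in the sense of distributions. $B_\varepsilon(x)$ denotes the ball of radius $\varepsilon$ centered at $x$. *)

theory Defs
  imports "HOL-Analysis.Analysis"
begin

text \<open>
  The spatial domain is \<open>D = \<real>\<^sup>d / \<Lambda>\<close> with \<open>d = CARD('n)\<close>, where \<open>\<Lambda> = {0}\<close> (whole space) or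
  \<open>\<Lambda> = \<int>\<^sup>d\<close> (torus). A function on \<open>D\<close> is represented by a \<open>\<Lambda>\<close>-periodic function on \<open>\<real>\<^sup>d\<close>,
  and integration over \<open>D\<close> is integration over a fundamental cell. A function on space-time
  takes a pair \<open>(t, x)\<close>. Elements of \<open>L\<^sup>p\<close> are represented by Borel functions (every class of
  Lebesgue measurable functions contains one).
\<close>

datatype domain = Whole_Space | Torus

fun periods :: "domain \<Rightarrow> (real ^ 'n) set" where
  "periods Whole_Space = {0}"
| "periods Torus = {k. \<forall>i. k $ i \<in> \<int>}"

fun cell :: "domain \<Rightarrow> (real ^ 'n) set" where
  "cell Whole_Space = UNIV"
| "cell Torus = {x. \<forall>i. 0 \<le> x $ i \<and> x $ i < 1}"

definition periodic :: "domain \<Rightarrow> (real ^ 'n \<Rightarrow> 'b) \<Rightarrow> bool" where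
  "periodic D f \<longleftrightarrow> (\<forall>x. \<forall>k\<in>periods D. f (x + k) = f x)"

text \<open>The ball of \<open>D\<close> in the quotient metric, as a subset of the fundamental cell.\<close>

definition dball :: "domain \<Rightarrow> real ^ 'n \<Rightarrow> real \<Rightarrow> (real ^ 'n) set" where
  "dball D x \<epsilon> = {y \<in> cell D. \<exists>k\<in>periods D. dist x (y + k) < \<epsilon>}"

definition Lp_on ::
    "real \<Rightarrow> 'a::euclidean_space set \<Rightarrow> ('a \<Rightarrow> 'b::euclidean_space) \<Rightarrow> bool" where
  "Lp_on q A f \<longleftrightarrow> set_borel_measurable lborel A f \<and>
     set_integrable lborel A (\<lambda>z. norm (f z) powr q)"

text \<open>\<open>L\<^sup>q\<^sub>l\<^sub>o\<^sub>c(J \<times> D)\<close>\<close>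

definition Lp_loc ::
    "real \<Rightarrow> real set \<Rightarrow> domain \<Rightarrow> (real \<times> (real ^ 'n) \<Rightarrow> 'b::euclidean_space) \<Rightarrow> bool" where
  "Lp_loc q J D f \<longleftrightarrow>
     (\<forall>K. compact K \<and> K \<subseteq> J \<times> UNIV \<longrightarrow> Lp_on q (K \<inter> (UNIV \<times> cell D)) f)"

text \<open>\<open>L\<^sup>\<infinity>((0,T); L\<^sup>2(D))\<close>\<close>

definition Linf_L2 ::
    "real \<Rightarrow> domain \<Rightarrow> (real \<times> (real ^ 'n) \<Rightarrow> 'b::euclidean_space) \<Rightarrow> bool" where
  "Linf_L2 T D f \<longleftrightarrow> set_borel_measurable lborel ({0<..<T} \<times> cell D) f \<and>
     (\<exists>C. AE t in lborel. t \<in> {0<..<T} \<longrightarrow>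
        Lp_on 2 (cell D) (\<lambda>x. f (t, x)) \<and> (LINT x:cell D|lborel. (norm (f (t, x)))\<^sup>2) \<le> C)"

primrec C_k :: "nat \<Rightarrow> ('a::euclidean_space \<Rightarrow> real) \<Rightarrow> bool" where
  "C_k 0 f \<longleftrightarrow> continuous_on UNIV f"
| "C_k (Suc m) f \<longleftrightarrow> (\<forall>z. f differentiable (at z)) \<and>
     (\<forall>b\<in>Basis. C_k m (\<lambda>z. frechet_derivative f (at z) b))"

definition smooth :: "('a::euclidean_space \<Rightarrow> real) \<Rightarrow> bool" where
  "smooth f \<longleftrightarrow> (\<forall>m. C_k m f)"

text \<open>
  \<open>C\<^sub>c\<^sup>\<infinity>(J \<times> D)\<close> for an open set \<open>J\<close> of times, each function being extended by \<open>0\<close> to all times.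
  For the half-open interval \<open>[0,T)\<close>, the elements of \<open>C\<^sub>c\<^sup>\<infinity>([0,T) \<times> D)\<close> are exactly the
  restrictions to \<open>t \<ge> 0\<close> of the elements of \<open>C\<^sub>c\<^sup>\<infinity>((-\<infinity>,T) \<times> D)\<close>, so \<open>J = {..<T}\<close> is used there.
\<close>

definition test_function :: "real set \<Rightarrow> domain \<Rightarrow> (real \<times> (real ^ 'n) \<Rightarrow> real) \<Rightarrow> bool" where
  "test_function J D \<phi> \<longleftrightarrow> smooth \<phi> \<and> (\<forall>t. periodic D (\<lambda>x. \<phi> (t, x))) \<and>
     (\<exists>K. compact K \<and> K \<subseteq> J \<times> UNIV \<and>
        (\<forall>t x. \<phi> (t, x) \<noteq> 0 \<longrightarrow> (\<exists>k\<in>periods D. (t, x + k) \<in> K)))"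

definition dt :: "(real \<times> (real ^ 'n) \<Rightarrow> real) \<Rightarrow> real \<times> (real ^ 'n) \<Rightarrow> real" where
  "dt \<phi> z = frechet_derivative \<phi> (at z) (1, 0)"

definition dx :: "'n \<Rightarrow> (real \<times> (real ^ 'n) \<Rightarrow> real) \<Rightarrow> real \<times> (real ^ 'n) \<Rightarrow> real" where
  "dx k \<phi> z = frechet_derivative \<phi> (at z) (0, axis k 1)"

definition grad :: "(real \<times> (real ^ 'n) \<Rightarrow> real) \<Rightarrow> real \<times> (real ^ 'n) \<Rightarrow> real ^ 'n" where
  "grad \<phi> z = (\<chi> k. dx k \<phi> z)"

text \<open>\<open>\<partial>\<^sub>t e + \<Sum>\<^sub>k \<partial>\<^sub>k q\<^sup>k = 0\<close> in the sense of distributions on \<open>(0,T) \<times> D\<close>\<close>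

definition weak_conservation_law ::
    "real \<Rightarrow> domain \<Rightarrow> (real \<times> (real ^ 'n) \<Rightarrow> real) \<Rightarrow> (real \<times> (real ^ 'n) \<Rightarrow> real ^ 'n) \<Rightarrow> bool" where
  "weak_conservation_law T D e q \<longleftrightarrow>
     Lp_loc 1 {0<..<T} D e \<and> Lp_loc 1 {0<..<T} D q \<and>
     (\<forall>\<phi>. test_function {0<..<T} D \<phi> \<longrightarrow>
        (LINT z:{0<..<T} \<times> cell D|lborel. e z * dt \<phi> z + (\<Sum>k\<in>UNIV. q z $ k * dx k \<phi> z)) = 0)"

definition weakly_div_free :: "real \<Rightarrow> domain \<Rightarrow> (real \<times> (real ^ 'n) \<Rightarrow> real ^ 'n) \<Rightarrow> bool" where
  "weakly_div_free T D v \<longleftrightarrow>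
     (\<forall>\<phi>. test_function {0<..<T} D \<phi> \<longrightarrow>
        (LINT z:{0<..<T} \<times> cell D|lborel. (\<Sum>k\<in>UNIV. v z $ k * dx k \<phi> z)) = 0)"

definition weak_euler_solution ::
    "real \<Rightarrow> domain \<Rightarrow> (real ^ 'n \<Rightarrow> real ^ 'n) \<Rightarrow> (real \<times> (real ^ 'n) \<Rightarrow> real ^ 'n) \<Rightarrow>
      (real \<times> (real ^ 'n) \<Rightarrow> real) \<Rightarrow> bool" where
  "weak_euler_solution T D v\<^sub>0 v p \<longleftrightarrow>
     Lp_loc 2 {0..T} D v \<and>
     (\<forall>\<phi>. test_function {..<T} D \<phi> \<longrightarrow>
        (LINT z:{0<..<T} \<times> cell D|lborel.
           dt \<phi> z *\<^sub>R v z + (\<Sum>k\<in>UNIV. (v z $ k * dx k \<phi> z) *\<^sub>R v z) + p z *\<^sub>R grad \<phi> z)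
        + (LINT x:cell D|lborel. \<phi> (0, x) *\<^sub>R v\<^sub>0 x) = 0) \<and>
     weakly_div_free T D v"

text \<open>
  \<open>\<integral>\<^sub>0\<^sup>T \<integral>\<^sub>D \<bar>B\<^sub>\<epsilon>(x)\<bar>\<^sup>-\<^sup>1 \<integral>\<^bsub>B\<^sub>\<epsilon>(x)\<^esub> \<bar>v(t,x) - v(t,y)\<bar>\<^sup>3 dy dx dt\<close>
\<close>

definition cubic_increment ::
    "real \<Rightarrow> domain \<Rightarrow> (real \<times> (real ^ 'n) \<Rightarrow> real ^ 'n) \<Rightarrow> real \<Rightarrow> ennreal" where
  "cubic_increment T D v \<epsilon> =
     (\<integral>\<^sup>+t\<in>{0<..<T}. (\<integral>\<^sup>+x\<in>cell D.
        ((\<integral>\<^sup>+y\<in>dball D x \<epsilon>. ennreal (norm (v (t, x) - v (t, y)) ^ 3) \<partial>lborel)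
          / emeasure lborel (dball D x \<epsilon>)) \<partial>lborel) \<partial>lborel)"

end

theory Submission
  imports Defs
begin

text \<open>
  The energy identity is obtained by splitting points: in place of \<open>\<bar>v\<bar>\<^sup>2\<close> one studies
  \<open>v(z) \<cdot> v(z + w)\<close> for a small space-time shift \<open>w\<close>. Testing the Euler equations with
  \<open>\<psi> v\<^sup>\<eta>\<close> and with \<open>(\<psi> v)\<^sup>\<eta>\<close>, where \<open>\<eta>\<close> is an even kernel and the superscript denotes
  mollification, and adding the results, the derivatives of \<open>\<eta>\<close> in time cancel. Testing the
  divergence condition with mollifications of \<open>\<psi> p\<close> and \<open>\<psi> \<bar>v\<bar>\<^sup>2\<close> removes the pressure terms
  and most of the cubic ones. With \<open>\<delta> = v(z + w) - v(z)\<close>, what is left is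

  \<open>\<integral> \<eta>(w) A(w) dw = 1/2 \<Sum>\<^sub>k \<integral> \<partial>\<^sub>k\<eta>(w) B\<^sub>k(w) dw\<close>,   \<open>B\<^sub>k(w) = \<integral> \<psi> \<delta>\<^sup>k \<bar>\<delta>\<bar>\<^sup>2 dz\<close>,

  where \<open>A\<close> is continuous at \<open>0\<close> and \<open>A(0)\<close> is twice the left-hand side of the energy identity
  tested with \<open>\<psi>\<close> (\<open>smeared_balance\<close>, \<open>balance\<close>, \<open>flux_0\<close>; \<open>A\<close> and \<open>B\<^sub>k\<close> are called
  \<open>flux\<close> and \<open>defect\<close>). This is the identity of Duchon and Robert, written before any limit.

  Take for \<open>\<eta>\<close> a bump of width \<open>\<epsilon>\<close> in space and of much smaller width \<open>d\<close> in time. Relative to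
  the mass of \<open>\<eta>\<close>, the gradient in space costs a factor \<open>1/\<epsilon>\<close>, and \<open>\<bar>B\<^sub>k(w)\<bar>\<close> is at most a
  constant times \<open>\<integral> \<bar>\<delta>\<bar>\<^sup>3 dz\<close>. Up to a factor \<open>4\<close> this splits into the cubic increment for the
  spatial part of \<open>w\<close> and the one for the temporal part. Translations are continuous in \<open>L\<^sup>3\<close>, so
  \<open>d\<close> can be chosen, depending on \<open>\<epsilon>\<close>, to make the temporal part smaller than \<open>\<epsilon>\<^sup>2\<close>. The spatial
  part, averaged over the ball and divided by \<open>\<epsilon>\<close>, is the quantity whose lower limit vanishes.
  Hence \<open>A(0) = 0\<close> (\<open>flux_eq_0\<close>).

  Both domains are treated at once. All functions are extended by \<open>0\<close> to times outside \<open>(0,T)\<close>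
  and are periodic in space with respect to a lattice \<open>\<Lambda>\<close>, which is \<open>{0}\<close> or \<open>\<int>\<^sup>d\<close>; they are
  integrated over the strip \<open>\<real> \<times> cell\<close>. The only geometric input is that the translates of the
  cell by \<open>\<Lambda>\<close> tile the space (\<open>nn_integral_unfold\<close>); this makes integrals of periodic functions
  over the strip invariant under translations (\<open>cellm_shift\<close>).
\<close>

section \<open>Smooth functions and their directional derivatives\<close>

definition pd :: "'a::euclidean_space \<Rightarrow> ('a \<Rightarrow> real) \<Rightarrow> 'a \<Rightarrow> real" where
  "pd b f z = frechet_derivative f (at z) b"

lemma pdI: "(f has_derivative f') (at z) \<Longrightarrow> pd b f z = f' b"
  unfolding pd_def using frechet_derivative_at by metis

lemma smooth_has_derivative_pd:
  assumes "f differentiable (at z)"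
  shows "(f has_derivative (\<lambda>h. pd h f z)) (at z)"
  using assms unfolding pd_def frechet_derivative_works by simp

lemma C_k_Suc: "C_k (Suc m) f \<longleftrightarrow> (\<forall>z. f differentiable (at z)) \<and> (\<forall>b\<in>Basis. C_k m (pd b f))"
  unfolding pd_def[abs_def] by simp

lemma C_k_SucD: "C_k (Suc m) f \<Longrightarrow> C_k m f"
proof (induction m arbitrary: f)
  case 0
  then show ?case
    by (auto intro!: continuous_at_imp_continuous_on differentiable_imp_continuous_within)
next
  case (Suc m)
  then show ?case unfolding C_k_Suc[of "Suc m"] C_k_Suc[of m] by blast
qed

lemma C_k_const: "C_k m (\<lambda>z. c)"
proof (induction m arbitrary: c)
  case (Suc m)
  have "pd b (\<lambda>z::'a. c) = (\<lambda>z. 0)" for b by (intro ext pdI) (auto intro!: derivative_eq_intros)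
  then show ?case unfolding C_k_Suc using Suc by simp
qed simp

lemma C_k_add: "C_k m f \<Longrightarrow> C_k m g \<Longrightarrow> C_k m (\<lambda>z. f z + g z)"
proof (induction m arbitrary: f g)
  case 0 then show ?case by (auto intro!: continuous_intros)
next
  case (Suc m)
  have d: "((\<lambda>z. f z + g z) has_derivative (\<lambda>h. pd h f z + pd h g z)) (at z)" for z
    using Suc.prems unfolding C_k_Suc
    by (intro has_derivative_add smooth_has_derivative_pd) auto
  have "pd b (\<lambda>z. f z + g z) = (\<lambda>z. pd b f z + pd b g z)" for b by (intro ext pdI d)
  moreover have "(\<lambda>z. f z + g z) differentiable (at z)" for z using d unfolding differentiable_def by blast
  ultimately show ?case using Suc unfolding C_k_Suc by simp
qed

lemma C_k_mult: "C_k m f \<Longrightarrow> C_k m g \<Longrightarrow> C_k m (\<lambda>z. f z * g z)"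
proof (induction m arbitrary: f g)
  case 0 then show ?case by (auto intro!: continuous_intros)
next
  case (Suc m)
  have d: "((\<lambda>z. f z * g z) has_derivative (\<lambda>h. f z * pd h g z + pd h f z * g z)) (at z)" for z
    using Suc.prems unfolding C_k_Suc
    by (intro has_derivative_mult smooth_has_derivative_pd) auto
  have "pd b (\<lambda>z. f z * g z) = (\<lambda>z. f z * pd b g z + pd b f z * g z)" for b by (intro ext pdI d)
  moreover have "(\<lambda>z. f z * g z) differentiable (at z)" for z using d unfolding differentiable_def by blast
  moreover have "C_k m f" "C_k m g" using C_k_SucD Suc.prems by auto
  ultimately show ?case using Suc unfolding C_k_Suc by (simp add: C_k_add)
qed

lemma smooth_mult: "smooth f \<Longrightarrow> smooth g \<Longrightarrow> smooth (\<lambda>z. f z * g z)"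
  and smooth_add: "smooth f \<Longrightarrow> smooth g \<Longrightarrow> smooth (\<lambda>z. f z + g z)"
  and smooth_const: "smooth (\<lambda>z. c)"
  unfolding smooth_def by (auto intro: C_k_mult C_k_add C_k_const)

lemma smooth_pd: "smooth f \<Longrightarrow> b \<in> Basis \<Longrightarrow> smooth (pd b f)"
  unfolding smooth_def using C_k_Suc by blast

lemma smooth_differentiable: "smooth f \<Longrightarrow> f differentiable (at z)"
  unfolding smooth_def using C_k_Suc by blast

lemma smooth_derivative: "smooth f \<Longrightarrow> (f has_derivative (\<lambda>h. pd h f z)) (at z)"
  by (intro smooth_has_derivative_pd smooth_differentiable)

lemma smooth_continuous: "smooth f \<Longrightarrow> continuous_on UNIV f"
  unfolding smooth_def using C_k.simps(1) by metis

lemma smooth_borel: "smooth f \<Longrightarrow> f \<in> borel_measurable borel"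
  using smooth_continuous borel_measurable_continuous_onI by blast

lemma pd_mult:
  "smooth f \<Longrightarrow> smooth g \<Longrightarrow> pd b (\<lambda>z. f z * g z) z = f z * pd b g z + pd b f z * g z"
  by (intro pdI has_derivative_mult smooth_derivative)

text \<open>
  The functions \<open>s\<^sup>-\<^sup>k exp (-1/s)\<close>, extended by \<open>0\<close> to \<open>s \<le> 0\<close>, form a family that is closed
  under differentiation up to linear combinations. Smoothness of \<open>exp (-1/s)\<close> therefore follows by
  induction on the order of differentiability, for all \<open>k\<close> simultaneously.
\<close>

definition flat :: "nat \<Rightarrow> real \<Rightarrow> real" where
  "flat k s = (if s > 0 then exp (- (1/s)) / s ^ k else 0)"


text \<open>
  With \<open>x = 1/s\<close> this is the decay of \<open>x\<^sup>k exp (-x)\<close>. It yields both the continuity of \<open>flat k\<close>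
  at \<open>0\<close> and, applied to \<open>flat (Suc k)\<close>, the vanishing of its difference quotients there.
\<close>

lemma flat_at_0: "(flat k \<longlongrightarrow> 0) (at 0)"
proof (rule filterlim_split_at)
  have "((\<lambda>s. (inverse s)^k / exp (inverse s)) \<longlongrightarrow> 0) (at_right (0::real))"
    by (rule filterlim_compose[OF tendsto_power_div_exp_0 filterlim_inverse_at_top_right])
  then show "(flat k \<longlongrightarrow> 0) (at_right 0)"
  proof (rule Lim_transform_eventually)
    show "\<forall>\<^sub>F s in at_right 0. (inverse s)^k / exp (inverse s) = flat k s"
      by (rule eventually_at_right_less[THEN eventually_mono])
        (simp add: flat_def exp_minus field_simps)
  qed
  show "(flat k \<longlongrightarrow> 0) (at_left 0)"
    by (rule Lim_transform_eventually[OF tendsto_const])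
      (auto simp: eventually_at_left_field flat_def intro!: exI[of _ "-1"])
qed

lemma flat_derivative:
  "(flat k has_real_derivative flat (Suc (Suc k)) s - real k * flat (Suc k) s) (at s)"
proof -
  consider "s > 0" | "s < 0" | "s = 0" by linarith
  then show ?thesis
  proof cases
    case 1
    have "((\<lambda>s. exp (- (1/s)) / s ^ k) has_real_derivative
        flat (Suc (Suc k)) s - real k * flat (Suc k) s) (at s)"
    proof (cases k)
      case (Suc n)
      have "s ^ k = s * s ^ n" "real k * s ^ (k - 1) = real k * s ^ n" by (simp_all add: Suc)
      then show ?thesis using 1
        by (auto intro!: derivative_eq_intros simp: flat_def field_simps power2_eq_square)
    qed (use 1 in \<open>auto intro!: derivative_eq_intros simp: flat_def field_simps power2_eq_square\<close>)
    then show ?thesis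
      by (rule has_field_derivative_transform_within_open[of _ _ _ "{0<..}"])
        (use 1 in \<open>auto simp: flat_def\<close>)
  next
    case 2
    have "((\<lambda>s. 0) has_real_derivative flat (Suc (Suc k)) s - real k * flat (Suc k) s) (at s)"
      using 2 by (auto simp: flat_def)
    then show ?thesis
      by (rule has_field_derivative_transform_within_open[of _ _ _ "{..<0}"])
        (use 2 in \<open>auto simp: flat_def\<close>)
  next
    case 3
    have "((\<lambda>h. (flat k (0 + h) - flat k 0) / h) \<longlongrightarrow> 0) (at 0)"
      by (rule Lim_transform_eventually[OF flat_at_0[of "Suc k"]])
        (auto simp: eventually_at_filter flat_def)
    then show ?thesis unfolding 3 DERIV_def by (simp add: flat_def)
  qed
qed

lemma C_k_flat_comp:
  assumes "smooth g"
  shows "C_k m (\<lambda>z. flat k (g z))"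
proof (induction m arbitrary: k)
  have d: "((\<lambda>z. flat k (g z)) has_derivative
      (\<lambda>h. (flat (Suc (Suc k)) (g z) + (- real k) * flat (Suc k) (g z)) * pd h g z)) (at z)" for k z
    using has_derivative_compose[OF smooth_derivative[OF assms]
        flat_derivative[THEN has_field_derivative_imp_has_derivative]]
    by simp
  {
    case 0
    have "continuous (at z) (\<lambda>z. flat k (g z))" for z
      using d has_derivative_continuous by blast
    then show ?case by (simp add: continuous_at_imp_continuous_on)
  next
    case (Suc m)
    have "pd b (\<lambda>z. flat k (g z)) =
        (\<lambda>z. (flat (Suc (Suc k)) (g z) + (- real k) * flat (Suc k) (g z)) * pd b g z)" for b
      by (intro ext pdI d)
    moreover have "(\<lambda>z. flat k (g z)) differentiable (at z)" for z
      using d unfolding differentiable_def by blast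
    moreover have "b \<in> Basis \<Longrightarrow> C_k m (pd b g)" for b
      using assms smooth_pd smooth_def by blast
    moreover have "C_k m (\<lambda>z. flat (Suc (Suc k)) (g z) + (- real k) * flat (Suc k) (g z))"
      by (intro C_k_mult C_k_add Suc C_k_const)
    ultimately show ?case unfolding C_k_Suc
      using C_k_mult[of m "\<lambda>z. flat (Suc (Suc k)) (g z) + (- real k) * flat (Suc k) (g z)"] by metis
  }
qed

lemma smooth_flat_comp: "smooth g \<Longrightarrow> smooth (\<lambda>z. flat k (g z))"
  unfolding smooth_def[of "\<lambda>z. flat k (g z)"] using C_k_flat_comp by blast

lemma smooth_linear:
  assumes "bounded_linear f" shows "smooth f"
  unfolding smooth_def
proof
  have d: "(f has_derivative f) (at z)" for z
    using assms by (rule bounded_linear_imp_has_derivative)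
  show "C_k m f" for m
  proof (cases m)
    case 0
    then show ?thesis using assms by (simp add: linear_continuous_on)
  next
    case (Suc n)
    have "pd b f = (\<lambda>z. f b)" for b by (intro ext pdI d)
    then show ?thesis unfolding Suc C_k_Suc using d by (auto simp: C_k_const differentiable_def)
  qed
qed

lemma smooth_sum: "finite I \<Longrightarrow> (\<And>i. i \<in> I \<Longrightarrow> smooth (f i)) \<Longrightarrow> smooth (\<lambda>z. \<Sum>i\<in>I. f i z)"
  by (induction I rule: finite_induct) (auto intro: smooth_add smooth_const)

lemma pd_eq_0_outside:
  assumes "closed S" "\<And>z. z \<notin> S \<Longrightarrow> f z = 0" "z \<notin> S"
  shows "pd b f z = 0"
proof -
  have "(f has_derivative (\<lambda>h. 0)) (at z)"
    by (rule has_derivative_transform_within_open[of "\<lambda>z. 0" _ _ _ "- S"])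
      (use assms in auto)
  then show ?thesis by (rule pdI)
qed

section \<open>Mollification\<close>

definition mollify :: "('a::euclidean_space \<Rightarrow> real) \<Rightarrow> ('a \<Rightarrow> real) \<Rightarrow> 'a \<Rightarrow> real" where
  "mollify \<eta> F z = (LINT u|lborel. \<eta> (z - u) * F u)"

text \<open>
  Integrability over balls of the one radius \<open>r\<close> suffices for kernels of smaller radius. For
  periodic functions it can be read off from the integral over a fundamental cell as soon as a ball
  of radius \<open>r\<close> fits into a translate of the cell.
\<close>

definition loc_int :: "real \<Rightarrow> ('a::euclidean_space \<Rightarrow> real) \<Rightarrow> bool" where
  "loc_int r F \<longleftrightarrow> F \<in> borel_measurable borel \<and> (\<forall>z. integrable lborel (\<lambda>u. indicator (cball z r) u * F u))"

lemma loc_int_kernel: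
  assumes F: "loc_int r F" and g: "g \<in> borel_measurable borel"
    and g0: "\<And>u. u \<notin> cball z r \<Longrightarrow> g u = 0" and B: "\<And>u. \<bar>g u\<bar> \<le> B"
  shows "integrable lborel (\<lambda>u. g u * F u)"
proof (rule Bochner_Integration.integrable_bound)
  show "integrable lborel (\<lambda>u. B * (indicator (cball z r) u * F u))"
    using F unfolding loc_int_def by auto
  show "(\<lambda>u. g u * F u) \<in> borel_measurable lborel"
    using F g unfolding loc_int_def by auto
  show "AE u in lborel. norm (g u * F u) \<le> norm (B * (indicator (cball z r) u * F u))"
  proof (rule AE_I2)
    fix u
    show "norm (g u * F u) \<le> norm (B * (indicator (cball z r) u * F u))"
      using g0[of u] B[of u]
      by (cases "u \<in> cball z r") (auto simp: abs_mult intro!: mult_right_mono)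
  qed
qed

lemma compact_support_bounded:
  fixes f :: "'a::euclidean_space \<Rightarrow> real"
  assumes "continuous_on UNIV f" "compact K" "\<And>z. z \<notin> K \<Longrightarrow> f z = 0"
  obtains B where "B > 0" "\<And>z. \<bar>f z\<bar> \<le> B"
proof -
  have "bounded (f ` K)"
    by (intro compact_imp_bounded compact_continuous_image continuous_on_subset[OF assms(1)] assms) auto
  then obtain B where "B > 0" "\<forall>y\<in>f`K. norm y \<le> B" unfolding bounded_pos by blast
  then have "\<bar>f z\<bar> \<le> B" for z using assms(3)[of z] by (cases "z \<in> K") auto
  then show ?thesis by (rule that[OF \<open>B > 0\<close>])
qed

lemma compact_support_uniformly_continuous:
  fixes f :: "'a::euclidean_space \<Rightarrow> real"
  assumes c: "continuous_on UNIV f" and 0: "\<And>z. norm z > r \<Longrightarrow> f z = 0" and "e > 0"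
  obtains d where "d > 0" "\<And>x y. dist x y < d \<Longrightarrow> \<bar>f x - f y\<bar> < e"
proof -
  have "uniformly_continuous_on (cball 0 (r+1)) f"
    using c by (intro compact_uniformly_continuous) (auto intro: continuous_on_subset)
  then obtain d where d: "d > 0"
    "\<And>x y. x \<in> cball 0 (r+1) \<Longrightarrow> y \<in> cball 0 (r+1) \<Longrightarrow> dist y x < d \<Longrightarrow> dist (f y) (f x) < e"
    using \<open>e > 0\<close> unfolding uniformly_continuous_on_def by metis
  have "\<bar>f x - f y\<bar> < e" if xy: "dist x y < min d 1" for x y
  proof (cases "norm x \<le> r + 1 \<and> norm y \<le> r + 1")
    case True
    then show ?thesis using d(2)[of x y] xy by (simp add: dist_real_def dist_commute abs_minus_commute)
  next
    case False
    have "norm x \<le> norm y + dist x y" "norm y \<le> norm x + dist x y"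
      using norm_triangle_ineq2[of x y] norm_triangle_ineq2[of y x]
      by (auto simp: dist_norm norm_minus_commute)
    then have "norm x > r \<and> norm y > r" using False xy by auto
    then show ?thesis using 0 \<open>e > 0\<close> by simp
  qed
  then show ?thesis using that[of "min d 1"] d(1) by simp
qed

lemma pd_eq_0_outside_cball:
  fixes f :: "'a::euclidean_space \<Rightarrow> real"
  assumes "\<And>z. norm z > r \<Longrightarrow> f z = 0" "norm z > r"
  shows "pd b f z = 0"
proof (rule pd_eq_0_outside[of "cball 0 r"])
  show "f z = 0" if "z \<notin> cball 0 r" for z using assms(1)[of z] that by simp
qed (use assms(2) in auto)

text \<open>
  The Taylor remainder is uniform in \<open>x\<close>, since the partial derivatives are uniformly
  continuous. The tolerance is divided by the dimension because the remainder is estimated one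
  direction at a time.
\<close>

lemma smooth_first_order:
  fixes \<eta> :: "'a::euclidean_space \<Rightarrow> real"
  assumes sm: "smooth \<eta>" and 0: "\<And>z. norm z > r \<Longrightarrow> \<eta> z = 0" and "e > 0"
  obtains d where "d > 0" "\<And>x h. norm h < d \<Longrightarrow> \<bar>\<eta> (x + h) - \<eta> x - pd h \<eta> x\<bar> \<le> e * norm h"
proof -
  define e' where "e' = e / real (Suc (DIM('a)))"
  have e': "e' > 0" using \<open>e > 0\<close> by (simp add: e'_def)
  have "\<forall>b\<in>Basis. \<exists>d>0. \<forall>x y. dist x y < d \<longrightarrow> \<bar>pd b \<eta> x - pd b \<eta> y\<bar> < e'"
  proof
    fix b :: 'a assume b: "b \<in> Basis"
    have "pd b \<eta> z = 0" if "norm z > r" for z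
      by (rule pd_eq_0_outside_cball[OF 0 that])
    then obtain d where "d > 0" "\<And>x y. dist x y < d \<Longrightarrow> \<bar>pd b \<eta> x - pd b \<eta> y\<bar> < e'"
      using compact_support_uniformly_continuous[OF smooth_continuous[OF smooth_pd[OF sm b]] _ e', of r]
      by blast
    then show "\<exists>d>0. \<forall>x y. dist x y < d \<longrightarrow> \<bar>pd b \<eta> x - pd b \<eta> y\<bar> < e'" by blast
  qed
  then obtain d where "\<forall>b\<in>Basis. 0 < d b \<and> (\<forall>x y. dist x y < d b \<longrightarrow> \<bar>pd b \<eta> x - pd b \<eta> y\<bar> < e')"
    unfolding bchoice_iff by blast
  then have d: "\<And>b. b \<in> Basis \<Longrightarrow> d b > 0"
    "\<And>b x y. b \<in> Basis \<Longrightarrow> dist x y < d b \<Longrightarrow> \<bar>pd b \<eta> x - pd b \<eta> y\<bar> < e'"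
    by blast+
  define d0 where "d0 = Min (d ` Basis)"
  have d0: "d0 > 0" "\<And>b. b \<in> Basis \<Longrightarrow> d0 \<le> d b"
    unfolding d0_def using d(1) by auto
  have lin: "linear (\<lambda>h. pd h \<eta> x)" for x
    using smooth_derivative[OF sm] has_derivative_linear by blast
  have "\<bar>\<eta> (x + h) - \<eta> x - pd h \<eta> x\<bar> \<le> e * norm h" if h: "norm h < d0" for x h
  proof -
    have on: "onorm (\<lambda>k. pd k \<eta> y - pd k \<eta> x) \<le> e" if y: "y \<in> ball x d0" for y
    proof (rule onorm_le)
      fix k :: 'a
      have exp: "pd k \<eta> y' = (\<Sum>b\<in>Basis. (k \<bullet> b) * pd b \<eta> y')" for y'
        using linear_sum[OF lin, of "\<lambda>b. (k \<bullet> b) *\<^sub>R b" Basis y'] linear_scale[OF lin]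
        by (simp add: euclidean_representation)
      have "\<bar>pd k \<eta> y - pd k \<eta> x\<bar> = \<bar>\<Sum>b\<in>Basis. (k \<bullet> b) * (pd b \<eta> y - pd b \<eta> x)\<bar>"
        unfolding exp by (simp add: sum_subtractf right_diff_distrib)
      also have "\<dots> \<le> (\<Sum>b\<in>Basis. \<bar>(k \<bullet> b) * (pd b \<eta> y - pd b \<eta> x)\<bar>)" by (rule sum_abs)
      also have "\<dots> \<le> (\<Sum>b\<in>(Basis::'a set). norm k * e')"
      proof (rule sum_mono)
        fix b :: 'a assume b: "b \<in> Basis"
        have "\<bar>pd b \<eta> y - pd b \<eta> x\<bar> \<le> e'"
          using d(2)[OF b, of y x] d0(2)[OF b] y by (simp add: dist_commute)
        then show "\<bar>(k \<bullet> b) * (pd b \<eta> y - pd b \<eta> x)\<bar> \<le> norm k * e'"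
          using Basis_le_norm[OF b, of k] unfolding abs_mult by (intro mult_mono) auto
      qed
      also have "\<dots> \<le> e * norm k"
        using \<open>e > 0\<close> by (simp add: e'_def field_simps)
      finally show "norm (pd k \<eta> y - pd k \<eta> x) \<le> e * norm k" by simp
    qed
    have "norm (\<eta> (x + h) - \<eta> x - pd (x + h - x) \<eta> x) \<le> norm (x + h - x) * e"
    proof (rule differentiable_bound_linearization[where S="ball x d0" and f'="\<lambda>y k. pd k \<eta> y"])
      show "x + t *\<^sub>R (x + h - x) \<in> ball x d0" if "t \<in> {0..1}" for t
      proof -
        have "\<bar>t\<bar> * norm h \<le> norm h" using mult_right_mono[of "\<bar>t\<bar>" 1 "norm h"] that by simp
        then show ?thesis using h by (simp add: dist_norm)
      qed
      show "onorm ((\<lambda>k. pd k \<eta> y) - (\<lambda>k. pd k \<eta> x)) \<le> e" if "y \<in> ball x d0" for y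
        unfolding fun_diff_def by (rule on[OF that])
      show "(\<eta> has_derivative (\<lambda>k. pd k \<eta> y)) (at y within ball x d0)" if "y \<in> ball x d0" for y
        by (rule has_derivative_at_withinI[OF smooth_derivative[OF sm]])
    qed (use d0 in auto)
    then show ?thesis by (simp add: mult.commute)
  qed
  then show ?thesis by (rule that[OF d0(1)])
qed

text \<open>
  All the derivatives fall on the kernel. The remainder of \<open>mollify \<eta> F\<close> is at most the uniform
  Taylor remainder of \<open>\<eta>\<close> times the integral of \<open>\<bar>F\<bar>\<close> over a ball; the gap between \<open>r\<close> and \<open>r'\<close>
  keeps the shifted kernels inside that ball.
\<close>

lemma mol_has_derivative:
  fixes \<eta> :: "'a::euclidean_space \<Rightarrow> real"
  assumes sm: "smooth \<eta>" and supp: "\<And>z. norm z > r \<Longrightarrow> \<eta> z = 0" and F: "loc_int r' F" and r: "r < r'" "0 < r"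
  shows "(mollify \<eta> F has_derivative (\<lambda>h. mollify (pd h \<eta>) F z)) (at z)"
proof -
  have lin: "linear (\<lambda>h. pd h \<eta> x)" for x
    using smooth_derivative[OF sm] has_derivative_linear by blast
  have supp': "pd h \<eta> y = 0" if "norm y > r" for h y
    by (rule pd_eq_0_outside_cball[OF supp that])
  have pdc: "continuous_on UNIV (pd h \<eta>)" for h
  proof -
    have "pd h \<eta> y = (\<Sum>b\<in>Basis. (h \<bullet> b) * pd b \<eta> y)" for y
      using linear_sum[OF lin, of "\<lambda>b. (h \<bullet> b) *\<^sub>R b" Basis y] linear_scale[OF lin]
      by (simp add: euclidean_representation)
    then have "pd h \<eta> = (\<lambda>y. \<Sum>b\<in>Basis. (h \<bullet> b) * pd b \<eta> y)" by auto
    then show ?thesis using smooth_continuous[OF smooth_pd[OF sm]]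
      by (auto intro!: continuous_intros)
  qed
  have integ: "integrable lborel (\<lambda>u. g (y - u) * F u)"
    if g: "continuous_on UNIV g" "\<And>z. norm z > r \<Longrightarrow> g z = 0" and y: "norm (y - z) < r' - r" for g y
  proof -
    obtain B where "\<And>z. \<bar>g z\<bar> \<le> B"
      using compact_support_bounded[OF g(1), of "cball 0 r"] g(2) by (metis compact_cball dist_0_norm mem_cball not_le)
    moreover have "g (y - u) = 0" if "u \<notin> cball z r'" for u
    proof -
      have "dist z u \<le> norm (y - z) + norm (y - u)"
        by (metis dist_norm dist_triangle dist_commute)
      then show ?thesis using that y g(2)[of "y - u"] by auto
    qed
    moreover have "(\<lambda>u. g (y - u)) \<in> borel_measurable borel"
      using borel_measurable_continuous_onI[OF g(1)] by measurable
    ultimately show ?thesis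
      using loc_int_kernel[OF F, of "\<lambda>u. g (y - u)" z B] by blast
  qed
  define I where "I = (LINT u|lborel. \<bar>indicator (cball z r') u * F u\<bar>)"
  have I: "I \<ge> 0" unfolding I_def by simp
  show ?thesis
  proof -
    have "bounded_linear (\<lambda>h. mollify (pd h \<eta>) F z)"
    proof (rule linear_conv_bounded_linear[THEN iffD1], rule linearI)
      fix h k :: 'a and c :: real
      have i: "integrable lborel (\<lambda>u. pd h \<eta> (z - u) * F u)" for h
        using integ[OF pdc supp', of z h] r by auto
      show "mollify (pd (h + k) \<eta>) F z = mollify (pd h \<eta>) F z + mollify (pd k \<eta>) F z"
        unfolding mollify_def linear_add[OF lin] distrib_right
        by (rule Bochner_Integration.integral_add[OF i i])
      show "mollify (pd (c *\<^sub>R h) \<eta>) F z = c *\<^sub>R mollify (pd h \<eta>) F z"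
        unfolding mollify_def linear_scale[OF lin] by (simp add: mult.assoc)
    qed
    moreover have "\<exists>d>0. \<forall>h. norm h < d \<longrightarrow>
        norm (mollify \<eta> F (z + h) - mollify \<eta> F z - mollify (pd h \<eta>) F z) \<le> e * norm h" if "e > 0" for e
    proof -
      obtain d where d: "d > 0"
        "\<And>x h. norm h < d \<Longrightarrow> \<bar>\<eta> (x + h) - \<eta> x - pd h \<eta> x\<bar> \<le> (e / (I + 1)) * norm h"
        using smooth_first_order[OF sm supp, of r "e / (I + 1)"] \<open>e > 0\<close> I by (metis add_nonneg_pos divide_pos_pos zero_less_one)
      have "norm (mollify \<eta> F (z + h) - mollify \<eta> F z - mollify (pd h \<eta>) F z) \<le> e * norm h"
        if h: "norm h < min d (r' - r)" for h
      proof -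
        have i1: "integrable lborel (\<lambda>u. \<eta> (z + h - u) * F u)"
          using integ[OF smooth_continuous[OF sm] supp, of "z + h"] h by auto
        have i2: "integrable lborel (\<lambda>u. \<eta> (z - u) * F u)"
          using integ[OF smooth_continuous[OF sm] supp, of "z"] r by auto
        have i3: "integrable lborel (\<lambda>u. pd h \<eta> (z - u) * F u)"
          using integ[OF pdc supp', of z h] r by auto
        have iF: "integrable lborel (\<lambda>u. (e / (I + 1) * norm h) * \<bar>indicator (cball z r') u * F u\<bar>)"
          using F unfolding loc_int_def by auto
        have "mollify \<eta> F (z + h) - mollify \<eta> F z - mollify (pd h \<eta>) F z =
          (LINT u|lborel. \<eta> (z + h - u) * F u - \<eta> (z - u) * F u - pd h \<eta> (z - u) * F u)"
          unfolding mollify_def using i1 i2 i3 by simp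
        also have "norm \<dots> \<le> (LINT u|lborel. (e / (I + 1) * norm h) * \<bar>indicator (cball z r') u * F u\<bar>)"
        proof (rule Bochner_Integration.integral_norm_bound_integral)
          show "integrable lborel (\<lambda>u. \<eta> (z + h - u) * F u - \<eta> (z - u) * F u - pd h \<eta> (z - u) * F u)"
            using i1 i2 i3 by auto
          fix u
          have eq: "\<eta> (z + h - u) * F u - \<eta> (z - u) * F u - pd h \<eta> (z - u) * F u
            = (\<eta> (z - u + h) - \<eta> (z - u) - pd h \<eta> (z - u)) * F u" by (simp add: algebra_simps)
          show "norm (\<eta> (z + h - u) * F u - \<eta> (z - u) * F u - pd h \<eta> (z - u) * F u)
            \<le> (e / (I + 1) * norm h) * \<bar>indicator (cball z r') u * F u\<bar>"
          proof (cases "u \<in> cball z r'")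
            case True
            then show ?thesis unfolding eq using mult_right_mono[OF d(2)[of h "z - u"] abs_ge_zero[of "F u"]] h
              by (simp add: abs_mult)
          next
            case False
            have "norm (z - u) \<le> norm (z - u + h) + norm h"
              using norm_triangle_ineq4[of "z - u + h" h] by simp
            then have "norm (z - u) > r" "norm (z - u + h) > r"
              using False h r by (auto simp: dist_norm)
            then show ?thesis unfolding eq using supp supp' False by simp
          qed
        qed (rule iF)
        also have "\<dots> = (e / (I + 1) * norm h) * I" unfolding I_def by simp
        also have "\<dots> \<le> e * norm h"
          using I \<open>e > 0\<close> by (simp add: field_simps mult_left_mono)
        finally show ?thesis .
      qed
      then show ?thesis using d(1) r by (intro exI[of _ "min d (r' - r)"]) auto
    qed
    ultimately show ?thesis
      unfolding has_derivative_at_alt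
    proof (intro conjI allI impI)
      fix e :: real
      assume a: "\<And>e. 0 < e \<Longrightarrow> \<exists>d>0. \<forall>h. norm h < d \<longrightarrow>
        norm (mollify \<eta> F (z + h) - mollify \<eta> F z - mollify (pd h \<eta>) F z) \<le> e * norm h" and e: "e > 0"
      obtain d where d: "d > 0" "\<And>h. norm h < d \<Longrightarrow>
        norm (mollify \<eta> F (z + h) - mollify \<eta> F z - mollify (pd h \<eta>) F z) \<le> e * norm h"
        using a[OF e] by blast
      have "norm (mollify \<eta> F y - mollify \<eta> F z - mollify (pd (y - z) \<eta>) F z) \<le> e * norm (y - z)"
        if "norm (y - z) < d" for y using d(2)[OF that] by simp
      then show "\<exists>d>0. \<forall>y. norm (y - z) < d \<longrightarrow>
        norm (mollify \<eta> F y - mollify \<eta> F z - mollify (pd (y - z) \<eta>) F z) \<le> e * norm (y - z)"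
        using d(1) by blast
    qed
  qed
qed

lemma C_k_mol:
  assumes "loc_int r' F" "0 < r" "r < r'" "smooth \<eta>" "\<And>z. norm z > r \<Longrightarrow> \<eta> z = 0"
  shows "C_k m (mollify \<eta> F)"
  using assms(4,5)
proof (induction m arbitrary: \<eta>)
  case 0
  have "(mollify \<eta> F has_derivative (\<lambda>h. mollify (pd h \<eta>) F z)) (at z)" for z
    by (rule mol_has_derivative[OF 0 assms(1,3,2)])
  then have "continuous (at z) (mollify \<eta> F)" for z
    using has_derivative_continuous by blast
  then show ?case by (simp add: continuous_at_imp_continuous_on)
next
  case (Suc m)
  have d: "(mollify \<eta> F has_derivative (\<lambda>h. mollify (pd h \<eta>) F z)) (at z)" for z
    by (rule mol_has_derivative[OF Suc.prems assms(1,3,2)])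
  have pd: "pd b (mollify \<eta> F) = mollify (pd b \<eta>) F" for b by (intro ext pdI d)
  show ?case unfolding C_k_Suc
  proof (intro conjI allI ballI)
    show "mollify \<eta> F differentiable (at z)" for z using d unfolding differentiable_def by blast
    fix b :: 'a assume "b \<in> Basis"
    then show "C_k m (pd b (mollify \<eta> F))"
      unfolding pd
      by (intro Suc.IH smooth_pd[OF Suc.prems(1)] pd_eq_0_outside_cball[OF Suc.prems(2)])
  qed
qed

lemma smooth_mol:
  assumes "loc_int r' F" "0 < r" "r < r'" "smooth \<eta>" "\<And>z. norm z > r \<Longrightarrow> \<eta> z = 0"
  shows "smooth (mollify \<eta> F)"
  unfolding smooth_def[of "mollify \<eta> F"]
proof
  show "C_k m (mollify \<eta> F)" for m by (rule C_k_mol[OF assms])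
qed

lemma pd_mol:
  assumes "loc_int r' F" "0 < r" "r < r'" "smooth \<eta>" "\<And>z. norm z > r \<Longrightarrow> \<eta> z = 0"
  shows "pd b (mollify \<eta> F) = mollify (pd b \<eta>) F"
  by (intro ext pdI mol_has_derivative[OF assms(4,5,1,3,2)])

text \<open>
  For an even kernel, mollification and its adjoint coincide, while their derivatives differ
  by a sign. This sign is what cancels the time derivatives in the balance.
\<close>

lemma pd_odd:
  assumes "smooth \<eta>" "\<And>z. \<eta> (- z) = \<eta> z"
  shows "pd b \<eta> (- z) = - pd b \<eta> z"
proof -
  have "((\<lambda>z. \<eta> (- z)) has_derivative (\<lambda>h. pd (- h) \<eta> (- z))) (at z)"
    by (rule has_derivative_compose[OF has_derivative_minus[OF has_derivative_ident]
          smooth_derivative[OF assms(1)]])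
  then have "(\<eta> has_derivative (\<lambda>h. pd (- h) \<eta> (- z))) (at z)"
    unfolding assms(2) .
  then have "pd b \<eta> z = pd (- b) \<eta> (- z)" by (rule pdI)
  also have "\<dots> = - pd b \<eta> (- z)"
    by (rule linear_neg[OF has_derivative_linear[OF smooth_derivative[OF assms(1)]]])
  finally show ?thesis by simp
qed

section \<open>Continuity of translations in the mean\<close>

lemma lborel_shift:
  fixes w :: "'a::euclidean_space"
  shows "integrable lborel (\<lambda>z. G (z + w) :: real) \<longleftrightarrow> G \<in> borel_measurable borel \<and> integrable lborel G"
    (is "?A \<longleftrightarrow> ?B")
  and "G \<in> borel_measurable borel \<Longrightarrow> (LINT z|lborel. G (z + w)) = (LINT z|lborel. G z)"
  and "H \<in> borel_measurable borel \<Longrightarrow> (\<integral>\<^sup>+z. H (z + w) \<partial>lborel) = (\<integral>\<^sup>+z. (H z :: ennreal) \<partial>lborel)"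
proof -
  show "(LINT z|lborel. G (z + w)) = (LINT z|lborel. G z)" if "G \<in> borel_measurable borel"
    using that integral_distr[of "(+) w" lborel borel G] lborel_distr_plus[of w]
    by (simp add: add.commute)
  show "(\<integral>\<^sup>+z. H (z + w) \<partial>lborel) = (\<integral>\<^sup>+z. H z \<partial>lborel)" if "H \<in> borel_measurable borel"
    using that nn_integral_distr[of "(+) w" lborel borel H] lborel_distr_plus[of w]
    by (simp add: add.commute)
  show "?A \<longleftrightarrow> ?B"
  proof
    assume A: ?A
    then have "(\<lambda>z. G (z + w)) \<in> borel_measurable borel" by (auto dest: borel_measurable_integrable)
    then have "(\<lambda>z. G (z + w)) \<circ> (\<lambda>z. z - w) \<in> borel_measurable borel"
      by (rule measurable_comp[rotated]) measurable
    then have "G \<in> borel_measurable borel" by (simp add: comp_def)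
    then show ?B using A integrable_distr_eq[of "(+) w" lborel borel G] lborel_distr_plus[of w]
      by (simp add: add.commute)
  next
    assume ?B
    then show ?A using integrable_distr_eq[of "(+) w" lborel borel G] lborel_distr_plus[of w]
      by (simp add: add.commute)
  qed
qed

lemma integrable_shift:
  "integrable lborel G \<Longrightarrow> integrable lborel (\<lambda>z. G (z + w) :: real)"
  by (subst lborel_shift) (auto dest: borel_measurable_integrable)

lemma integral_shift:
  "integrable lborel G \<Longrightarrow> (LINT z|lborel. G (z + w)) = (LINT z|lborel. (G z :: real))"
  by (rule lborel_shift(2)) (auto dest: borel_measurable_integrable)

text \<open>
  Since both indicators have the same integral, the \<open>L\<^sup>1\<close> distance is twice the integral of the
  positive part of \<open>1\<^sub>U(z) - 1\<^sub>U(z + w)\<close>. That part is dominated by \<open>1\<^sub>U\<close> and, \<open>U\<close> being open,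
  vanishes eventually at each point.
\<close>

lemma L1_translation_open:
  fixes U :: "'a::euclidean_space set"
  assumes U: "open U" "emeasure lborel U < \<infinity>" and X: "X \<longlonglongrightarrow> 0"
  shows "(\<lambda>n. LINT z|lborel. \<bar>indicator U (z + X n) - indicator U z :: real\<bar>) \<longlonglongrightarrow> 0"
proof -
  let ?I = "indicator U :: 'a \<Rightarrow> real"
  have [measurable]: "U \<in> sets borel" using U by auto
  have iU: "integrable lborel ?I" using U by (simp add: integrable_indicator_iff)
  have "(\<lambda>n. LINT z|lborel. max 0 (?I z - ?I (z + X n))) \<longlonglongrightarrow> (LINT z|(lborel :: 'a measure). (0::real))"
  proof (rule Bochner_Integration.integral_dominated_convergence[where w = ?I])
    show "integrable lborel ?I" by (rule iU)
    show "AE z in lborel. (\<lambda>n. max 0 (?I z - ?I (z + X n))) \<longlonglongrightarrow> 0"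
    proof (rule AE_I2)
      fix z
      show "(\<lambda>n. max 0 (?I z - ?I (z + X n))) \<longlonglongrightarrow> 0"
      proof (cases "z \<in> U")
        case True
        have "(\<lambda>n. z + X n) \<longlonglongrightarrow> z + 0" by (intro tendsto_intros X)
        then have "\<forall>\<^sub>F n in sequentially. z + X n \<in> U"
          using topological_tendstoD[of _ z sequentially U] U True by simp
        then show ?thesis
          by (intro tendsto_eventually) (auto elim!: eventually_mono)
      next
        case False
        then show ?thesis by (simp add: indicator_def)
      qed
    qed
    show "AE z in lborel. norm (max 0 (?I z - ?I (z + X n))) \<le> ?I z" for n
      by (auto simp: indicator_def)
  qed auto
  moreover have "(LINT z|lborel. \<bar>?I (z + X n) - ?I z\<bar>) = 2 * (LINT z|lborel. max 0 (?I z - ?I (z + X n)))" for n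
  proof -
    have i: "integrable lborel (\<lambda>z. ?I (z + X n))" by (rule integrable_shift[OF iU])
    have m: "integrable lborel (\<lambda>z. max 0 (?I z - ?I (z + X n)))" using i iU by auto
    have "(LINT z|lborel. \<bar>?I (z + X n) - ?I z\<bar>) =
        (LINT z|lborel. 2 * max 0 (?I z - ?I (z + X n)) + (?I (z + X n) - ?I z))"
      by (rule Bochner_Integration.integral_cong) (auto simp: max_def)
    also have "\<dots> = 2 * (LINT z|lborel. max 0 (?I z - ?I (z + X n)))
        + ((LINT z|lborel. ?I (z + X n)) - (LINT z|lborel. ?I z))"
      using i iU m by simp
    also have "(LINT z|lborel. ?I (z + X n)) = (LINT z|lborel. ?I z)" by (rule integral_shift[OF iU])
    finally show ?thesis by simp
  qed
  ultimately show ?thesis using tendsto_mult_right_zero by fastforce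
qed

definition trans_cont :: "('a::euclidean_space \<Rightarrow> real) \<Rightarrow> bool" where
  "trans_cont G \<longleftrightarrow> (\<forall>X. X \<longlonglongrightarrow> 0 \<longrightarrow> (\<lambda>n. LINT z|lborel. \<bar>G (z + X n) - G z\<bar>) \<longlonglongrightarrow> 0)"

text \<open>
  Continuity of translations passes to \<open>L\<^sup>1\<close> limits because translations are isometries.
\<close>

lemma trans_cont_approx:
  assumes G: "integrable lborel G"
    and ap: "\<And>e. e > 0 \<Longrightarrow> \<exists>S. integrable lborel S \<and> trans_cont S \<and> (LINT z|lborel. \<bar>S z - G z\<bar>) \<le> e"
  shows "trans_cont G"
  unfolding trans_cont_def
proof (intro allI impI LIMSEQ_I)
  fix X :: "nat \<Rightarrow> 'a" and e :: real assume X: "X \<longlonglongrightarrow> 0" and e: "0 < e"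
  obtain S where S: "integrable lborel S" "trans_cont S" "(LINT z|lborel. \<bar>S z - G z\<bar>) \<le> e / 4"
    using ap[of "e / 4"] e by auto
  have "(\<lambda>n. LINT z|lborel. \<bar>S (z + X n) - S z\<bar>) \<longlonglongrightarrow> 0" using S(2) X unfolding trans_cont_def by blast
  then obtain N where N: "\<And>n. n \<ge> N \<Longrightarrow> norm ((LINT z|lborel. \<bar>S (z + X n) - S z\<bar>) - 0) < e / 4"
    using LIMSEQ_D[of _ 0 "e/4"] e by fastforce
  have "norm ((LINT z|lborel. \<bar>G (z + X n) - G z\<bar>) - 0) < e" if "n \<ge> N" for n
  proof -
    have i[simp]: "integrable lborel (\<lambda>z. S (z + X n))" "integrable lborel (\<lambda>z. G (z + X n))"
      by (rule integrable_shift, fact)+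
    have j[simp]: "integrable lborel (\<lambda>z. \<bar>S z - G z\<bar>)" using S(1) G by auto
    have k[simp]: "integrable lborel (\<lambda>z. \<bar>S (z + X n) - G (z + X n)\<bar>)" by (rule integrable_shift[OF j])
    have "(LINT z|lborel. \<bar>G (z + X n) - G z\<bar>) \<le>
       (LINT z|lborel. \<bar>S (z + X n) - G (z + X n)\<bar> + \<bar>S (z + X n) - S z\<bar> + \<bar>S z - G z\<bar>)"
      using S(1) G by (intro integral_mono) auto
    also have "\<dots> = (LINT z|lborel. \<bar>S (z + X n) - G (z + X n)\<bar>) + (LINT z|lborel. \<bar>S (z + X n) - S z\<bar>)
        + (LINT z|lborel. \<bar>S z - G z\<bar>)" using S(1) G by simp
    also have "(LINT z|lborel. \<bar>S (z + X n) - G (z + X n)\<bar>) = (LINT z|lborel. \<bar>S z - G z\<bar>)"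
      by (rule integral_shift[OF j])
    finally have "(LINT z|lborel. \<bar>G (z + X n) - G z\<bar>) < e" using N[OF that] S(3) e by simp
    moreover have "(LINT z|lborel. \<bar>G (z + X n) - G z\<bar>) \<ge> 0" by simp
    ultimately show ?thesis by simp
  qed
  then show "\<exists>no. \<forall>n\<ge>no. norm ((LINT z|lborel. \<bar>G (z + X n) - G z\<bar>) - 0) < e" by blast
qed

lemma trans_cont_cmult: "trans_cont G \<Longrightarrow> trans_cont (\<lambda>z. G z * c)"
  unfolding trans_cont_def
proof (intro allI impI)
  fix X :: "nat \<Rightarrow> 'a"
  assume "\<forall>X. X \<longlonglongrightarrow> 0 \<longrightarrow> (\<lambda>n. LINT z|lborel. \<bar>G (z + X n) - G z\<bar>) \<longlonglongrightarrow> 0" and X: "X \<longlonglongrightarrow> 0"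
  then have "(\<lambda>n. (LINT z|lborel. \<bar>G (z + X n) - G z\<bar>) * \<bar>c\<bar>) \<longlonglongrightarrow> 0"
    by (intro tendsto_mult_left_zero) auto
  then show "(\<lambda>n. LINT z|lborel. \<bar>G (z + X n) * c - G z * c\<bar>) \<longlonglongrightarrow> 0"
    by (simp add: left_diff_distrib[symmetric] abs_mult)
qed

text \<open>
  Open sets of finite measure approximate Borel sets by outer regularity; from there one goes to
  simple functions and to their limits.
\<close>

lemma integrable_imp_trans_cont:
  fixes G :: "'a::euclidean_space \<Rightarrow> real"
  assumes "integrable lborel G"
  shows "trans_cont G"
  using assms
proof (induction rule: integrable_induct)
  case (base A c)
  have A[measurable]: "A \<in> sets borel" using base by simp
  have iA: "integrable lborel (indicator A :: 'a \<Rightarrow> real)" using base by (simp add: integrable_indicator_iff)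
  have "trans_cont (indicator A :: 'a \<Rightarrow> real)"
  proof (rule trans_cont_approx[OF iA])
    fix e :: real assume e: "e > 0"
    obtain U where U: "open U" "A \<subseteq> U" "emeasure lborel (U - A) < ennreal e"
      using outer_regular_lborel[OF A e] by blast
    have [measurable]: "U \<in> sets borel" using U by auto
    have "emeasure lborel U \<le> emeasure lborel A + emeasure lborel (U - A)"
      using emeasure_subadditive[of A lborel "U - A"] U(2) by (simp add: Un_absorb1)
    also have "\<dots> < \<infinity>" using base U(3) by (auto simp: less_top[symmetric] intro: order.strict_trans)
    finally have fU: "emeasure lborel U < \<infinity>" .
    have iU: "integrable lborel (indicator U :: 'a \<Rightarrow> real)" using fU by (simp add: integrable_indicator_iff)
    have "(LINT z|lborel. \<bar>indicator U z - indicator A z :: real\<bar>) = (LINT z|lborel. indicator (U - A) z)"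
      using U(2) by (intro Bochner_Integration.integral_cong) (auto simp: indicator_def)
    also have "\<dots> = measure lborel (U - A)" by simp
    also have "\<dots> \<le> e" using U(3) e by (simp add: measure_def enn2real_leI less_imp_le)
    finally show "\<exists>S. integrable lborel S \<and> trans_cont S \<and> (LINT z|lborel. \<bar>S z - indicator A z\<bar>) \<le> e"
      using iU L1_translation_open[OF U(1) fU] unfolding trans_cont_def by blast
  qed
  then show ?case using trans_cont_cmult by simp
next
  case (add f g)
  show ?case unfolding trans_cont_def
  proof (intro allI impI)
    fix X :: "nat \<Rightarrow> 'a" assume X: "X \<longlonglongrightarrow> 0"
    have lim: "(\<lambda>n. (LINT z|lborel. \<bar>f (z + X n) - f z\<bar>) + (LINT z|lborel. \<bar>g (z + X n) - g z\<bar>)) \<longlonglongrightarrow> 0"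
      using add(3,4) X unfolding trans_cont_def by (intro tendsto_add_zero) auto
    show "(\<lambda>n. LINT z|lborel. \<bar>f (z + X n) + g (z + X n) - (f z + g z)\<bar>) \<longlonglongrightarrow> 0"
    proof (rule tendsto_sandwich[OF _ _ tendsto_const lim])
      show "\<forall>\<^sub>F n in sequentially. (LINT z|lborel. \<bar>f (z + X n) + g (z + X n) - (f z + g z)\<bar>)
        \<le> (LINT z|lborel. \<bar>f (z + X n) - f z\<bar>) + (LINT z|lborel. \<bar>g (z + X n) - g z\<bar>)"
      proof (rule always_eventually, rule allI)
        fix n
        have i[simp]: "integrable lborel (\<lambda>z. f (z + X n))" "integrable lborel (\<lambda>z. g (z + X n))"
          by (rule integrable_shift, fact)+
        have "(LINT z|lborel. \<bar>f (z + X n) + g (z + X n) - (f z + g z)\<bar>)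
          \<le> (LINT z|lborel. \<bar>f (z + X n) - f z\<bar> + \<bar>g (z + X n) - g z\<bar>)"
          using add(1,2) by (intro integral_mono) auto
        then show "(LINT z|lborel. \<bar>f (z + X n) + g (z + X n) - (f z + g z)\<bar>)
          \<le> (LINT z|lborel. \<bar>f (z + X n) - f z\<bar>) + (LINT z|lborel. \<bar>g (z + X n) - g z\<bar>)"
          using add(1,2) by simp
      qed
    qed simp
  qed
next
  case (lim f s)
  show ?case
  proof (rule trans_cont_approx[OF lim(4)])
    fix e :: real assume e: "e > 0"
    have "(\<lambda>i. LINT z|lborel. \<bar>s i z - f z\<bar>) \<longlonglongrightarrow> (LINT z|(lborel :: 'a measure). (0::real))"
    proof (rule Bochner_Integration.integral_dominated_convergence[where w = "\<lambda>z. 3 * \<bar>f z\<bar>"])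
      show "integrable lborel (\<lambda>z. 3 * \<bar>f z\<bar>)" using lim(4) by auto
      show "AE z in lborel. (\<lambda>i. \<bar>s i z - f z\<bar>) \<longlonglongrightarrow> 0"
        using lim(2) by (auto intro!: tendsto_rabs_zero simp: LIM_zero)
      show "AE z in lborel. norm \<bar>s i z - f z\<bar> \<le> 3 * \<bar>f z\<bar>" for i
      proof (rule AE_I2)
        show "norm \<bar>s i z - f z\<bar> \<le> 3 * \<bar>f z\<bar>" for z using lim(3)[of z i] by auto
      qed
    qed (use lim(1,4) in \<open>auto dest: borel_measurable_integrable\<close>)
    then obtain i where "norm ((LINT z|lborel. \<bar>s i z - f z\<bar>) - 0) < e"
      using LIMSEQ_D[of _ 0 e] e by fastforce
    then show "\<exists>S. integrable lborel S \<and> trans_cont S \<and> (LINT z|lborel. \<bar>S z - f z\<bar>) \<le> e"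
      using lim(1,5)[of i] by (intro exI[of _ "s i"]) auto
  qed
qed

section \<open>Integration of periodic functions over a fundamental cell\<close>

lemma periods_uminus: "k \<in> periods D \<Longrightarrow> - k \<in> periods D"
  by (cases D) auto

lemma closed_periods: "closed (periods D :: (real ^ 'n) set)"
proof (cases D)
  case Torus
  have "periods D = (\<Inter>i. (\<lambda>k :: real ^ 'n. k $ i) -` \<int>)" using Torus by auto
  also have "closed \<dots>"
    by (intro closed_INT ballI closed_vimage) (auto intro!: continuous_intros)
  finally show ?thesis .
qed auto

lemma countable_periods: "countable (periods D :: (real ^ 'n) set)"
proof (cases D)
  case Torus
  have "periods D \<subseteq> range (\<lambda>f :: 'n \<Rightarrow> int. \<chi> i. of_int (f i))"
  proof
    fix k :: "real ^ 'n" assume "k \<in> periods D"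
    then have "k = (\<chi> i. of_int \<lfloor>k $ i\<rfloor>)" using Torus by (simp add: vec_eq_iff)
    then show "k \<in> range (\<lambda>f :: 'n \<Rightarrow> int. \<chi> i. of_int (f i))"
      by (rule range_eqI[where x = "\<lambda>i. \<lfloor>k $ i\<rfloor>"])
  qed
  then show ?thesis by (rule countable_subset) auto
qed auto

lemma cell_borel[measurable]: "cell D \<in> sets borel"
proof (cases D)
  case Torus
  have "cell D = (\<Inter>i. {x :: real ^ 'a. 0 \<le> x $ i} \<inter> {x. x $ i < 1})" using Torus by auto
  also have "\<dots> \<in> sets borel"
    by (intro sets.finite_INT sets.Int borel_closed borel_open closed_Collect_le open_Collect_less)
      (auto intro!: continuous_intros)
  finally show ?thesis .
qed auto

text \<open>
  The translates of the cell by the periods tile the space.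
\<close>

lemma cell_unique:
  fixes x :: "real ^ 'n"
  obtains k where "k \<in> periods D" "x + k \<in> cell D" "\<And>l. l \<in> periods D \<Longrightarrow> x + l \<in> cell D \<Longrightarrow> l = k"
proof (cases D)
  case Torus
  let ?k = "(\<chi> i. - of_int \<lfloor>x $ i\<rfloor>) :: real ^ 'n"
  show ?thesis
  proof (rule that[of ?k])
    show "?k \<in> periods D" "x + ?k \<in> cell D" using Torus by (auto simp: algebra_simps) linarith
    fix l assume l: "l \<in> periods D" "x + l \<in> cell D"
    have "l $ i = - of_int \<lfloor>x $ i\<rfloor>" for i
    proof -
      obtain m where m: "l $ i = of_int m" using l(1) Torus by (auto elim: Ints_cases)
      have "0 \<le> x $ i + of_int m" "x $ i + of_int m < 1" using l(2) Torus m[symmetric] by auto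
      then have "\<lfloor>x $ i\<rfloor> = - m" by (intro floor_unique) auto
      then show ?thesis using m by simp
    qed
    then show "l = ?k" by (simp add: vec_eq_iff)
  qed
qed auto

text \<open>
  Lebesgue measure on the strip \<open>\<real> \<times> cell D\<close>, as a measure on all of space-time.
\<close>

definition cellm :: "domain \<Rightarrow> (real \<times> (real ^ 'n)) measure" where
  "cellm D = density lborel (indicator (UNIV \<times> cell D))"

lemma sets_cellm[measurable_cong, simp]: "sets (cellm D) = sets borel"
  and space_cellm[simp]: "space (cellm D) = UNIV"
  unfolding cellm_def by auto

lemma strip_borel[measurable]: "(UNIV :: real set) \<times> cell D \<in> sets borel"
  by (intro borel_Times) auto

lemma measurable_cellm[simp]: "measurable (cellm D) N = measurable borel N"
  by (rule measurable_cong_sets) auto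

lemma nn_integral_cellm:
  "F \<in> borel_measurable borel \<Longrightarrow>
    (\<integral>\<^sup>+z. F z \<partial>cellm D) = (\<integral>\<^sup>+z. indicator (UNIV \<times> cell D) z * F z \<partial>lborel)"
  unfolding cellm_def by (subst nn_integral_density) auto

lemma cellm_eq: "cellm D = density lborel (\<lambda>z. ennreal (indicator (UNIV \<times> cell D) z))"
  unfolding cellm_def by (simp add: ennreal_indicator)

lemma integrable_cellm:
  "F \<in> borel_measurable borel \<Longrightarrow>
    integrable (cellm D) F \<longleftrightarrow> integrable lborel (\<lambda>z. indicator (UNIV \<times> cell D) z *\<^sub>R (F z :: real))"
  unfolding cellm_eq by (subst integrable_density) auto

lemma integral_cellm:
  "F \<in> borel_measurable borel \<Longrightarrow>
    integral\<^sup>L (cellm D) F = (LINT z|lborel. indicator (UNIV \<times> cell D) z *\<^sub>R (F z :: real))"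
  unfolding cellm_eq by (subst integral_density) auto

lemma sigma_finite_cellm: "sigma_finite_measure (cellm D)"
  unfolding cellm_eq by (subst sigma_finite_measure.sigma_finite_iff_density_finite[OF sigma_finite_lborel]) auto

lemma count_cell:
  fixes z :: "real \<times> (real ^ 'n)"
  shows "(\<integral>\<^sup>+k. indicator (UNIV \<times> cell D) (z + (0, k)) \<partial>count_space (periods D)) = 1"
proof -
  obtain k where k: "k \<in> periods D" "snd z + k \<in> cell D"
    "\<And>l. l \<in> periods D \<Longrightarrow> snd z + l \<in> cell D \<Longrightarrow> l = k"
    using cell_unique by blast
  have "(\<integral>\<^sup>+k. indicator (UNIV \<times> cell D) (z + (0, k)) \<partial>count_space (periods D))
      = (\<integral>\<^sup>+l. indicator {k} l \<partial>count_space (periods D))"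
  proof (rule nn_integral_cong)
    fix l :: "real ^ 'n" assume "l \<in> space (count_space (periods D))"
    then have "z + (0, l) \<in> UNIV \<times> cell D \<longleftrightarrow> l = k"
      using k(2) k(3)[of l] by (auto simp: mem_Times_iff)
    then show "indicator (UNIV \<times> cell D) (z + (0, l)) = (indicator {k} l :: ennreal)"
      by (simp add: indicator_def)
  qed
  also have "\<dots> = 1" using k(1) by (subst nn_integral_indicator) auto
  finally show ?thesis .
qed

text \<open>
  Unfolding: the strip is a fundamental domain for the translations by periods.
\<close>

lemma nn_integral_unfold:
  assumes [measurable]: "H \<in> borel_measurable borel"
  shows "(\<integral>\<^sup>+z. (\<integral>\<^sup>+k. H (z + (0, k)) \<partial>count_space (periods D)) \<partial>cellm D) = (\<integral>\<^sup>+z. H z \<partial>lborel)"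
proof -
  let ?S = "UNIV \<times> cell D :: (real \<times> (real ^ 'a)) set"
  have "(\<integral>\<^sup>+z. (\<integral>\<^sup>+k. H (z + (0, k)) \<partial>count_space (periods D)) \<partial>cellm D)
    = (\<integral>\<^sup>+k. (\<integral>\<^sup>+z. H (z + (0, k)) \<partial>cellm D) \<partial>count_space (periods D))"
    by (rule nn_integral_count_space_nn_integral) (auto intro: countable_periods)
  also have "\<dots> = (\<integral>\<^sup>+k. (\<integral>\<^sup>+z. indicator ?S (z - (0, k)) * H z \<partial>lborel) \<partial>count_space (periods D))"
  proof (rule nn_integral_cong)
    fix k :: "real ^ 'a"
    have "(\<integral>\<^sup>+z. H (z + (0, k)) \<partial>cellm D) = (\<integral>\<^sup>+z. indicator ?S z * H (z + (0, k)) \<partial>lborel)"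
      by (rule nn_integral_cellm) measurable
    also have "\<dots> = (\<integral>\<^sup>+z. indicator ?S (z + (0,k) - (0, k)) * H (z + (0, k)) \<partial>lborel)" by simp
    also have "\<dots> = (\<integral>\<^sup>+z. indicator ?S (z - (0, k)) * H z \<partial>lborel)"
      by (rule lborel_shift(3)) measurable
    finally show "(\<integral>\<^sup>+z. H (z + (0, k)) \<partial>cellm D) = (\<integral>\<^sup>+z. indicator ?S (z - (0, k)) * H z \<partial>lborel)" .
  qed
  also have "\<dots> = (\<integral>\<^sup>+z. (\<integral>\<^sup>+k. indicator ?S (z - (0, k)) * H z \<partial>count_space (periods D)) \<partial>lborel)"
    by (rule nn_integral_count_space_nn_integral[symmetric]) (auto intro: countable_periods)
  also have "\<dots> = (\<integral>\<^sup>+z. H z \<partial>lborel)"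
  proof (rule nn_integral_cong)
    fix z :: "real \<times> (real ^ 'a)"
    have "(\<integral>\<^sup>+k. indicator ?S (z - (0, k)) \<partial>count_space (periods D))
       = (\<integral>\<^sup>+k. indicator ?S (z + (0, - k)) \<partial>count_space (periods D))"
      by (intro nn_integral_cong) (simp add: plus_prod_def minus_prod_def case_prod_unfold)
    also have "\<dots> = (\<integral>\<^sup>+k. indicator ?S (z + (0, k)) \<partial>count_space (periods D))"
      by (rule nn_integral_bij_count_space)
        (auto intro!: bij_betwI[where g = uminus] simp: periods_uminus)
    also have "\<dots> = 1" by (rule count_cell)
    finally show "(\<integral>\<^sup>+k. indicator ?S (z - (0, k)) * H z \<partial>count_space (periods D)) = H z"
      by (simp add: nn_integral_multc)
  qed
  finally show ?thesis .
qed

definition x_periodic :: "domain \<Rightarrow> (real \<times> (real ^ 'n) \<Rightarrow> 'b) \<Rightarrow> bool" where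
  "x_periodic D F \<longleftrightarrow> (\<forall>z. \<forall>k\<in>periods D. F (z + (0, k)) = F z)"

lemma x_periodicD: "x_periodic D F \<Longrightarrow> k \<in> periods D \<Longrightarrow> F (z + (0, k)) = F z"
  unfolding x_periodic_def by blast

text \<open>
  The translated strip is again a fundamental domain: by unfolding, every periodic function has
  the same integral over it.
\<close>

lemma nn_integral_cellm_shift:
  assumes [measurable]: "H \<in> borel_measurable borel" and p: "x_periodic D H"
  shows "(\<integral>\<^sup>+z. H (z + w) \<partial>cellm D) = (\<integral>\<^sup>+z. (H z :: ennreal) \<partial>cellm D)"
proof -
  let ?S = "UNIV \<times> cell D :: (real \<times> (real ^ 'a)) set"
  have "(\<integral>\<^sup>+z. H (z + w) \<partial>cellm D) = (\<integral>\<^sup>+z. indicator ?S (z + w - w) * H (z + w) \<partial>lborel)"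
    by (subst nn_integral_cellm) auto
  also have "\<dots> = (\<integral>\<^sup>+z. indicator ?S (z - w) * H z \<partial>lborel)"
    by (rule lborel_shift(3)) measurable
  also have "\<dots> = (\<integral>\<^sup>+z. (\<integral>\<^sup>+k. indicator ?S (z + (0,k) - w) * H (z + (0,k)) \<partial>count_space (periods D)) \<partial>cellm D)"
    by (rule nn_integral_unfold[symmetric]) measurable
  also have "\<dots> = (\<integral>\<^sup>+z. H z \<partial>cellm D)"
  proof (rule nn_integral_cong)
    fix z
    have "(\<integral>\<^sup>+k. indicator ?S (z + (0,k) - w) * H (z + (0,k)) \<partial>count_space (periods D))
      = (\<integral>\<^sup>+k. indicator ?S (z - w + (0,k)) * H z \<partial>count_space (periods D))"
    proof (rule nn_integral_cong)
      fix k :: "real ^ 'a" assume "k \<in> space (count_space (periods D))"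
      then have "H (z + (0, k)) = H z" using p by (intro x_periodicD) auto
      then show "indicator ?S (z + (0,k) - w) * H (z + (0,k)) = indicator ?S (z - w + (0,k)) * H z"
        by (simp add: algebra_simps)
    qed
    also have "\<dots> = (\<integral>\<^sup>+k. indicator ?S (z - w + (0,k)) \<partial>count_space (periods D)) * H z"
      by (simp add: nn_integral_multc)
    also have "\<dots> = H z" by (simp add: count_cell)
    finally show "(\<integral>\<^sup>+k. indicator ?S (z + (0,k) - w) * H (z + (0,k)) \<partial>count_space (periods D)) = H z" .
  qed
  finally show ?thesis .
qed

lemma cellm_shift:
  assumes F: "integrable (cellm D) F" and p: "x_periodic D F"
  shows "integrable (cellm D) (\<lambda>z. F (z + w) :: real)"
    and "(LINT z|cellm D. F (z + w)) = (LINT z|cellm D. F z)"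
proof -
  have [measurable]: "F \<in> borel_measurable borel" using F by (auto dest: borel_measurable_integrable)
  have sh: "(\<integral>\<^sup>+z. ennreal (g (F (z + w))) \<partial>cellm D) = (\<integral>\<^sup>+z. ennreal (g (F z)) \<partial>cellm D)"
    if [measurable]: "g \<in> borel_measurable borel" for g :: "real \<Rightarrow> real"
    by (rule nn_integral_cellm_shift[of "\<lambda>z. ennreal (g (F z))"]) (use p in \<open>auto simp: x_periodic_def\<close>)
  show i: "integrable (cellm D) (\<lambda>z. F (z + w) :: real)"
  proof (rule integrableI_bounded)
    show "(\<integral>\<^sup>+z. ennreal (norm (F (z + w))) \<partial>cellm D) < \<infinity>"
      using F sh[of norm] by (simp add: integrable_iff_bounded)
  qed simp
  show "(LINT z|cellm D. F (z + w)) = (LINT z|cellm D. F z)"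
    using sh[of "\<lambda>x. x"] sh[of "\<lambda>x. - x"] by (simp add: real_lebesgue_integral_def[OF i] real_lebesgue_integral_def[OF F])
qed

lemma sum_le_nn_integral_count_space:
  assumes "finite A" "A \<subseteq> I"
  shows "(\<Sum>k\<in>A. f k) \<le> (\<integral>\<^sup>+k. f k \<partial>count_space I)"
proof -
  have "(\<Sum>k\<in>A. f k) = (\<integral>\<^sup>+k. f k * indicator A k \<partial>count_space I)"
    using assms by (subst nn_integral_indicator_finite) (auto simp: subset_eq intro!: sum.cong)
  also have "\<dots> \<le> (\<integral>\<^sup>+k. f k \<partial>count_space I)"
    by (intro nn_integral_mono) (auto simp: indicator_def)
  finally show ?thesis .
qed

text \<open>
  Let \<open>G\<close> be \<open>F\<close> cut off to the strip, an integrable function on the whole of space-time. At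
  most two translates of \<open>G\<close> contribute to \<open>F (z + w) - F z\<close>, so the increments of \<open>F\<close> over the
  strip are controlled, after unfolding, by those of \<open>G\<close>.
\<close>

lemma cellm_trans_cont:
  assumes F: "integrable (cellm D) F" and p: "x_periodic D F" and X: "X \<longlonglongrightarrow> 0"
  shows "(\<lambda>n. LINT z|cellm D. \<bar>F (z + X n) - F z :: real\<bar>) \<longlonglongrightarrow> 0"
proof -
  let ?S = "UNIV \<times> cell D :: (real \<times> (real ^ 'a)) set"
  have [measurable]: "F \<in> borel_measurable borel" using F by (auto dest: borel_measurable_integrable)
  define G where "G z = indicator ?S z *\<^sub>R F z" for z
  have G: "integrable lborel G"
    using F unfolding G_def by (subst (asm) integrable_cellm) auto
  then have [measurable]: "G \<in> borel_measurable borel" by (auto dest: borel_measurable_integrable)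
  have ineq: "(LINT z|cellm D. \<bar>F (z + w) - F z\<bar>) \<le> (LINT z|lborel. \<bar>G (z + w) - G z\<bar>)" for w
  proof -
    have iG: "integrable lborel (\<lambda>z. \<bar>G (z + w) - G z\<bar>)" using integrable_shift[OF G, of w] G by auto
    have iF: "integrable (cellm D) (\<lambda>z. \<bar>F (z + w) - F z\<bar>)" using cellm_shift(1)[OF F p, of w] F by auto
    have pt: "ennreal \<bar>F (z + w) - F z\<bar> \<le>
      (\<integral>\<^sup>+k. ennreal \<bar>G (z + (0,k) + w) - G (z + (0,k))\<bar> \<partial>count_space (periods D))" for z
    proof -
      obtain k where k: "k \<in> periods D" "snd z + k \<in> cell D"
        "\<And>l. l \<in> periods D \<Longrightarrow> snd z + l \<in> cell D \<Longrightarrow> l = k"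
        using cell_unique by blast
      obtain k' where k': "k' \<in> periods D" "snd (z + w) + k' \<in> cell D"
        "\<And>l. l \<in> periods D \<Longrightarrow> snd (z + w) + l \<in> cell D \<Longrightarrow> l = k'"
        using cell_unique by blast
      have F1: "F (z + (0, l)) = F z" "F (z + (0, l) + w) = F (z + w)" if "l \<in> periods D" for l
      proof -
        have eq: "z + (0, l) + w = z + w + (0, l)" by (simp add: algebra_simps)
        show "F (z + (0, l) + w) = F (z + w)" unfolding eq by (rule x_periodicD[OF p that])
        show "F (z + (0, l)) = F z" by (rule x_periodicD[OF p that])
      qed
      have G1: "G (z + (0, l)) = (if l = k then F z else 0)" if "l \<in> periods D" for l
      proof -
        have "z + (0, l) \<in> ?S \<longleftrightarrow> l = k" using k(2) k(3)[OF that] by (auto simp: mem_Times_iff)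
        then show ?thesis using F1[OF that] by (simp add: G_def indicator_def)
      qed
      have G2: "G (z + (0, l) + w) = (if l = k' then F (z + w) else 0)" if "l \<in> periods D" for l
      proof -
        have eq: "snd (z + (0, l) + w) = snd (z + w) + l" by (simp add: algebra_simps)
        have "z + (0, l) + w \<in> ?S \<longleftrightarrow> l = k'" unfolding mem_Times_iff eq using k'(2) k'(3)[OF that] by blast
        then show ?thesis using F1[OF that] by (simp add: G_def indicator_def)
      qed
      have "ennreal \<bar>F (z + w) - F z\<bar> \<le> (\<Sum>l\<in>{k,k'}. ennreal \<bar>G (z + (0,l) + w) - G (z + (0,l))\<bar>)"
      proof (cases "k = k'")
        case True
        then show ?thesis using G1[OF k(1)] G2[OF k(1)] by simp
      next
        case False
        have "ennreal \<bar>F (z + w) - F z\<bar> \<le> ennreal (\<bar>F z\<bar> + \<bar>F (z + w)\<bar>)"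
          by (rule ennreal_leI) linarith
        also have "\<dots> = ennreal \<bar>F z\<bar> + ennreal \<bar>F (z + w)\<bar>" by (rule ennreal_plus) auto
        finally show ?thesis
          using False G1[OF k(1)] G1[OF k'(1)] G2[OF k(1)] G2[OF k'(1)] by simp
      qed
      also have "\<dots> \<le> (\<integral>\<^sup>+k. ennreal \<bar>G (z + (0,k) + w) - G (z + (0,k))\<bar> \<partial>count_space (periods D))"
        using k(1) k'(1) by (intro sum_le_nn_integral_count_space) auto
      finally show ?thesis .
    qed
    have "ennreal (LINT z|cellm D. \<bar>F (z + w) - F z\<bar>) = (\<integral>\<^sup>+z. ennreal \<bar>F (z + w) - F z\<bar> \<partial>cellm D)"
      by (rule nn_integral_eq_integral[symmetric, OF iF]) auto
    also have "\<dots> \<le> (\<integral>\<^sup>+z. (\<integral>\<^sup>+k. ennreal \<bar>G (z + (0,k) + w) - G (z + (0,k))\<bar> \<partial>count_space (periods D)) \<partial>cellm D)"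
      by (intro nn_integral_mono pt)
    also have "\<dots> = (\<integral>\<^sup>+z. ennreal \<bar>G (z + w) - G z\<bar> \<partial>lborel)"
      by (rule nn_integral_unfold[of "\<lambda>z. ennreal \<bar>G (z + w) - G z\<bar>"]) measurable
    also have "\<dots> = ennreal (LINT z|lborel. \<bar>G (z + w) - G z\<bar>)"
      by (rule nn_integral_eq_integral[OF iG]) auto
    finally have "ennreal (LINT z|cellm D. \<bar>F (z + w) - F z\<bar>) \<le> ennreal (LINT z|lborel. \<bar>G (z + w) - G z\<bar>)" .
    moreover have "0 \<le> (LINT z|lborel. \<bar>G (z + w) - G z\<bar>)" by (rule Bochner_Integration.integral_nonneg) auto
    ultimately show ?thesis using ennreal_le_iff by blast
  qed
  have "(\<lambda>n. LINT z|lborel. \<bar>G (z + X n) - G z\<bar>) \<longlonglongrightarrow> 0"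
    using integrable_imp_trans_cont[OF G] X unfolding trans_cont_def by blast
  show ?thesis
  proof (rule tendsto_sandwich[OF always_eventually always_eventually tendsto_const])
    show "\<forall>n. 0 \<le> (LINT z|cellm D. \<bar>F (z + X n) - F z\<bar>)" by (intro allI Bochner_Integration.integral_nonneg) auto
    show "\<forall>n. (LINT z|cellm D. \<bar>F (z + X n) - F z\<bar>) \<le> (LINT z|lborel. \<bar>G (z + X n) - G z\<bar>)"
      by (intro allI ineq)
  qed fact
qed

section \<open>Test functions\<close>

lemma x_periodic_iff_periodic: "x_periodic D F \<longleftrightarrow> (\<forall>t. periodic D (\<lambda>x. F (t, x)))"
  unfolding x_periodic_def periodic_def by auto

text \<open>
  All translates of \<open>K\<close> by periods: the set in which a test function with support controlled by
  \<open>K\<close> may be nonzero.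
\<close>

definition periodic_hull :: "domain \<Rightarrow> (real \<times> (real ^ 'n)) set \<Rightarrow> (real \<times> (real ^ 'n)) set" where
  "periodic_hull D K = {z. \<exists>k\<in>periods D. z + (0, k) \<in> K}"

lemma test_function_iff:
  "test_function J D \<phi> \<longleftrightarrow> smooth \<phi> \<and> x_periodic D \<phi> \<and>
     (\<exists>K. compact K \<and> K \<subseteq> J \<times> UNIV \<and> (\<forall>z. z \<notin> periodic_hull D K \<longrightarrow> \<phi> z = 0))"
proof -
  have "(\<forall>t x. \<phi> (t, x) \<noteq> 0 \<longrightarrow> (\<exists>k\<in>periods D. (t, x + k) \<in> K)) \<longleftrightarrow> (\<forall>z. z \<notin> periodic_hull D K \<longrightarrow> \<phi> z = 0)" for K
    unfolding periodic_hull_def split_paired_All by simp blast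
  then show ?thesis unfolding test_function_def x_periodic_iff_periodic by simp
qed

lemma closed_periodic_hull:
  assumes "compact K" shows "closed (periodic_hull D K)"
proof -
  have "periodic_hull D K = (\<Union>x\<in>K. \<Union>y\<in>{0} \<times> periods D. {x + y})"
  proof (intro set_eqI iffI)
    fix z assume "z \<in> periodic_hull D K"
    then obtain k where k: "k \<in> periods D" "z + (0, k) \<in> K" unfolding periodic_hull_def by blast
    have "z = (z + (0, k)) + (0, - k)" by (simp add: prod_eq_iff)
    then show "z \<in> (\<Union>x\<in>K. \<Union>y\<in>{0} \<times> periods D. {x + y})"
      using k periods_uminus[OF k(1)] by blast
  next
    fix z assume "z \<in> (\<Union>x\<in>K. \<Union>y\<in>{0} \<times> periods D. {x + y})"
    then obtain x k where k: "x \<in> K" "k \<in> periods D" "z = x + (0, k)" by blast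
    then have "z + (0, - k) = x" by (simp add: prod_eq_iff)
    then have "z + (0, - k) \<in> K" using k(1) by simp
    then show "z \<in> periodic_hull D K" unfolding periodic_hull_def using periods_uminus[OF k(2)] by blast
  qed
  also have "closed \<dots>"
    by (rule compact_closed_sums[OF assms]) (intro closed_Times closed_periods closed_singleton)
  finally show ?thesis .
qed

text \<open>
  Periodic test functions have supports of finite measure in the strip. This compensates for the
  lack of integrability at infinity of \<open>v\<close> and \<open>\<bar>v\<bar>\<^sup>2\<close> on the whole space.
\<close>

lemma emeasure_periodic_hull:
  fixes K :: "(real \<times> (real ^ 'n)) set"
  assumes K: "compact K" shows "emeasure (cellm D) (periodic_hull D K) < \<infinity>"
proof -
  have [measurable]: "K \<in> sets borel" "periodic_hull D K \<in> sets borel"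
    using K closed_periodic_hull[OF K] by (auto intro: borel_compact borel_closed)
  have "emeasure (cellm D) (periodic_hull D K) = (\<integral>\<^sup>+z. indicator (periodic_hull D K) z \<partial>cellm D)" by simp
  also have "\<dots> \<le> (\<integral>\<^sup>+z. (\<integral>\<^sup>+k. indicator K (z + (0, k)) \<partial>count_space (periods D)) \<partial>cellm D)"
  proof (rule nn_integral_mono)
    fix z
    show "indicator (periodic_hull D K) z \<le> (\<integral>\<^sup>+k. indicator K (z + (0, k)) \<partial>count_space (periods D) :: ennreal)"
    proof (cases "z \<in> periodic_hull D K")
      case True
      then obtain k where k: "k \<in> periods D" "z + (0, k) \<in> K" unfolding periodic_hull_def by blast
      have "(\<Sum>k\<in>{k}. indicator K (z + (0, k))) \<le>
          (\<integral>\<^sup>+k. indicator K (z + (0, k)) \<partial>count_space (periods D) :: ennreal)"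
        by (rule sum_le_nn_integral_count_space) (use k in auto)
      then show ?thesis using True k by simp
    qed simp
  qed
  also have "\<dots> = (\<integral>\<^sup>+z. indicator K z \<partial>lborel)" by (rule nn_integral_unfold) measurable
  also have "\<dots> = emeasure lborel K" by simp
  also have "\<dots> < \<infinity>" using K by (rule emeasure_compact_finite)
  finally show ?thesis .
qed

text \<open>
  What the integral estimates use of a test function and of its derivatives.
\<close>

definition cutoff :: "domain \<Rightarrow> (real \<times> (real ^ 'n) \<Rightarrow> real) \<Rightarrow> bool" where
  "cutoff D g \<longleftrightarrow> g \<in> borel_measurable borel \<and> x_periodic D g \<and> (\<exists>B. \<forall>z. \<bar>g z\<bar> \<le> B) \<and> integrable (cellm D) g"

lemma cutoffI:
  fixes g :: "real \<times> (real ^ 'n) \<Rightarrow> real"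
  assumes c: "continuous_on UNIV g" and p: "x_periodic D g" and K: "compact K" and 0: "\<And>z. z \<notin> periodic_hull D K \<Longrightarrow> g z = 0"
  shows "cutoff D g"
proof -
  have [measurable]: "g \<in> borel_measurable borel" using c by (rule borel_measurable_continuous_onI)
  have [measurable]: "periodic_hull D K \<in> sets borel" using closed_periodic_hull[OF K] by (rule borel_closed)
  have "bounded (g ` K)"
    by (intro compact_imp_bounded compact_continuous_image continuous_on_subset[OF c] K) auto
  then obtain B where B: "B > 0" "\<forall>y\<in>g`K. norm y \<le> B" unfolding bounded_pos by blast
  have b: "\<bar>g z\<bar> \<le> B * indicator (periodic_hull D K) z" for z
  proof (cases "z \<in> periodic_hull D K")
    case True
    then obtain k where k: "k \<in> periods D" "z + (0, k) \<in> K" unfolding periodic_hull_def by blast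
    have "g z = g (z + (0, k))" by (rule x_periodicD[OF p k(1), symmetric])
    then show ?thesis using B(2) k(2) True by auto
  qed (simp add: 0)
  then have b': "\<bar>g z\<bar> \<le> B" for z using b[of z] B(1) by (cases "z \<in> periodic_hull D K") auto
  have "integrable (cellm D) (\<lambda>z. B * indicator (periodic_hull D K) z)"
    using emeasure_periodic_hull[OF K, of D] by (intro integrable_mult_right) (simp add: integrable_indicator_iff)
  then have "integrable (cellm D) g"
  proof (rule Bochner_Integration.integrable_bound)
    show "AE z in cellm D. norm (g z) \<le> norm (B * indicator (periodic_hull D K) z)"
    proof (rule AE_I2)
      fix z
      show "norm (g z) \<le> norm (B * indicator (periodic_hull D K) z)"
        using b[of z] unfolding real_norm_def by (rule order_trans[OF _ abs_ge_self])
    qed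
  qed simp
  then show ?thesis unfolding cutoff_def using p b' by auto
qed

lemma x_periodic_pd:
  fixes \<phi> :: "real \<times> (real ^ 'n) \<Rightarrow> real"
  assumes s: "smooth \<phi>" and p: "x_periodic D \<phi>" shows "x_periodic D (pd b \<phi>)"
  unfolding x_periodic_def
proof (intro allI ballI)
  fix z :: "real \<times> (real ^ 'n)" and k :: "real ^ 'n" assume k: "k \<in> periods D"
  have d: "((\<lambda>z. z + (0, k)) has_derivative (\<lambda>h. h)) (at z)" by (auto intro!: derivative_eq_intros)
  have "((\<lambda>z. \<phi> (z + (0, k))) has_derivative (\<lambda>h. pd h \<phi> (z + (0, k)))) (at z)"
    by (rule has_derivative_compose[OF d smooth_derivative[OF s]])
  then have "(\<phi> has_derivative (\<lambda>h. pd h \<phi> (z + (0, k)))) (at z)" unfolding x_periodicD[OF p k] .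
  then show "pd b \<phi> (z + (0, k)) = pd b \<phi> z" by (rule pdI[symmetric])
qed

lemma cutoff_test_function:
  assumes "test_function J D \<phi>"
  shows "cutoff D \<phi>" and "b \<in> Basis \<Longrightarrow> cutoff D (pd b \<phi>)"
proof -
  obtain K where s: "smooth \<phi>" and p: "x_periodic D \<phi>" and K: "compact K" and 0: "\<And>z. z \<notin> periodic_hull D K \<Longrightarrow> \<phi> z = 0"
    using assms unfolding test_function_iff by blast
  show "cutoff D \<phi>" by (rule cutoffI[OF smooth_continuous[OF s] p K 0])
  show "cutoff D (pd b \<phi>)" if b: "b \<in> Basis"
  proof (rule cutoffI[OF smooth_continuous[OF smooth_pd[OF s b]] x_periodic_pd[OF s p] K])
    show "pd b \<phi> z = 0" if "z \<notin> periodic_hull D K" for z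
      by (rule pd_eq_0_outside[OF closed_periodic_hull[OF K] 0 that])
  qed
qed

lemma test_function_mult:
  assumes "test_function J D \<psi>" "smooth g" "x_periodic D g"
  shows "test_function J D (\<lambda>z. \<psi> z * g z)"
proof -
  obtain K where s: "smooth \<psi>" and p: "x_periodic D \<psi>" and K: "compact K" "K \<subseteq> J \<times> UNIV"
    and 0: "\<And>z. z \<notin> periodic_hull D K \<Longrightarrow> \<psi> z = 0"
    using assms(1) unfolding test_function_iff by blast
  have "x_periodic D (\<lambda>z. \<psi> z * g z)"
    unfolding x_periodic_def using x_periodicD[OF p] x_periodicD[OF assms(3)] by presburger
  moreover have "\<forall>z. z \<notin> periodic_hull D K \<longrightarrow> \<psi> z * g z = 0" using 0 by simp
  ultimately show ?thesis
    unfolding test_function_iff using K smooth_mult[OF s assms(2)] by blast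
qed

lemma x_periodic_mol:
  fixes F :: "real \<times> (real ^ 'n) \<Rightarrow> real"
  assumes [measurable]: "F \<in> borel_measurable borel" "\<eta> \<in> borel_measurable borel" and p: "x_periodic D F"
  shows "x_periodic D (mollify \<eta> F)"
  unfolding x_periodic_def mollify_def
proof (intro allI ballI)
  fix z :: "real \<times> (real ^ 'n)" and k :: "real ^ 'n" assume k: "k \<in> periods D"
  have "(LINT u|lborel. \<eta> (z + (0, k) - u) * F u) = (LINT u|lborel. \<eta> (z + (0, k) - (u + (0, k))) * F (u + (0, k)))"
    by (rule lborel_shift(2)[symmetric]) measurable
  also have "\<dots> = (LINT u|lborel. \<eta> (z - u) * F u)" unfolding x_periodicD[OF p k] by simp
  finally show "(LINT u|lborel. \<eta> (z + (0, k) - u) * F u) = (LINT u|lborel. \<eta> (z - u) * F u)" .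
qed

definition kernel :: "real \<Rightarrow> ('a::euclidean_space \<Rightarrow> real) \<Rightarrow> bool" where
  "kernel r \<eta> \<longleftrightarrow> smooth \<eta> \<and> (\<forall>z. norm z > r \<longrightarrow> \<eta> z = 0)"

lemma kernel_pd: "kernel r \<eta> \<Longrightarrow> b \<in> Basis \<Longrightarrow> kernel r (pd b \<eta>)"
  unfolding kernel_def using smooth_pd pd_eq_0_outside_cball by blast

lemma kernel_borel: "kernel r \<eta> \<Longrightarrow> \<eta> \<in> borel_measurable borel"
  unfolding kernel_def using smooth_borel by blast

lemma kernel_bounded:
  assumes "kernel r \<eta>" obtains B where "B > 0" "\<And>z. \<bar>\<eta> z\<bar> \<le> B" 
proof -
  have "continuous_on UNIV \<eta>" using assms smooth_continuous unfolding kernel_def by blast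
  moreover have "\<eta> z = 0" if "z \<notin> cball 0 r" for z using assms that unfolding kernel_def by simp
  ultimately show ?thesis using compact_support_bounded[OF _ compact_cball, of \<eta> 0 r] that by metis
qed

lemma kernel_integrable:
  assumes "kernel r \<eta>" shows "integrable lborel \<eta>"
proof -
  obtain B where B: "B > 0" "\<And>z. \<bar>\<eta> z\<bar> \<le> B" using kernel_bounded[OF assms] by blast
  have "integrable lborel (\<lambda>z::'a. B * indicator (cball 0 r) z)"
    using emeasure_compact_finite[OF compact_cball, of 0 r]
    by (intro integrable_mult_right) (simp add: integrable_indicator_iff)
  then show ?thesis
  proof (rule Bochner_Integration.integrable_bound)
    show "AE z in lborel. norm (\<eta> z) \<le> norm (B * indicator (cball 0 r) z)"
    proof (rule AE_I2)
      fix z show "norm (\<eta> z) \<le> norm (B * indicator (cball 0 r) z)"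
        using B(1) B(2)[of z] assms by (cases "z \<in> cball 0 r") (auto simp: kernel_def)
    qed
  qed (use kernel_borel[OF assms] in simp)
qed

text \<open>
  Mollification enlarges supports. The number \<open>r0\<close> bounds the kernel radii for which the
  mollification of \<open>\<psi> G\<close> keeps its support inside \<open>J\<close>. The radius \<open>1/4\<close> is below half the side of
  the unit cell, so a ball of that radius fits into a translate of the cell.
\<close>

definition mollifiable :: "real set \<Rightarrow> domain \<Rightarrow> (real \<times> (real ^ 'n) \<Rightarrow> real) \<Rightarrow> real \<Rightarrow> bool" where
  "mollifiable J D \<psi> r0 \<longleftrightarrow> (\<forall>r \<eta> G. 0 < r \<longrightarrow> r \<le> r0 \<longrightarrow> kernel r \<eta> \<longrightarrow> x_periodic D G \<longrightarrow>
     loc_int (1/4) (\<lambda>z. \<psi> z * G z) \<longrightarrow> G \<in> borel_measurable borel \<longrightarrow> r < 1/4 \<longrightarrow>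
     test_function J D (mollify \<eta> (\<lambda>z. \<psi> z * G z)))"

lemma mollifiableD:
  "mollifiable J D \<psi> r0 \<Longrightarrow> 0 < r \<Longrightarrow> r \<le> r0 \<Longrightarrow> kernel r \<eta> \<Longrightarrow> x_periodic D G \<Longrightarrow>
     loc_int (1/4) (\<lambda>z. \<psi> z * G z) \<Longrightarrow> G \<in> borel_measurable borel \<Longrightarrow> r < 1/4 \<Longrightarrow>
     test_function J D (mollify \<eta> (\<lambda>z. \<psi> z * G z))"
  unfolding mollifiable_def by blast

lemma test_function_mollifiable:
  fixes \<psi> :: "real \<times> (real ^ 'n) \<Rightarrow> real"
  assumes "test_function J D \<psi>" and "open J"
  obtains r where "r > 0" "mollifiable J D \<psi> r"
proof -
  obtain K where s: "smooth \<psi>" and p: "x_periodic D \<psi>" and K: "compact K" "K \<subseteq> J \<times> UNIV"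
    and 0: "\<And>z. z \<notin> periodic_hull D K \<Longrightarrow> \<psi> z = 0"
    using assms(1) unfolding test_function_iff by blast
  have "open (J \<times> (UNIV :: (real ^ 'n) set))" using assms(2) by (intro open_Times) auto
  then obtain r where r: "r > 0" "(\<Union>x\<in>K. cball x r) \<subseteq> J \<times> UNIV"
    using compact_subset_open_imp_cball_epsilon_subset[OF K(1) _ K(2)] by metis
  show ?thesis
  proof (rule that[OF r(1)], unfold mollifiable_def, intro allI impI)
    fix r' and \<eta> G :: "real \<times> (real ^ 'n) \<Rightarrow> real"
    assume r': "0 < r'" "r' \<le> r" and \<eta>: "kernel r' \<eta>" and G: "x_periodic D G" "loc_int (1/4) (\<lambda>z. \<psi> z * G z)"
      and [measurable]: "G \<in> borel_measurable borel" and R: "r' < 1/4"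
    have [measurable]: "\<eta> \<in> borel_measurable borel" "\<psi> \<in> borel_measurable borel"
      using \<eta> s by (auto intro: kernel_borel smooth_borel)
    have sm: "smooth (mollify \<eta> (\<lambda>z. \<psi> z * G z))"
    proof (rule smooth_mol[OF G(2) r'(1) R])
      show "smooth \<eta>" using \<eta> unfolding kernel_def by blast
      show "\<eta> z = 0" if "norm z > r'" for z using \<eta> that unfolding kernel_def by blast
    qed
    have "x_periodic D (\<lambda>z. \<psi> z * G z)"
      unfolding x_periodic_def using x_periodicD[OF p] x_periodicD[OF G(1)] by presburger
    then have per: "x_periodic D (mollify \<eta> (\<lambda>z. \<psi> z * G z))" by (intro x_periodic_mol) auto
    define K' where "K' = (\<Union>x\<in>K. \<Union>y\<in>cball 0 r'. {x + y})"
    have K': "compact K'" unfolding K'_def by (rule compact_sums'[OF K(1) compact_cball])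
    have "K' \<subseteq> (\<Union>x\<in>K. cball x r)" unfolding K'_def using r'(2) by (auto simp: dist_norm)
    then have sub: "K' \<subseteq> J \<times> UNIV" using r(2) by blast
    have "mollify \<eta> (\<lambda>z. \<psi> z * G z) z = 0" if z: "z \<notin> periodic_hull D K'" for z
    proof -
      have "\<eta> (z - u) * (\<psi> u * G u) = 0" for u
      proof (rule ccontr)
        assume "\<eta> (z - u) * (\<psi> u * G u) \<noteq> 0"
        then have n: "\<eta> (z - u) \<noteq> 0" "u \<in> periodic_hull D K" using 0[of u] by auto
        then have "norm (z - u) \<le> r'" using \<eta> unfolding kernel_def by (meson not_le)
        obtain k where k: "k \<in> periods D" "u + (0, k) \<in> K" using n(2) unfolding periodic_hull_def by blast
        have eq: "z + (0, k) = (u + (0, k)) + (z - u)" by simp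
        have "z - u \<in> cball 0 r'" using \<open>norm (z - u) \<le> r'\<close> by simp
        then have "z + (0, k) \<in> K'" unfolding K'_def eq using k(2) by blast
        then show False using z k(1) unfolding periodic_hull_def by blast
      qed
      then show ?thesis unfolding mollify_def by (simp only: integral_zero)
    qed
    then show "test_function J D (mollify \<eta> (\<lambda>z. \<psi> z * G z))"
      unfolding test_function_iff by (intro conjI exI[of _ K'] sm per K' sub allI impI)
  qed
qed

section \<open>Correlations of two functions\<close>

definition corr :: "domain \<Rightarrow> (real \<times> (real ^ 'n) \<Rightarrow> real) \<Rightarrow> (real \<times> (real ^ 'n) \<Rightarrow> real) \<Rightarrow>
    real \<times> (real ^ 'n) \<Rightarrow> real" where
  "corr D F G w = (LINT z|cellm D. F z * G (z + w))"

text \<open>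
  A splitting \<open>\<bar>F z * G z'\<bar> \<le> a z + b z'\<close> with integrable \<open>a\<close>, \<open>b\<close> replaces the Hoelder
  inequality: it is stable under shifting the second argument, so it gives the integrability of
  \<open>F z * G (z + w)\<close> for every \<open>w\<close>, uniformly enough for Fubini's theorem.
\<close>

definition paired :: "domain \<Rightarrow> (real \<times> (real ^ 'n) \<Rightarrow> real) \<Rightarrow> (real \<times> (real ^ 'n) \<Rightarrow> real) \<Rightarrow> bool" where
  "paired D F G \<longleftrightarrow> F \<in> borel_measurable borel \<and> G \<in> borel_measurable borel \<and> x_periodic D F \<and> x_periodic D G \<and>
     (\<exists>a b. integrable (cellm D) a \<and> integrable (cellm D) b \<and> x_periodic D a \<and> x_periodic D b \<and>
        (\<forall>z z'. \<bar>F z * G z'\<bar> \<le> a z + b z'))"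

lemma paired_sym: 
  assumes "paired D F G" shows "paired D G F"
proof -
  obtain a b where "integrable (cellm D) a" "integrable (cellm D) b" "x_periodic D a" "x_periodic D b" "\<And>z z'. \<bar>F z * G z'\<bar> \<le> a z + b z'"
    using assms unfolding paired_def by blast
  moreover have "\<bar>G z * F z'\<bar> \<le> b z + a z'" for z z'
    using \<open>\<bar>F z' * G z\<bar> \<le> a z' + b z\<close> by (simp only: mult.commute add.commute)
  ultimately show ?thesis using assms unfolding paired_def by blast
qed

lemma paired_integrable:
  assumes "paired D F G" shows "integrable (cellm D) (\<lambda>z. F z * G (z + w))"
proof -
  obtain a b where ab: "integrable (cellm D) a" "integrable (cellm D) b" "x_periodic D b" "\<And>z z'. \<bar>F z * G z'\<bar> \<le> a z + b z'"
    using assms unfolding paired_def by blast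
  have [measurable]: "F \<in> borel_measurable borel" "G \<in> borel_measurable borel" using assms unfolding paired_def by auto
  have "integrable (cellm D) (\<lambda>z. a z + b (z + w))" using ab cellm_shift(1)[OF ab(2,3)] by simp
  then show ?thesis
  proof (rule Bochner_Integration.integrable_bound)
    show "AE z in cellm D. norm (F z * G (z + w)) \<le> norm (a z + b (z + w))"
      unfolding real_norm_def by (rule AE_I2, rule order_trans[OF ab(4) abs_ge_self])
  qed simp
qed

lemma corr_swap:
  fixes F :: "real \<times> (real ^ 'n) \<Rightarrow> real"
  assumes "paired D F G" shows "corr D G F (- w) = corr D F G w"
proof -
  have p: "x_periodic D F" "x_periodic D G" using assms unfolding paired_def by auto
  have i: "integrable (cellm D) (\<lambda>z. F z * G (z + w))" by (rule paired_integrable[OF assms])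
  have sp: "x_periodic D (\<lambda>z. F z * G (z + w))"
    unfolding x_periodic_def
  proof (intro allI ballI)
    fix z :: "real \<times> (real ^ 'n)" and k :: "real ^ 'n" assume k: "k \<in> periods D"
    have "z + (0, k) + w = z + w + (0, k)" by (simp add: algebra_simps)
    then show "F (z + (0, k)) * G (z + (0, k) + w) = F z * G (z + w)"
      using x_periodicD[OF p(1) k] x_periodicD[OF p(2) k] by metis
  qed
  have "corr D F G w = (LINT z|cellm D. F (z + (- w)) * G (z + (- w) + w))"
    unfolding corr_def by (rule cellm_shift(2)[OF i sp, symmetric])
  also have "\<dots> = corr D G F (- w)" unfolding corr_def by (simp add: mult.commute)
  finally show ?thesis by simp
qed

lemma distr_uminus: "distr lborel borel uminus = (lborel :: 'a::euclidean_space measure)"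
  by (subst (2) lborel_affine[of "-1" 0]) (auto simp: density_1 uminus_add_conv_diff[symmetric])

lemma lborel_uminus:
  fixes G :: "'a::euclidean_space \<Rightarrow> real"
  assumes "G \<in> borel_measurable borel"
  shows "(LINT w|lborel. G (- w)) = (LINT w|lborel. G w)"
proof -
  have "(LINT w|lborel. G w) = (LINT w|distr lborel borel uminus. G w)" by (simp only: distr_uminus)
  also have "\<dots> = (LINT w|lborel. G (- w))" by (rule integral_distr) (use assms in auto)
  finally show ?thesis by simp
qed

lemma integrable_uminus:
  fixes G :: "'a::euclidean_space \<Rightarrow> real"
  assumes "integrable lborel G"
  shows "integrable lborel (\<lambda>w. G (- w))"
proof -
  have "integrable (distr lborel borel uminus) G" using assms by (simp only: distr_uminus)
  then show ?thesis by (rule integrable_distr[rotated]) simp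
qed

text \<open>
  Testing \<open>F\<close> against a mollification of \<open>G\<close> averages the correlations over the kernel.
\<close>

lemma fubini_corr:
  assumes FG: "paired D F G" and \<kappa>: "kernel r \<kappa>"
  shows "(LINT z|cellm D. F z * mollify \<kappa> G z) = (LINT w|lborel. \<kappa> (- w) * corr D F G w)"
    and "integrable lborel (\<lambda>w. \<kappa> (- w) * corr D F G w)"
    and "integrable (cellm D) (\<lambda>z. F z * mollify \<kappa> G z)"
proof -
  obtain a b where ab: "integrable (cellm D) a" "integrable (cellm D) b" "x_periodic D b" "\<And>z z'. \<bar>F z * G z'\<bar> \<le> a z + b z'"
    using FG unfolding paired_def by blast
  have [measurable]: "F \<in> borel_measurable borel" "G \<in> borel_measurable borel" "\<kappa> \<in> borel_measurable borel"
    using FG \<kappa> unfolding paired_def by (auto intro: kernel_borel)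
  have [measurable]: "a \<in> borel_measurable borel" "b \<in> borel_measurable borel"
    using ab(1,2) by (auto dest: borel_measurable_integrable)
  interpret c: sigma_finite_measure "cellm D" by (rule sigma_finite_cellm)
  interpret pair_sigma_finite "lborel :: (real \<times> (real ^ 'a)) measure" "cellm D" ..
  have i\<kappa>: "integrable lborel (\<lambda>w. \<kappa> (- w))"
    by (rule integrable_uminus[OF kernel_integrable[OF \<kappa>]])
  have int: "integrable (lborel \<Otimes>\<^sub>M cellm D) (case_prod (\<lambda>w z. \<kappa> (- w) * (F z * G (z + w))))"
  proof (rule Fubini_integrable)
    show "case_prod (\<lambda>w z. \<kappa> (- w) * (F z * G (z + w))) \<in> borel_measurable (lborel \<Otimes>\<^sub>M cellm D)"
      by measurable
    show "AE w in lborel. integrable (cellm D) (\<lambda>z. case (w, z) of (w, z) \<Rightarrow> \<kappa> (- w) * (F z * G (z + w)))"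
      by (rule AE_I2) (simp add: paired_integrable[OF FG])
    have bd: "(LINT z|cellm D. norm (\<kappa> (- w) * (F z * G (z + w)))) \<le> \<bar>\<kappa> (- w)\<bar> * (integral\<^sup>L (cellm D) a + integral\<^sup>L (cellm D) b)" for w
    proof -
      have "(LINT z|cellm D. norm (\<kappa> (- w) * (F z * G (z + w)))) \<le> (LINT z|cellm D. \<bar>\<kappa> (- w)\<bar> * (a z + b (z + w)))"
      proof (rule integral_mono)
        show "integrable (cellm D) (\<lambda>z. norm (\<kappa> (- w) * (F z * G (z + w))))"
          using paired_integrable[OF FG, of w] by simp
        show "integrable (cellm D) (\<lambda>z. \<bar>\<kappa> (- w)\<bar> * (a z + b (z + w)))"
          using ab cellm_shift(1)[OF ab(2,3)] by simp
        show "norm (\<kappa> (- w) * (F z * G (z + w))) \<le> \<bar>\<kappa> (- w)\<bar> * (a z + b (z + w))" for z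
          using mult_left_mono[OF ab(4)[of z "z + w"] abs_ge_zero[of "\<kappa> (- w)"]] by (simp add: abs_mult)
      qed
      also have "\<dots> = \<bar>\<kappa> (- w)\<bar> * (integral\<^sup>L (cellm D) a + integral\<^sup>L (cellm D) b)"
        using ab cellm_shift[OF ab(2,3), of w] by simp
      finally show ?thesis .
    qed
    have "integrable lborel (\<lambda>w. \<bar>\<kappa> (- w)\<bar> * (integral\<^sup>L (cellm D) a + integral\<^sup>L (cellm D) b))"
      using i\<kappa> by simp
    then show "integrable lborel (\<lambda>w. LINT z|cellm D. norm (case (w, z) of (w, z) \<Rightarrow> \<kappa> (- w) * (F z * G (z + w))))"
    proof (rule Bochner_Integration.integrable_bound)
      show "AE w in lborel. norm (LINT z|cellm D. norm (case (w, z) of (w, z) \<Rightarrow> \<kappa> (- w) * (F z * G (z + w))))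
        \<le> norm (\<bar>\<kappa> (- w)\<bar> * (integral\<^sup>L (cellm D) a + integral\<^sup>L (cellm D) b))"
      proof (rule AE_I2)
        fix w
        have "0 \<le> (LINT z|cellm D. norm (\<kappa> (- w) * (F z * G (z + w))))"
          by (rule Bochner_Integration.integral_nonneg) simp
        then show "norm (LINT z|cellm D. norm (case (w, z) of (w, z) \<Rightarrow> \<kappa> (- w) * (F z * G (z + w))))
          \<le> norm (\<bar>\<kappa> (- w)\<bar> * (integral\<^sup>L (cellm D) a + integral\<^sup>L (cellm D) b))"
          using order_trans[OF bd[of w] abs_ge_self] by (simp only: prod.case real_norm_def abs_of_nonneg)
      qed
    qed measurable
  qed
  have m: "mollify \<kappa> G z = (LINT w|lborel. \<kappa> (- w) * G (z + w))" for z
  proof -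
    have "(LINT w|lborel. \<kappa> (z - (w + z)) * G (w + z)) = mollify \<kappa> G z"
      unfolding mollify_def by (rule lborel_shift(2)) measurable
    then show ?thesis by (simp add: add.commute)
  qed
  have e1: "(LINT z|cellm D. \<kappa> (- w) * (F z * G (z + w))) = \<kappa> (- w) * corr D F G w" for w
    unfolding corr_def by simp
  have e2: "(LINT w|lborel. \<kappa> (- w) * (F z * G (z + w))) = F z * mollify \<kappa> G z" for z
    unfolding m by (simp add: mult.left_commute)
  show "(LINT z|cellm D. F z * mollify \<kappa> G z) = (LINT w|lborel. \<kappa> (- w) * corr D F G w)"
    using Fubini_integral[OF int] unfolding e1 e2 .
  show "integrable lborel (\<lambda>w. \<kappa> (- w) * corr D F G w)"
    using integrable_fst'[OF int] unfolding corr_def by simp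
  show "integrable (cellm D) (\<lambda>z. F z * mollify \<kappa> G z)"
    using integrable_snd[OF int] by (simp add: e2)
qed

section \<open>Integration by parts against kernels\<close>

lemma C_k_shift: "C_k m f \<Longrightarrow> C_k m (\<lambda>u. f (u - z))"
proof (induction m arbitrary: f)
  case 0
  then show ?case by (auto intro!: continuous_on_compose2[of UNIV f] continuous_intros)
next
  case (Suc m)
  have d: "((\<lambda>u. f (u - z)) has_derivative (\<lambda>h. pd h f (u - z))) (at u)" for u
  proof -
    have "((\<lambda>u. u - z) has_derivative (\<lambda>h. h)) (at u)" by (auto intro!: derivative_eq_intros)
    moreover have "(f has_derivative (\<lambda>h. pd h f (u - z))) (at (u - z))"
      using Suc.prems unfolding C_k_Suc by (intro smooth_has_derivative_pd) blast
    ultimately show ?thesis by (rule has_derivative_compose)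
  qed
  have pd: "pd b (\<lambda>u. f (u - z)) = (\<lambda>u. pd b f (u - z))" for b by (intro ext pdI d)
  show ?case unfolding C_k_Suc pd
  proof (intro conjI allI ballI)
    show "(\<lambda>u. f (u - z)) differentiable (at u)" for u using d unfolding differentiable_def by blast
    show "C_k m (\<lambda>u. pd b f (u - z))" if "b \<in> Basis" for b
      using Suc.prems that unfolding C_k_Suc by (intro Suc.IH) blast
  qed
qed

lemma smooth_shift: "smooth f \<Longrightarrow> smooth (\<lambda>u. f (u - z))"
  unfolding smooth_def by (blast intro: C_k_shift)

lemma pd_shift:
  assumes "smooth f" shows "pd b (\<lambda>u. f (u - z)) u = pd b f (u - z)"
proof (rule pdI)
  have "((\<lambda>u. u - z) has_derivative (\<lambda>h. h)) (at u)" by (auto intro!: derivative_eq_intros)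
  then show "((\<lambda>u. f (u - z)) has_derivative (\<lambda>h. pd h f (u - z))) (at u)"
    by (rule has_derivative_compose) (rule smooth_derivative[OF assms])
qed

text \<open>
  The mollification of the constant \<open>1\<close> is constant, and its derivative is the integral in
  question.
\<close>

lemma integral_pd_eq_0:
  fixes q :: "'a::euclidean_space \<Rightarrow> real"
  assumes q: "kernel r q" and r: "0 < r" and b: "b \<in> Basis"
  shows "(LINT u|lborel. pd b q u) = 0"
proof -
  have l: "loc_int (r + 1) (\<lambda>u::'a. 1)"
    unfolding loc_int_def using emeasure_compact_finite[OF compact_cball, of _ "r + 1"]
    by (auto simp: integrable_indicator_iff)
  have c: "mollify g (\<lambda>u. 1) z = (LINT u|lborel. g u)" if [measurable]: "g \<in> borel_measurable borel"
    for g :: "'a \<Rightarrow> real" and z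
  proof -
    have "mollify g (\<lambda>u. 1) z = (LINT u|lborel. g (z - (u + z)))"
      unfolding mollify_def mult_1_right by (rule lborel_shift(2)[symmetric, of "\<lambda>u. g (z - u)"]) measurable
    also have "\<dots> = (LINT u|lborel. g u)" using lborel_uminus[OF that] by simp
    finally show ?thesis .
  qed
  have "pd b (mollify q (\<lambda>u. 1)) = mollify (pd b q) (\<lambda>u. 1)"
  proof (rule pd_mol[OF l r])
    show "smooth q" using q unfolding kernel_def by blast
    show "q z = 0" if "norm z > r" for z using q that unfolding kernel_def by blast
  qed simp
  moreover have "mollify q (\<lambda>u. 1) = (\<lambda>z. LINT u|lborel. q u)" using c[OF kernel_borel[OF q]] by auto
  moreover have "pd b (\<lambda>z::'a. c) 0 = 0" for c by (rule pdI) (rule has_derivative_const)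
  ultimately have "mollify (pd b q) (\<lambda>u. 1) 0 = 0" by metis
  then show ?thesis using c[OF kernel_borel[OF kernel_pd[OF q b]]] by simp
qed

text \<open>
  Integration by parts for the product of the translated kernel with \<open>\<psi>\<close>, which is compactly
  supported although \<open>\<psi>\<close> itself is periodic.
\<close>

lemma mol_pd_commute:
  fixes \<eta> :: "'a::euclidean_space \<Rightarrow> real"
  assumes \<eta>: "kernel r \<eta>" and r: "0 < r" and ev: "\<And>z. \<eta> (- z) = \<eta> z" and s: "smooth \<psi>" and b: "b \<in> Basis"
  shows "mollify (pd b \<eta>) \<psi> z = mollify \<eta> (pd b \<psi>) z"
proof -
  have s\<eta>: "smooth \<eta>" using \<eta> unfolding kernel_def by blast
  define q where "q u = \<eta> (u - z) * \<psi> u" for u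
  have q: "kernel (r + norm z) q"
    unfolding kernel_def
  proof (intro conjI allI impI)
    show "smooth q" unfolding q_def[abs_def] by (intro smooth_mult smooth_shift s\<eta> s)
    fix u :: 'a assume "norm u > r + norm z"
    then have "norm (u - z) > r" using norm_triangle_ineq2[of u z] by linarith
    then show "q u = 0" using \<eta> unfolding kernel_def q_def by simp
  qed
  have pq: "pd b q u = \<eta> (u - z) * pd b \<psi> u + pd b \<eta> (u - z) * \<psi> u" for u
    unfolding q_def[abs_def] pd_mult[OF smooth_shift[OF s\<eta>] s] pd_shift[OF s\<eta>] ..
  have k: "kernel (r + norm z) (\<lambda>u. g (u - z) * h u)" if g: "kernel r g" and h: "smooth h" for g h
    unfolding kernel_def
  proof (intro conjI allI impI)
    show "smooth (\<lambda>u. g (u - z) * h u)" using g h unfolding kernel_def by (intro smooth_mult smooth_shift) blast+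
    fix u :: 'a assume "norm u > r + norm z"
    then have "norm (u - z) > r" using norm_triangle_ineq2[of u z] by linarith
    then show "g (u - z) * h u = 0" using g unfolding kernel_def by simp
  qed
  have i1: "integrable lborel (\<lambda>u. \<eta> (u - z) * pd b \<psi> u)"
    by (rule kernel_integrable[OF k[OF \<eta> smooth_pd[OF s b]]])
  have i2: "integrable lborel (\<lambda>u. pd b \<eta> (u - z) * \<psi> u)"
    by (rule kernel_integrable[OF k[OF kernel_pd[OF \<eta> b] s]])
  have "(LINT u|lborel. pd b q u) = 0"
    by (rule integral_pd_eq_0[OF q _ b]) (use r in \<open>simp add: add_pos_nonneg\<close>)
  then have z0: "(LINT u|lborel. \<eta> (u - z) * pd b \<psi> u) + (LINT u|lborel. pd b \<eta> (u - z) * \<psi> u) = 0"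
    unfolding pq using i1 i2 by simp
  have "\<eta> (u - z) = \<eta> (z - u)" for u using ev[of "z - u"] by simp
  moreover have "pd b \<eta> (u - z) = - pd b \<eta> (z - u)" for u using pd_odd[OF s\<eta> ev, of b "z - u"] by simp
  ultimately show ?thesis using z0 unfolding mollify_def by simp
qed

section \<open>Fields with integrable cube\<close>

text \<open>
  Both factors are at most powers of \<open>max 1 (max x y)\<close>.
\<close>

lemma pow_mult_le:
  fixes x y :: real
  assumes "0 \<le> x" "0 \<le> y" "j + l \<le> 3"
  shows "x ^ j * y ^ l \<le> 1 + x ^ 3 + y ^ 3"
proof -
  define M where "M = max 1 (max x y)"
  have "x ^ j * y ^ l \<le> M ^ j * M ^ l"
    unfolding M_def by (intro mult_mono power_mono) (use assms in auto)
  also have "\<dots> = M ^ (j + l)" by (simp add: power_add)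
  also have "\<dots> \<le> M ^ 3" by (rule power_increasing) (use assms in \<open>auto simp: M_def\<close>)
  also have "\<dots> \<le> 1 + x ^ 3 + y ^ 3"
    using assms zero_le_power[of x 3] zero_le_power[of y 3] unfolding M_def max_def by auto
  finally show ?thesis .
qed

text \<open>
  The integrability of \<open>P\<close> is stated as that of \<open>\<bar>P\<bar>\<^sup>1\<^sup>/\<^sup>2\<close> to the power \<open>3\<close>, so that velocity and
  pressure have a common envelope.
\<close>

locale cubic_fields =
  fixes D :: domain and V :: "real \<times> (real ^ 'n) \<Rightarrow> real ^ 'n" and P :: "real \<times> (real ^ 'n) \<Rightarrow> real"
  assumes V_borel[measurable]: "V \<in> borel_measurable borel" and P_borel[measurable]: "P \<in> borel_measurable borel"
    and V_per: "x_periodic D V" and P_per: "x_periodic D P"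
    and V3: "integrable (cellm D) (\<lambda>z. norm (V z) ^ 3)" and P32: "integrable (cellm D) (\<lambda>z. sqrt \<bar>P z\<bar> ^ 3)"
begin

text \<open>
  Envelope of both fields: a velocity component is bounded by \<open>m\<close> and the pressure by \<open>m\<^sup>2\<close>.
  Integrability is then a matter of counting degrees, the cube of \<open>m\<close> being integrable.
\<close>

definition m :: "real \<times> (real ^ 'n) \<Rightarrow> real" where "m z = max (norm (V z)) (sqrt \<bar>P z\<bar>)"

definition tame :: "nat \<Rightarrow> (real \<times> (real ^ 'n) \<Rightarrow> real) \<Rightarrow> bool" where
  "tame j f \<longleftrightarrow> f \<in> borel_measurable borel \<and> x_periodic D f \<and> (\<forall>z. \<bar>f z\<bar> \<le> m z ^ j)"

lemma m_nonneg: "0 \<le> m z"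
  unfolding m_def by (simp add: le_max_iff_disj)

lemma m_borel[measurable]: "m \<in> borel_measurable borel"
  unfolding m_def[abs_def] by measurable

lemma m_per: "x_periodic D m"
  unfolding x_periodic_def m_def using x_periodicD[OF V_per] x_periodicD[OF P_per] by simp

lemma m3_integrable: "integrable (cellm D) (\<lambda>z. m z ^ 3)"
proof (rule Bochner_Integration.integrable_bound)
  show "integrable (cellm D) (\<lambda>z. norm (V z) ^ 3 + sqrt \<bar>P z\<bar> ^ 3)" using V3 P32 by simp
  show "AE z in cellm D. norm (m z ^ 3) \<le> norm (norm (V z) ^ 3 + sqrt \<bar>P z\<bar> ^ 3)"
    by (rule AE_I2) (simp add: m_def max_def)
qed simp

lemma m3_per: "x_periodic D (\<lambda>z. c * m z ^ 3)"
  unfolding x_periodic_def using x_periodicD[OF m_per] by simp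

lemma tame_le: "tame j f \<Longrightarrow> \<bar>f z\<bar> \<le> m z ^ j"
  and tame_per: "tame j f \<Longrightarrow> x_periodic D f"
  and tame_borel: "tame j f \<Longrightarrow> f \<in> borel_measurable borel"
  unfolding tame_def by blast+

lemma tame_mult:
  assumes "tame j f" "tame l g" shows "tame (j + l) (\<lambda>z. f z * g z)"
  unfolding tame_def
proof (intro conjI allI)
  show "(\<lambda>z. f z * g z) \<in> borel_measurable borel" using assms[THEN tame_borel] by simp
  show "x_periodic D (\<lambda>z. f z * g z)"
    unfolding x_periodic_def using x_periodicD[OF assms(1)[THEN tame_per]] x_periodicD[OF assms(2)[THEN tame_per]] by simp
  show "\<bar>f z * g z\<bar> \<le> m z ^ (j + l)" for z
    unfolding abs_mult power_add
    by (intro mult_mono tame_le[OF assms(1)] tame_le[OF assms(2)] zero_le_power m_nonneg) simp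
qed

lemma tame_V: "tame 1 (\<lambda>z. V z $ i)"
  unfolding tame_def
proof (intro conjI allI)
  show "(\<lambda>z. V z $ i) \<in> borel_measurable borel"
    by (rule borel_measurable_continuous_on[OF _ V_borel]) (intro continuous_intros)
  show "x_periodic D (\<lambda>z. V z $ i)" unfolding x_periodic_def using x_periodicD[OF V_per] by simp
  show "\<bar>V z $ i\<bar> \<le> m z ^ 1" for z
    using component_le_norm_cart[of "V z" i] unfolding m_def by (simp add: le_max_iff_disj)
qed

lemma tame_P: "tame 2 P"
  unfolding tame_def
proof (intro conjI allI P_borel P_per)
  fix z
  have "\<bar>P z\<bar> = (sqrt \<bar>P z\<bar>)\<^sup>2" by simp
  also have "\<dots> \<le> m z ^ 2" by (rule power_mono) (auto simp: m_def)
  finally show "\<bar>P z\<bar> \<le> m z ^ 2" .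
qed

lemma tame_1: "tame 0 (\<lambda>z. 1)"
  unfolding tame_def x_periodic_def by simp

definition N :: "real \<times> (real ^ 'n) \<Rightarrow> real" where "N z = (norm (V z))\<^sup>2"

lemma tame_N: "tame 2 N"
  unfolding tame_def
proof (intro conjI allI)
  show "N \<in> borel_measurable borel" unfolding N_def[abs_def] by measurable
  show "x_periodic D N" unfolding x_periodic_def N_def using x_periodicD[OF V_per] by simp
  show "\<bar>N z\<bar> \<le> m z ^ 2" for z
    unfolding N_def by (auto simp: m_def intro!: power_mono)
qed

lemma tame_VV: "tame 2 (\<lambda>z. V z $ i * V z $ k)"
  using tame_mult[OF tame_V[of i] tame_V[of k]] by (simp add: numeral_2_eq_2)

lemma tame_VN: "tame 3 (\<lambda>z. V z $ k * N z)"
  using tame_mult[OF tame_V[of k] tame_N] by (simp add: numeral_3_eq_3 numeral_2_eq_2)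

text \<open>
  Degrees adding up to at most \<open>3\<close> are what the integrability of \<open>m\<^sup>3\<close> allows; the cutoff absorbs
  the constant in the bound by \<open>1 + m\<^sup>3 + m'\<^sup>3\<close>, which is not integrable by itself.
\<close>

lemma paired_tame:
  assumes f: "tame j f" and g: "tame l g" and jl: "j + l \<le> 3" and c: "cutoff D c"
  shows "paired D (\<lambda>z. f z * c z) g"
proof -
  obtain B where B: "\<And>z. \<bar>c z\<bar> \<le> B" using c unfolding cutoff_def by blast
  have B0: "B \<ge> 0" using B[of 0] by linarith
  have ci: "integrable (cellm D) c" "x_periodic D c" "c \<in> borel_measurable borel" using c unfolding cutoff_def by auto
  have bd: "\<bar>f z * c z * g z'\<bar> \<le> (\<bar>c z\<bar> + B * m z ^ 3) + B * m z' ^ 3" for z z'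
  proof -
    have "\<bar>f z * c z * g z'\<bar> = \<bar>c z\<bar> * (\<bar>f z\<bar> * \<bar>g z'\<bar>)" by (simp add: abs_mult)
    also have "\<dots> \<le> \<bar>c z\<bar> * (m z ^ j * m z' ^ l)"
      by (intro mult_left_mono mult_mono tame_le[OF f] tame_le[OF g] zero_le_power m_nonneg) auto
    also have "\<dots> \<le> \<bar>c z\<bar> * (1 + m z ^ 3 + m z' ^ 3)"
      by (intro mult_left_mono pow_mult_le jl m_nonneg) auto
    also have "\<dots> = \<bar>c z\<bar> + \<bar>c z\<bar> * m z ^ 3 + \<bar>c z\<bar> * m z' ^ 3" by (simp add: algebra_simps)
    also have "\<dots> \<le> (\<bar>c z\<bar> + B * m z ^ 3) + B * m z' ^ 3"
      using mult_right_mono[OF B[of z] zero_le_power[OF m_nonneg[of z], of 3]]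
        mult_right_mono[OF B[of z] zero_le_power[OF m_nonneg[of z'], of 3]] by linarith
    finally show ?thesis .
  qed
  have "x_periodic D (\<lambda>z. f z * c z)" "x_periodic D (\<lambda>z. \<bar>c z\<bar> + B * m z ^ 3)"
    unfolding x_periodic_def using f x_periodicD[OF ci(2)] x_periodicD[OF m_per] unfolding tame_def x_periodic_def by simp_all
  moreover have "integrable (cellm D) (\<lambda>z. \<bar>c z\<bar> + B * m z ^ 3)" "integrable (cellm D) (\<lambda>z. B * m z ^ 3)"
    using ci(1) m3_integrable by simp_all
  moreover have "(\<lambda>z. f z * c z) \<in> borel_measurable borel" "g \<in> borel_measurable borel" "x_periodic D g"
    using f g ci(3) unfolding tame_def by auto
  ultimately show ?thesis unfolding paired_def using bd m3_per by blast
qed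

lemma integrable_tame:
  assumes f: "tame j f" and j: "j \<le> 3" and c: "cutoff D c"
  shows "integrable (cellm D) (\<lambda>z. f z * c z)"
  using paired_integrable[OF paired_tame[OF f tame_1 _ c]] j by simp

text \<open>
  The ball of radius \<open>1/4\<close> around \<open>z\<close> lies in the strip translated by \<open>z\<close> and by minus half a unit
  in each direction, over which \<open>m\<^sup>3\<close> has the same integral as over the strip itself.
\<close>

lemma loc_int_tame:
  assumes f: "tame j f" and j: "j \<le> 3" and c: "c \<in> borel_measurable borel" "\<And>z. \<bar>c z\<bar> \<le> B"
  shows "loc_int (1/4) (\<lambda>z. c z * f z)"
  unfolding loc_int_def
proof (intro conjI allI)
  have [measurable]: "f \<in> borel_measurable borel" "c \<in> borel_measurable borel" using f c unfolding tame_def by auto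
  show "(\<lambda>z. c z * f z) \<in> borel_measurable borel" by measurable
  fix z :: "real \<times> (real ^ 'n)"
  have B0: "B \<ge> 0" using c(2)[of 0] by linarith
  let ?e = "(0, \<chi> i. 1/2) :: real \<times> (real ^ 'n)"
  have [measurable]: "cball z (1/4) \<in> sets borel" by simp
  have m3: "integrable lborel (\<lambda>u. indicator (cball z (1/4)) u * m u ^ 3)"
  proof (rule integrableI_bounded)
    have "(\<integral>\<^sup>+u. ennreal (norm (indicator (cball z (1/4)) u * m u ^ 3)) \<partial>lborel)
      = (\<integral>\<^sup>+u. indicator (cball 0 (1/4)) (u - z) * ennreal (m u ^ 3) \<partial>lborel)"
      by (intro nn_integral_cong) (auto simp: indicator_def dist_norm norm_minus_commute m_nonneg)
    also have "\<dots> \<le> (\<integral>\<^sup>+u. indicator (UNIV \<times> cell D) (u - z + ?e) * ennreal (m u ^ 3) \<partial>lborel)"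
    proof (rule nn_integral_mono)
      fix u
      have "u - z + ?e \<in> UNIV \<times> cell D" if "norm (u - z) \<le> 1/4"
      proof (cases D)
        case Torus
        have "\<bar>snd (u - z) $ i\<bar> \<le> 1/4" for i
          using component_le_norm_cart[of "snd (u - z)" i] norm_snd_le[of "snd (u - z)" "fst (u - z)"] that
          unfolding prod.collapse by linarith
        then have "- (1/4) \<le> snd (u - z) $ i" "snd (u - z) $ i \<le> 1/4" for i
          using abs_le_D1 abs_le_D2 minus_le_iff by blast+
        then have "0 \<le> snd (u - z) $ i + 1/2 \<and> snd (u - z) $ i + 1/2 < 1" for i
          using \<open>- (1/4) \<le> snd (u - z) $ i\<close> \<open>snd (u - z) $ i \<le> 1/4\<close> by linarith
        then show ?thesis using Torus by (simp add: mem_Times_iff)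
      qed (simp add: mem_Times_iff)
      then show "indicator (cball 0 (1/4)) (u - z) * ennreal (m u ^ 3) \<le>
          indicator (UNIV \<times> cell D) (u - z + ?e) * ennreal (m u ^ 3)"
        by (auto simp: indicator_def)
    qed
    also have "\<dots> = (\<integral>\<^sup>+u. indicator (UNIV \<times> cell D) (u + (z - ?e) - z + ?e) * ennreal (m (u + (z - ?e)) ^ 3) \<partial>lborel)"
      by (rule lborel_shift(3)[symmetric]) measurable
    also have "\<dots> = (\<integral>\<^sup>+u. ennreal (m (u + (z - ?e)) ^ 3) \<partial>cellm D)"
    proof -
      have eq: "u + (z - ?e) - z + ?e = u" for u by (simp only: algebra_simps)
      show ?thesis unfolding eq by (rule nn_integral_cellm[symmetric]) measurable
    qed
    also have "\<dots> = (\<integral>\<^sup>+u. ennreal (m u ^ 3) \<partial>cellm D)"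
    proof (rule nn_integral_cellm_shift[of "\<lambda>u. ennreal (m u ^ 3)"])
      show "x_periodic D (\<lambda>u. ennreal (m u ^ 3))" unfolding x_periodic_def using x_periodicD[OF m_per] by simp
    qed measurable
    also have "\<dots> < \<infinity>"
      using m3_integrable m_nonneg by (simp add: integrable_iff_bounded abs_of_nonneg)
    finally show "(\<integral>\<^sup>+u. ennreal (norm (indicator (cball z (1/4)) u * m u ^ 3)) \<partial>lborel) < \<infinity>" .
  qed simp
  have 1: "integrable lborel (\<lambda>u. indicator (cball z (1/4)) u :: real)"
    using emeasure_compact_finite[OF compact_cball, of z "1/4"] by (simp add: integrable_indicator_iff)
  have "integrable lborel (\<lambda>u. B * (indicator (cball z (1/4)) u + indicator (cball z (1/4)) u * m u ^ 3))"
    using 1 m3 by simp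
  then show "integrable lborel (\<lambda>u. indicator (cball z (1/4)) u * (c u * f u))"
  proof (rule Bochner_Integration.integrable_bound)
    show "AE u in lborel. norm (indicator (cball z (1/4)) u * (c u * f u)) \<le>
       norm (B * (indicator (cball z (1/4)) u + indicator (cball z (1/4)) u * m u ^ 3))"
    proof (rule AE_I2)
      fix u
      have "\<bar>f u\<bar> \<le> m u ^ j * 0 ^ 0" using tame_le[OF f] by simp
      also have "\<dots> \<le> 1 + m u ^ 3 + 0 ^ 3" by (rule pow_mult_le) (use j m_nonneg in auto)
      finally have f1: "\<bar>f u\<bar> \<le> 1 + m u ^ 3" by simp
      have "\<bar>c u * f u\<bar> \<le> B * (1 + m u ^ 3)"
        unfolding abs_mult by (rule mult_mono[OF c(2) f1 B0]) simp
      also have "\<dots> \<le> \<bar>B * (1 + m u ^ 3)\<bar>" by (rule abs_ge_self)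
      finally show "norm (indicator (cball z (1/4)) u * (c u * f u)) \<le>
       norm (B * (indicator (cball z (1/4)) u + indicator (cball z (1/4)) u * m u ^ 3))"
        by (cases "u \<in> cball z (1/4)") auto
    qed
  qed simp
qed

lemma integrable_tame_pd:
  assumes "test_function J D \<phi>" "tame j f" "j \<le> 3" "b \<in> Basis"
  shows "integrable (cellm D) (\<lambda>z. f z * pd b \<phi> z)"
  by (rule integrable_tame[OF assms(2,3) cutoff_test_function(2)[OF assms(1,4)]])

end

text \<open>
  The weak formulation for fields extended by \<open>0\<close> to all times, tested by functions supported in
  the open time interval, for which there is no initial term.
\<close>

locale weak_solution = cubic_fields D V P
  for D :: domain and V :: "real \<times> (real ^ 'n) \<Rightarrow> real ^ 'n" and P :: "real \<times> (real ^ 'n) \<Rightarrow> real" +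
  fixes T :: real
  assumes euler: "\<And>\<phi> i. test_function {0<..<T} D \<phi> \<Longrightarrow>
      (LINT z|cellm D. V z $ i * dt \<phi> z + (\<Sum>k\<in>UNIV. V z $ i * V z $ k * dx k \<phi> z) + P z * dx i \<phi> z) = 0"
    and div_free: "\<And>\<phi>. test_function {0<..<T} D \<phi> \<Longrightarrow> (LINT z|cellm D. (\<Sum>k\<in>UNIV. V z $ k * dx k \<phi> z)) = 0"

section \<open>The point-split energy balance\<close>

abbreviation t_dir :: "real \<times> (real ^ 'n)" where "t_dir \<equiv> (1, 0)"
abbreviation x_dir :: "'n \<Rightarrow> real \<times> (real ^ 'n)" where "x_dir k \<equiv> (0, axis k 1)"

lemma dt_eq_pd: "dt = pd t_dir" and dx_eq_pd: "dx k = pd (x_dir k)"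
  unfolding dt_def[abs_def] dx_def[abs_def] pd_def[abs_def] by auto

lemma t_dir_Basis: "t_dir \<in> Basis" and x_dir_Basis: "x_dir k \<in> Basis"
  by (auto simp: Basis_prod_def Basis_vec_def)

text \<open>
  Average of the correlations of \<open>F\<close> and \<open>G\<close> against a kernel. In this form all the tested
  equations become linear relations between numbers.
\<close>

definition smear :: "domain \<Rightarrow> (real \<times> (real ^ 'n) \<Rightarrow> real) \<Rightarrow> (real \<times> (real ^ 'n) \<Rightarrow> real) \<Rightarrow>
    (real \<times> (real ^ 'n) \<Rightarrow> real) \<Rightarrow> real" where
  "smear D \<kappa> F G = (LINT w|lborel. \<kappa> w * corr D F G w)"

lemma smear_integrable:
  assumes "paired D F G" "kernel r \<kappa>"
  shows "integrable lborel (\<lambda>w. \<kappa> w * corr D F G w)"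
  using integrable_uminus[OF fubini_corr(2)[OF paired_sym[OF assms(1)] assms(2)]]
  by (simp add: corr_swap[OF assms(1)])

text \<open>
  Mollifying the first factor reproduces the average; mollifying the second one reflects the
  kernel, which for even and odd kernels amounts to the sign \<open>s\<close>.
\<close>

lemma smear_fubini:
  assumes FG: "paired D F G" and \<kappa>: "kernel r \<kappa>"
  shows "(LINT z|cellm D. G z * mollify \<kappa> F z) = smear D \<kappa> F G"
    and "(\<And>w. \<kappa> (- w) = s * \<kappa> w) \<Longrightarrow> (LINT z|cellm D. F z * mollify \<kappa> G z) = s * smear D \<kappa> F G"
proof -
  have [measurable]: "\<kappa> \<in> borel_measurable borel" by (rule kernel_borel[OF \<kappa>])
  have i: "integrable lborel (\<lambda>w. \<kappa> (- w) * corr D G F w)"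
    by (rule fubini_corr(2)[OF paired_sym[OF FG] \<kappa>])
  have "(LINT z|cellm D. G z * mollify \<kappa> F z) = (LINT w|lborel. \<kappa> (- w) * corr D G F w)"
    by (rule fubini_corr(1)[OF paired_sym[OF FG] \<kappa>])
  also have "\<dots> = (LINT w|lborel. \<kappa> (- (- w)) * corr D G F (- w))"
    by (rule lborel_uminus[symmetric, of "\<lambda>w. \<kappa> (- w) * corr D G F w"])
      (use i in \<open>auto dest: borel_measurable_integrable\<close>)
  also have "\<dots> = smear D \<kappa> F G" unfolding smear_def by (simp add: corr_swap[OF FG])
  finally show "(LINT z|cellm D. G z * mollify \<kappa> F z) = smear D \<kappa> F G" .
  assume s: "\<And>w. \<kappa> (- w) = s * \<kappa> w"
  show "(LINT z|cellm D. F z * mollify \<kappa> G z) = s * smear D \<kappa> F G"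
    unfolding fubini_corr(1)[OF FG \<kappa>] s smear_def by (simp add: mult.assoc)
qed

context weak_solution
begin

lemma integral_mult_test:
  fixes \<psi> :: "real \<times> (real ^ 'n) \<Rightarrow> real"
  assumes \<psi>: "test_function J D \<psi>" and \<eta>: "kernel r \<eta>" "\<And>w. \<eta> (- w) = \<eta> w" and r: "0 < r" "r < 1/4"
    and f: "tame j f" and g: "tame l g" and jl: "j + l \<le> 3" and b: "b \<in> Basis"
  shows "(LINT z|cellm D. f z * pd b (\<lambda>z. \<psi> z * mollify \<eta> g z) z) =
     smear D \<eta> (\<lambda>z. f z * pd b \<psi> z) g - smear D (pd b \<eta>) (\<lambda>z. f z * \<psi> z) g"
    and "test_function J D (\<lambda>z. \<psi> z * mollify \<eta> g z)"
proof -
  have s\<eta>: "smooth \<eta>" and s\<psi>: "smooth \<psi>" using \<eta>(1) \<psi> unfolding kernel_def test_function_iff by blast+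
  have l: "loc_int (1/4) g"
    using loc_int_tame[OF g, of "\<lambda>z. 1" 1] jl by simp
  have z: "\<eta> z = 0" if "norm z > r" for z using \<eta>(1) that unfolding kernel_def by blast
  have sm: "smooth (mollify \<eta> g)" by (rule smooth_mol[OF l r s\<eta> z])
  show "test_function J D (\<lambda>z. \<psi> z * mollify \<eta> g z)"
    by (rule test_function_mult[OF \<psi> sm x_periodic_mol[OF tame_borel[OF g] kernel_borel[OF \<eta>(1)] tame_per[OF g]]])
  have p1: "paired D (\<lambda>z. f z * \<psi> z) g" by (rule paired_tame[OF f g jl cutoff_test_function(1)[OF \<psi>]])
  have p2: "paired D (\<lambda>z. f z * pd b \<psi> z) g" by (rule paired_tame[OF f g jl cutoff_test_function(2)[OF \<psi> b]])
  have pdm: "pd b (mollify \<eta> g) = mollify (pd b \<eta>) g" by (rule pd_mol[OF l r s\<eta> z])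
  have "f z * pd b (\<lambda>z. \<psi> z * mollify \<eta> g z) z = f z * \<psi> z * mollify (pd b \<eta>) g z + f z * pd b \<psi> z * mollify \<eta> g z" for z
    unfolding pd_mult[OF s\<psi> sm] pdm by (simp add: algebra_simps)
  then have "(LINT z|cellm D. f z * pd b (\<lambda>z. \<psi> z * mollify \<eta> g z) z) =
     (LINT z|cellm D. f z * \<psi> z * mollify (pd b \<eta>) g z) + (LINT z|cellm D. f z * pd b \<psi> z * mollify \<eta> g z)"
    using fubini_corr(3)[OF p1 kernel_pd[OF \<eta>(1) b]] fubini_corr(3)[OF p2 \<eta>(1)] by simp
  also have "(LINT z|cellm D. f z * \<psi> z * mollify (pd b \<eta>) g z) = - 1 * smear D (pd b \<eta>) (\<lambda>z. f z * \<psi> z) g"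
    by (rule smear_fubini(2)[OF p1 kernel_pd[OF \<eta>(1) b]]) (simp add: pd_odd[OF s\<eta> \<eta>(2)])
  also have "(LINT z|cellm D. f z * pd b \<psi> z * mollify \<eta> g z) = 1 * smear D \<eta> (\<lambda>z. f z * pd b \<psi> z) g"
    by (rule smear_fubini(2)[OF p2 \<eta>(1)]) (simp add: \<eta>(2))
  finally show "(LINT z|cellm D. f z * pd b (\<lambda>z. \<psi> z * mollify \<eta> g z) z) =
     smear D \<eta> (\<lambda>z. f z * pd b \<psi> z) g - smear D (pd b \<eta>) (\<lambda>z. f z * \<psi> z) g" by simp
qed

lemma integral_mol_test:
  fixes \<psi> :: "real \<times> (real ^ 'n) \<Rightarrow> real"
  assumes \<psi>: "test_function J D \<psi>" and \<eta>: "kernel r \<eta>" and r: "0 < r" "r < 1/4"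
    and f: "tame j f" and g: "tame l g" and jl: "j + l \<le> 3" and b: "b \<in> Basis"
  shows "(LINT z|cellm D. f z * pd b (mollify \<eta> (\<lambda>z. \<psi> z * g z)) z) = smear D (pd b \<eta>) (\<lambda>z. g z * \<psi> z) f"
    and "loc_int (1/4) (\<lambda>z. \<psi> z * g z)"
proof -
  have s\<eta>: "smooth \<eta>" and s\<psi>: "smooth \<psi>" using \<eta>(1) \<psi> unfolding kernel_def test_function_iff by blast+
  obtain B where "\<And>z. \<bar>\<psi> z\<bar> \<le> B" using cutoff_test_function(1)[OF \<psi>] unfolding cutoff_def by blast
  then show l: "loc_int (1/4) (\<lambda>z. \<psi> z * g z)"
    by (rule loc_int_tame[OF g _ smooth_borel[OF s\<psi>], rotated]) (use jl in simp)
  have z: "\<eta> z = 0" if "norm z > r" for z using \<eta>(1) that unfolding kernel_def by blast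
  have p: "paired D (\<lambda>z. g z * \<psi> z) f"
    by (rule paired_tame[OF g f _ cutoff_test_function(1)[OF \<psi>]]) (use jl in simp)
  have "pd b (mollify \<eta> (\<lambda>z. \<psi> z * g z)) = mollify (pd b \<eta>) (\<lambda>z. \<psi> z * g z)" by (rule pd_mol[OF l r s\<eta> z])
  then show "(LINT z|cellm D. f z * pd b (mollify \<eta> (\<lambda>z. \<psi> z * g z)) z) = smear D (pd b \<eta>) (\<lambda>z. g z * \<psi> z) f"
    using smear_fubini(1)[OF p kernel_pd[OF \<eta> b]] by (simp add: mult.commute[of "\<psi> _"])
qed

lemma euler_split:
  assumes \<phi>: "test_function {0<..<T} D \<phi>"
  shows "(LINT z|cellm D. V z $ i * pd t_dir \<phi> z) + (\<Sum>k\<in>UNIV. LINT z|cellm D. (V z $ i * V z $ k) * pd (x_dir k) \<phi> z)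
     + (LINT z|cellm D. P z * pd (x_dir i) \<phi> z) = 0"
proof -
  have i1: "integrable (cellm D) (\<lambda>z. V z $ i * pd t_dir \<phi> z)"
    by (rule integrable_tame_pd[OF \<phi> tame_V _ t_dir_Basis]) simp
  have i2: "integrable (cellm D) (\<lambda>z. V z $ i * V z $ k * pd (x_dir k) \<phi> z)" for k
    by (rule integrable_tame_pd[OF \<phi> tame_VV _ x_dir_Basis]) simp
  have i3: "integrable (cellm D) (\<lambda>z. P z * pd (x_dir i) \<phi> z)"
    by (rule integrable_tame_pd[OF \<phi> tame_P _ x_dir_Basis]) simp
  show ?thesis using euler[OF \<phi>, of i] i1 i2 i3 unfolding dt_eq_pd dx_eq_pd by simp
qed

lemma div_free_split:
  assumes \<phi>: "test_function {0<..<T} D \<phi>"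
  shows "(\<Sum>k\<in>UNIV. LINT z|cellm D. V z $ k * pd (x_dir k) \<phi> z) = 0"
proof -
  have "integrable (cellm D) (\<lambda>z. V z $ k * pd (x_dir k) \<phi> z)" for k
    by (rule integrable_tame_pd[OF \<phi> tame_V _ x_dir_Basis]) simp
  then show ?thesis using div_free[OF \<phi>] unfolding dx_eq_pd by simp
qed

text \<open>
  The Euler equation for each component is tested with \<open>\<psi> V\<^sub>i\<^sup>\<eta>\<close> and \<open>(\<psi> V\<^sub>i)\<^sup>\<eta>\<close> (facts \<open>e1\<close>, \<open>e2\<close>),
  the divergence condition with \<open>\<psi> P\<^sup>\<eta>\<close>, \<open>(\<psi> P)\<^sup>\<eta>\<close>, \<open>\<psi> N\<^sup>\<eta>\<close> and \<open>(\<psi> N)\<^sup>\<eta>\<close> (\<open>d1\<close> to \<open>d4\<close>). The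
  terms \<open>t1\<close> and \<open>t2\<close> come from \<open>\<bar>v\<bar>\<^sup>2 v\<close> evaluated at only one of the two points and need no
  equation. The right-hand side collects the six products into which
  \<open>(v(z+w) - v(z))\<^sup>k \<bar>v(z+w) - v(z)\<bar>\<^sup>2\<close> expands.
\<close>

lemma smeared_balance:
  fixes \<psi> :: "real \<times> (real ^ 'n) \<Rightarrow> real"
  assumes \<psi>: "test_function {0<..<T} D \<psi>"
    and ok: "mollifiable {0<..<T} D \<psi> r0"
    and \<eta>: "kernel r \<eta>" "\<And>w. \<eta> (- w) = \<eta> w" and r: "0 < r" "r < 1/4" "r \<le> r0"
  shows "(\<Sum>i\<in>UNIV. smear D \<eta> (\<lambda>z. V z $ i * pd t_dir \<psi> z) (\<lambda>z. V z $ i))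
     + (\<Sum>i\<in>UNIV. \<Sum>k\<in>UNIV. smear D \<eta> (\<lambda>z. V z $ i * V z $ k * pd (x_dir k) \<psi> z) (\<lambda>z. V z $ i))
     + (\<Sum>i\<in>UNIV. smear D \<eta> (\<lambda>z. P z * pd (x_dir i) \<psi> z) (\<lambda>z. V z $ i))
     + (\<Sum>i\<in>UNIV. smear D \<eta> (\<lambda>z. V z $ i * pd (x_dir i) \<psi> z) P)
     + (\<Sum>k\<in>UNIV. smear D \<eta> (\<lambda>z. 1 * pd (x_dir k) \<psi> z) (\<lambda>z. V z $ k * N z)) / 2
     - (\<Sum>k\<in>UNIV. smear D \<eta> (\<lambda>z. V z $ k * pd (x_dir k) \<psi> z) N) / 2
   = (\<Sum>k\<in>UNIV. smear D (pd (x_dir k) \<eta>) (\<lambda>z. 1 * \<psi> z) (\<lambda>z. V z $ k * N z)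
        - 2 * (\<Sum>i\<in>UNIV. smear D (pd (x_dir k) \<eta>) (\<lambda>z. V z $ i * \<psi> z) (\<lambda>z. V z $ i * V z $ k))
        + smear D (pd (x_dir k) \<eta>) (\<lambda>z. N z * \<psi> z) (\<lambda>z. V z $ k)
        - smear D (pd (x_dir k) \<eta>) (\<lambda>z. V z $ k * \<psi> z) N
        + 2 * (\<Sum>i\<in>UNIV. smear D (pd (x_dir k) \<eta>) (\<lambda>z. V z $ i * V z $ k * \<psi> z) (\<lambda>z. V z $ i))
        - smear D (pd (x_dir k) \<eta>) (\<lambda>z. V z $ k * N z * \<psi> z) (\<lambda>z. 1)) / 2"
proof -
  note A = integral_mult_test[OF \<psi> \<eta> r(1,2)]
  note B = integral_mol_test[OF \<psi> \<eta>(1) r(1,2)]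
  have T2: "test_function {0<..<T} D (mollify \<eta> (\<lambda>z. \<psi> z * g z))" if "tame l g" "l \<le> 3" for l g
    by (rule mollifiableD[OF ok r(1,3) \<eta>(1) tame_per[OF that(1)] B(2)[OF tame_1 that(1) _ t_dir_Basis] tame_borel[OF that(1)] r(2)])
      (use that in simp)
  have e1: "(smear D \<eta> (\<lambda>z. V z $ i * pd t_dir \<psi> z) (\<lambda>z. V z $ i) - smear D (pd t_dir \<eta>) (\<lambda>z. V z $ i * \<psi> z) (\<lambda>z. V z $ i))
    + (\<Sum>k\<in>UNIV. smear D \<eta> (\<lambda>z. V z $ i * V z $ k * pd (x_dir k) \<psi> z) (\<lambda>z. V z $ i)
         - smear D (pd (x_dir k) \<eta>) (\<lambda>z. V z $ i * V z $ k * \<psi> z) (\<lambda>z. V z $ i))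
    + (smear D \<eta> (\<lambda>z. P z * pd (x_dir i) \<psi> z) (\<lambda>z. V z $ i) - smear D (pd (x_dir i) \<eta>) (\<lambda>z. P z * \<psi> z) (\<lambda>z. V z $ i)) = 0" for i
    using euler_split[OF A(2)[OF tame_1 tame_V[of i] _ t_dir_Basis], of i]
    by (simp add: A(1)[OF tame_V tame_V _ t_dir_Basis] A(1)[OF tame_VV tame_V _ x_dir_Basis] A(1)[OF tame_P tame_V _ x_dir_Basis])
  have e2: "smear D (pd t_dir \<eta>) (\<lambda>z. V z $ i * \<psi> z) (\<lambda>z. V z $ i)
    + (\<Sum>k\<in>UNIV. smear D (pd (x_dir k) \<eta>) (\<lambda>z. V z $ i * \<psi> z) (\<lambda>z. V z $ i * V z $ k))
    + smear D (pd (x_dir i) \<eta>) (\<lambda>z. V z $ i * \<psi> z) P = 0" for i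
    using euler_split[OF T2[OF tame_V[of i]], of i]
    by (simp add: B(1)[OF tame_V tame_V _ t_dir_Basis] B(1)[OF tame_VV tame_V _ x_dir_Basis] B(1)[OF tame_P tame_V _ x_dir_Basis])
  have d1: "(\<Sum>i\<in>UNIV. smear D \<eta> (\<lambda>z. V z $ i * pd (x_dir i) \<psi> z) P - smear D (pd (x_dir i) \<eta>) (\<lambda>z. V z $ i * \<psi> z) P) = 0"
    using div_free_split[OF A(2)[OF tame_1 tame_P _ t_dir_Basis]] by (simp add: A(1)[OF tame_V tame_P _ x_dir_Basis])
  have d2: "(\<Sum>i\<in>UNIV. smear D (pd (x_dir i) \<eta>) (\<lambda>z. P z * \<psi> z) (\<lambda>z. V z $ i)) = 0"
    using div_free_split[OF T2[OF tame_P]] by (simp add: B(1)[OF tame_V tame_P _ x_dir_Basis])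
  have d3: "(\<Sum>i\<in>UNIV. smear D \<eta> (\<lambda>z. V z $ i * pd (x_dir i) \<psi> z) N - smear D (pd (x_dir i) \<eta>) (\<lambda>z. V z $ i * \<psi> z) N) = 0"
    using div_free_split[OF A(2)[OF tame_1 tame_N _ t_dir_Basis]] by (simp add: A(1)[OF tame_V tame_N _ x_dir_Basis])
  have d4: "(\<Sum>i\<in>UNIV. smear D (pd (x_dir i) \<eta>) (\<lambda>z. N z * \<psi> z) (\<lambda>z. V z $ i)) = 0"
    using div_free_split[OF T2[OF tame_N]] by (simp add: B(1)[OF tame_V tame_N _ x_dir_Basis])
  have s\<eta>: "smooth \<eta>" and s\<psi>: "smooth \<psi>" using \<eta>(1) \<psi> unfolding kernel_def test_function_iff by blast+
  have t1: "smear D (pd (x_dir k) \<eta>) (\<lambda>z. V z $ k * N z * \<psi> z) (\<lambda>z. 1) = 0" for k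
    unfolding smear_def corr_def using integral_pd_eq_0[OF \<eta>(1) r(1) x_dir_Basis[of k]] by simp
  have t2: "smear D (pd (x_dir k) \<eta>) (\<lambda>z. 1 * \<psi> z) (\<lambda>z. V z $ k * N z) = smear D \<eta> (\<lambda>z. 1 * pd (x_dir k) \<psi> z) (\<lambda>z. V z $ k * N z)" for k
  proof -
    have p1: "paired D (\<lambda>z. 1 * \<psi> z) (\<lambda>z. V z $ k * N z)"
      by (rule paired_tame[OF tame_1 tame_VN _ cutoff_test_function(1)[OF \<psi>]]) simp
    have p2: "paired D (\<lambda>z. 1 * pd (x_dir k) \<psi> z) (\<lambda>z. V z $ k * N z)"
      by (rule paired_tame[OF tame_1 tame_VN _ cutoff_test_function(2)[OF \<psi> x_dir_Basis]]) simp
    have "mollify (pd (x_dir k) \<eta>) \<psi> = mollify \<eta> (pd (x_dir k) \<psi>)"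
      by (rule ext) (rule mol_pd_commute[OF \<eta>(1) r(1) \<eta>(2) s\<psi> x_dir_Basis])
    then show ?thesis
      using smear_fubini(1)[OF p1 kernel_pd[OF \<eta>(1) x_dir_Basis[of k]]] smear_fubini(1)[OF p2 \<eta>(1)] by simp
  qed
  define X1 where "X1 = (\<Sum>i\<in>UNIV. smear D \<eta> (\<lambda>z. V z $ i * pd t_dir \<psi> z) (\<lambda>z. V z $ i))"
  define X2 where "X2 = (\<Sum>i\<in>UNIV. smear D (pd t_dir \<eta>) (\<lambda>z. V z $ i * \<psi> z) (\<lambda>z. V z $ i))"
  define X3 where "X3 = (\<Sum>i\<in>UNIV. \<Sum>k\<in>UNIV. smear D \<eta> (\<lambda>z. V z $ i * V z $ k * pd (x_dir k) \<psi> z) (\<lambda>z. V z $ i))"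
  define X4 where "X4 = (\<Sum>i\<in>UNIV. \<Sum>k\<in>UNIV. smear D (pd (x_dir k) \<eta>) (\<lambda>z. V z $ i * V z $ k * \<psi> z) (\<lambda>z. V z $ i))"
  define X5 where "X5 = (\<Sum>i\<in>UNIV. smear D \<eta> (\<lambda>z. P z * pd (x_dir i) \<psi> z) (\<lambda>z. V z $ i))"
  define X6 where "X6 = (\<Sum>i\<in>UNIV. smear D (pd (x_dir i) \<eta>) (\<lambda>z. P z * \<psi> z) (\<lambda>z. V z $ i))"
  define X7 where "X7 = (\<Sum>i\<in>UNIV. \<Sum>k\<in>UNIV. smear D (pd (x_dir k) \<eta>) (\<lambda>z. V z $ i * \<psi> z) (\<lambda>z. V z $ i * V z $ k))"
  define X8 where "X8 = (\<Sum>i\<in>UNIV. smear D (pd (x_dir i) \<eta>) (\<lambda>z. V z $ i * \<psi> z) P)"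
  define X9 where "X9 = (\<Sum>i\<in>UNIV. smear D \<eta> (\<lambda>z. V z $ i * pd (x_dir i) \<psi> z) P)"
  define Y1 where "Y1 = (\<Sum>i\<in>UNIV. smear D \<eta> (\<lambda>z. V z $ i * pd (x_dir i) \<psi> z) N)"
  define Y2 where "Y2 = (\<Sum>i\<in>UNIV. smear D (pd (x_dir i) \<eta>) (\<lambda>z. V z $ i * \<psi> z) N)"
  define Y3 where "Y3 = (\<Sum>k\<in>UNIV. smear D \<eta> (\<lambda>z. 1 * pd (x_dir k) \<psi> z) (\<lambda>z. V z $ k * N z))"
  have E1: "X1 - X2 + (X3 - X4) + (X5 - X6) = 0"
    using sum.neutral[where A = UNIV, OF ballI[OF e1]] unfolding X1_def X2_def X3_def X4_def X5_def X6_def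
    by (simp only: sum.distrib sum_subtractf sum.neutral_const)
  have E2: "X2 + X7 + X8 = 0"
    using sum.neutral[where A = UNIV, OF ballI[OF e2]] unfolding X2_def X7_def X8_def
    by (simp only: sum.distrib sum.neutral_const)
  have D1: "X9 - X8 = 0" using d1 unfolding X9_def X8_def sum_subtractf .
  have D2: "X6 = 0" using d2 unfolding X6_def .
  have D3: "Y1 - Y2 = 0" using d3 unfolding Y1_def Y2_def sum_subtractf .
  have s4: "(\<Sum>k\<in>UNIV. \<Sum>i\<in>UNIV. smear D (pd (x_dir k) \<eta>) (\<lambda>z. V z $ i * V z $ k * \<psi> z) (\<lambda>z. V z $ i)) = X4"
    unfolding X4_def by (rule sum.swap)
  have s7: "(\<Sum>k\<in>UNIV. \<Sum>i\<in>UNIV. smear D (pd (x_dir k) \<eta>) (\<lambda>z. V z $ i * \<psi> z) (\<lambda>z. V z $ i * V z $ k)) = X7"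
    unfolding X7_def by (rule sum.swap)
  have "X1 + X3 + X5 + X9 + Y3 / 2 - Y1 / 2 = (Y3 - 2 * X7 + 0 - Y2 + 2 * X4 - 0) / 2"
    using E1 E2 D1 D2 D3 by (simp add: field_simps)
  then show ?thesis
    unfolding sum_divide_distrib[symmetric] sum_subtractf sum.distrib sum_distrib_left[symmetric] t1 t2 s4 s7 d4
    unfolding X1_def X3_def X5_def X9_def Y3_def Y1_def Y2_def by simp
qed

end

section \<open>Continuity of correlations\<close>

lemma cube_add_le: "0 \<le> x \<Longrightarrow> 0 \<le> y \<Longrightarrow> (x + y) ^ 3 \<le> 4 * x ^ 3 + 4 * (y::real) ^ 3"
proof -
  assume xy: "0 \<le> x" "0 \<le> y"
  have "4 * x ^ 3 + 4 * y ^ 3 - (x + y) ^ 3 = 3 * (x + y) * (x - y)\<^sup>2"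
    by (simp add: power3_eq_cube power2_eq_square algebra_simps)
  also have "\<dots> \<ge> 0" using xy by simp
  finally show ?thesis by simp
qed

text \<open>
  It reduces the continuity of translations in \<open>L\<^sup>3\<close> to that in \<open>L\<^sup>1\<close>, applied to the cube.
  After division by \<open>\<bar>x - y\<bar>\<close> it is \<open>(x - y)\<^sup>2 \<le> 4 (x\<^sup>2 + x y + y\<^sup>2)\<close>, that is \<open>0 \<le> 3 (x + y)\<^sup>2\<close>.
\<close>

lemma cube_diff_le: "\<bar>x - y\<bar> ^ 3 \<le> 4 * \<bar>x ^ 3 - (y::real) ^ 3\<bar>"
proof -
  have f: "x ^ 3 - y ^ 3 = (x - y) * (x\<^sup>2 + x * y + y\<^sup>2)"
    by (simp add: power3_eq_cube power2_eq_square algebra_simps)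
  have "4 * (x\<^sup>2 + x * y + y\<^sup>2) - (x - y)\<^sup>2 = 3 * (x + y)\<^sup>2"
    by (simp add: power2_eq_square algebra_simps)
  then have g: "(x - y)\<^sup>2 \<le> 4 * (x\<^sup>2 + x * y + y\<^sup>2)"
    using zero_le_power2[of "x + y"] by linarith
  have "\<bar>x - y\<bar> ^ 3 = \<bar>x - y\<bar> * (x - y)\<^sup>2" by (simp add: power3_eq_cube power2_eq_square)
  also have "\<dots> \<le> \<bar>x - y\<bar> * (4 * (x\<^sup>2 + x * y + y\<^sup>2))" by (rule mult_left_mono[OF g]) simp
  also have "\<dots> \<le> \<bar>x - y\<bar> * (4 * \<bar>x\<^sup>2 + x * y + y\<^sup>2\<bar>)" by (intro mult_left_mono) auto
  also have "\<dots> = 4 * \<bar>x ^ 3 - y ^ 3\<bar>" unfolding f abs_mult by simp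
  finally show ?thesis .
qed

text \<open>
  The first term dominates if \<open>y \<le> l q\<close>, the second one otherwise. Choosing \<open>l\<close> small and then
  the shift small replaces the Hoelder inequality with exponents \<open>3/2\<close> and \<open>3\<close>.
\<close>

lemma young_weighted:
  fixes q y l :: real
  assumes "0 \<le> q" "0 \<le> y" "0 < l"
  shows "q\<^sup>2 * y \<le> l * q ^ 3 + y ^ 3 / l\<^sup>2"
proof (cases "y \<le> l * q")
  case True
  have "q\<^sup>2 * y \<le> q\<^sup>2 * (l * q)" by (rule mult_left_mono[OF True]) simp
  also have "\<dots> = l * q ^ 3" by (simp add: power2_eq_square power3_eq_cube)
  also have "\<dots> \<le> l * q ^ 3 + y ^ 3 / l\<^sup>2" using assms by simp
  finally show ?thesis .
next
  case False
  then have "q \<le> y / l" using assms by (simp add: field_simps)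
  then have "q\<^sup>2 \<le> (y / l)\<^sup>2" by (rule power_mono) (use assms in simp)
  then have "q\<^sup>2 * y \<le> (y / l)\<^sup>2 * y" by (rule mult_right_mono) (use assms in simp)
  also have "\<dots> = y ^ 3 / l\<^sup>2" by (simp add: power2_eq_square power3_eq_cube power_divide)
  also have "\<dots> \<le> l * q ^ 3 + y ^ 3 / l\<^sup>2" using assms by simp
  finally show ?thesis .
qed

lemma cellm_shift_diff_cube:
  fixes G :: "real \<times> (real ^ 'n) \<Rightarrow> 'b::euclidean_space"
  assumes [measurable]: "G \<in> borel_measurable borel" and p: "x_periodic D G" and G3: "integrable (cellm D) (\<lambda>z. norm (G z) ^ 3)"
  shows "integrable (cellm D) (\<lambda>z. norm (G (z + w) - G (z + w')) ^ 3)"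
proof -
  have sp: "x_periodic D (\<lambda>z. norm (G z) ^ 3)" unfolding x_periodic_def using x_periodicD[OF p] by simp
  have "integrable (cellm D) (\<lambda>z. 4 * norm (G (z + w)) ^ 3 + 4 * norm (G (z + w')) ^ 3)"
    using cellm_shift(1)[OF G3 sp] by simp
  then show ?thesis
  proof (rule Bochner_Integration.integrable_bound)
    show "AE z in cellm D. norm (norm (G (z + w) - G (z + w')) ^ 3) \<le> norm (4 * norm (G (z + w)) ^ 3 + 4 * norm (G (z + w')) ^ 3)"
    proof (rule AE_I2)
      fix z
      have "norm (G (z + w) - G (z + w')) ^ 3 \<le> (norm (G (z + w)) + norm (G (z + w'))) ^ 3"
        by (intro power_mono norm_triangle_ineq4) simp
      also have "\<dots> \<le> 4 * norm (G (z + w)) ^ 3 + 4 * norm (G (z + w')) ^ 3" by (rule cube_add_le) auto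
      finally show "norm (norm (G (z + w) - G (z + w')) ^ 3) \<le> norm (4 * norm (G (z + w)) ^ 3 + 4 * norm (G (z + w')) ^ 3)"
        by simp
    qed
  qed simp
qed

lemma L3_trans_cont:
  assumes [measurable]: "G \<in> borel_measurable borel" and p: "x_periodic D G" and G3: "integrable (cellm D) (\<lambda>z. \<bar>G z\<bar> ^ 3)"
    and X: "X \<longlonglongrightarrow> 0"
  shows "(\<lambda>n. LINT z|cellm D. \<bar>G (z + X n) - G z :: real\<bar> ^ 3) \<longlonglongrightarrow> 0"
proof -
  have i: "integrable (cellm D) (\<lambda>z. G z ^ 3)"
    by (rule Bochner_Integration.integrable_bound[OF G3]) (auto simp: power_abs)
  have sp: "x_periodic D (\<lambda>z. G z ^ 3)" unfolding x_periodic_def using x_periodicD[OF p] by simp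
  have "(\<lambda>n. 4 * (LINT z|cellm D. \<bar>G (z + X n) ^ 3 - G z ^ 3\<bar>)) \<longlonglongrightarrow> 4 * 0"
    by (intro tendsto_mult tendsto_const cellm_trans_cont[OF i sp X])
  then have lim: "(\<lambda>n. 4 * (LINT z|cellm D. \<bar>G (z + X n) ^ 3 - G z ^ 3\<bar>)) \<longlonglongrightarrow> 0" by simp
  show ?thesis
  proof (rule tendsto_sandwich[OF always_eventually always_eventually tendsto_const lim])
    show "\<forall>n. 0 \<le> (LINT z|cellm D. \<bar>G (z + X n) - G z\<bar> ^ 3)" by (intro allI Bochner_Integration.integral_nonneg) auto
    show "\<forall>n. (LINT z|cellm D. \<bar>G (z + X n) - G z\<bar> ^ 3) \<le> 4 * (LINT z|cellm D. \<bar>G (z + X n) ^ 3 - G z ^ 3\<bar>)"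
    proof
      fix n
      have "(LINT z|cellm D. \<bar>G (z + X n) - G z\<bar> ^ 3) \<le> (LINT z|cellm D. 4 * \<bar>G (z + X n) ^ 3 - G z ^ 3\<bar>)"
      proof (rule integral_mono)
        show "integrable (cellm D) (\<lambda>z. \<bar>G (z + X n) - G z\<bar> ^ 3)"
          using cellm_shift_diff_cube[of G D "X n" 0] p G3 by simp
        show "integrable (cellm D) (\<lambda>z. 4 * \<bar>G (z + X n) ^ 3 - G z ^ 3\<bar>)"
          using cellm_shift(1)[OF i sp] i by simp
      qed (rule cube_diff_le)
      then show "(LINT z|cellm D. \<bar>G (z + X n) - G z\<bar> ^ 3) \<le> 4 * (LINT z|cellm D. \<bar>G (z + X n) ^ 3 - G z ^ 3\<bar>)"
        by simp
    qed
  qed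
qed

text \<open>
  The bound \<open>\<bar>F\<bar> \<le> q\<^sup>2\<close> with \<open>q\<^sup>3\<close> integrable expresses that \<open>F\<close> is of class \<open>L\<^sup>3\<^sup>/\<^sup>2\<close>.
\<close>

lemma corr_cont_32_3:
  assumes pr: "paired D F G" and q: "\<And>z. 0 \<le> q z" "\<And>z. \<bar>F z\<bar> \<le> (q z)\<^sup>2" "integrable (cellm D) (\<lambda>z. q z ^ 3)"
    and G3: "integrable (cellm D) (\<lambda>z. \<bar>G z\<bar> ^ 3)" and X: "X \<longlonglongrightarrow> 0"
  shows "(\<lambda>n. corr D F G (X n)) \<longlonglongrightarrow> corr D F G 0"
proof (rule LIMSEQ_I)
  fix e :: real assume e: "0 < e"
  have G[measurable]: "G \<in> borel_measurable borel" and p: "x_periodic D G" using pr unfolding paired_def by auto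
  define I where "I = (LINT z|cellm D. q z ^ 3)"
  have I: "I \<ge> 0" unfolding I_def by (rule Bochner_Integration.integral_nonneg) (simp add: q(1))
  define l where "l = e / 2 / (I + 1)"
  have l: "l > 0" unfolding l_def using e I by simp
  have "l * I \<le> l * (I + 1)" using l by simp
  also have "l * (I + 1) = e / 2" by (rule nonzero_eq_divide_eq[THEN iffD1, OF _ l_def]) (use I in simp)
  finally have lI: "l * I \<le> e / 2" .
  have pos: "l\<^sup>2 * (e / 2) > 0" using l e by simp
  have "(\<lambda>n. LINT z|cellm D. \<bar>G (z + X n) - G z\<bar> ^ 3) \<longlonglongrightarrow> 0"
    by (rule L3_trans_cont[OF G p G3 X])
  then obtain M where M: "\<And>n. n \<ge> M \<Longrightarrow> norm ((LINT z|cellm D. \<bar>G (z + X n) - G z\<bar> ^ 3) - 0) < l\<^sup>2 * (e / 2)"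
    using LIMSEQ_D[OF _ pos] by blast
  have "norm (corr D F G (X n) - corr D F G 0) < e" if n: "n \<ge> M" for n
  proof -
    have i1: "integrable (cellm D) (\<lambda>z. F z * G (z + w))" for w by (rule paired_integrable[OF pr])
    have i2: "integrable (cellm D) (\<lambda>z. \<bar>G (z + X n) - G z\<bar> ^ 3)"
      using cellm_shift_diff_cube[of G D "X n" 0] p G3 by simp
    have "corr D F G (X n) - corr D F G 0 = (LINT z|cellm D. F z * G (z + X n) - F z * G z)"
      unfolding corr_def using i1[of "X n"] i1[of 0] by simp
    also have "norm \<dots> \<le> (LINT z|cellm D. l * q z ^ 3 + \<bar>G (z + X n) - G z\<bar> ^ 3 / l\<^sup>2)"
    proof (rule Bochner_Integration.integral_norm_bound_integral)
      show "integrable (cellm D) (\<lambda>z. F z * G (z + X n) - F z * G z)" using i1[of "X n"] i1[of 0] by simp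
      show "integrable (cellm D) (\<lambda>z. l * q z ^ 3 + \<bar>G (z + X n) - G z\<bar> ^ 3 / l\<^sup>2)" using q(3) i2 by simp
      fix z
      have "norm (F z * G (z + X n) - F z * G z) = \<bar>F z\<bar> * \<bar>G (z + X n) - G z\<bar>"
        by (simp add: abs_mult[symmetric] right_diff_distrib)
      also have "\<dots> \<le> (q z)\<^sup>2 * \<bar>G (z + X n) - G z\<bar>" by (rule mult_right_mono[OF q(2)]) simp
      also have "\<dots> \<le> l * q z ^ 3 + \<bar>G (z + X n) - G z\<bar> ^ 3 / l\<^sup>2" by (rule young_weighted[OF q(1) _ l]) simp
      finally show "norm (F z * G (z + X n) - F z * G z) \<le> l * q z ^ 3 + \<bar>G (z + X n) - G z\<bar> ^ 3 / l\<^sup>2" .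
    qed
    also have "\<dots> = l * I + (LINT z|cellm D. \<bar>G (z + X n) - G z\<bar> ^ 3) / l\<^sup>2" unfolding I_def using q(3) i2 by simp
    also have "(LINT z|cellm D. \<bar>G (z + X n) - G z\<bar> ^ 3) / l\<^sup>2 < e / 2"
      using M[OF n] l by (simp add: pos_divide_less_eq mult.commute)
    finally show ?thesis using lI by simp
  qed
  then show "\<exists>no. \<forall>n\<ge>no. norm (corr D F G (X n) - corr D F G 0) < e" by blast
qed

lemma corr_cont_inf_1:
  assumes pr: "paired D F G" and B: "\<And>z. \<bar>F z\<bar> \<le> B" and G: "integrable (cellm D) G" and X: "X \<longlonglongrightarrow> 0"
  shows "(\<lambda>n. corr D F G (X n)) \<longlonglongrightarrow> corr D F G 0"
proof -
  have p: "x_periodic D G" using pr unfolding paired_def by auto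
  have "(\<lambda>n. B * (LINT z|cellm D. \<bar>G (z + X n) - G z\<bar>)) \<longlonglongrightarrow> B * 0"
    by (intro tendsto_mult tendsto_const cellm_trans_cont[OF G p X])
  then have lim: "(\<lambda>n. B * (LINT z|cellm D. \<bar>G (z + X n) - G z\<bar>)) \<longlonglongrightarrow> 0" by simp
  have "(\<lambda>n. corr D F G (X n) - corr D F G 0) \<longlonglongrightarrow> 0"
  proof (rule Lim_null_comparison[OF always_eventually lim], rule allI)
    fix n
    have i1: "integrable (cellm D) (\<lambda>z. F z * G (z + w))" for w by (rule paired_integrable[OF pr])
    have i2: "integrable (cellm D) (\<lambda>z. \<bar>G (z + X n) - G z\<bar>)" using cellm_shift(1)[OF G p] G by simp
    have "corr D F G (X n) - corr D F G 0 = (LINT z|cellm D. F z * G (z + X n) - F z * G z)"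
      unfolding corr_def using i1[of "X n"] i1[of 0] by simp
    also have "norm \<dots> \<le> (LINT z|cellm D. B * \<bar>G (z + X n) - G z\<bar>)"
    proof (rule Bochner_Integration.integral_norm_bound_integral)
      show "integrable (cellm D) (\<lambda>z. F z * G (z + X n) - F z * G z)" using i1[of "X n"] i1[of 0] by simp
      show "integrable (cellm D) (\<lambda>z. B * \<bar>G (z + X n) - G z\<bar>)" using i2 by simp
      fix z
      have "norm (F z * G (z + X n) - F z * G z) = \<bar>F z\<bar> * \<bar>G (z + X n) - G z\<bar>"
        by (simp add: abs_mult[symmetric] right_diff_distrib)
      also have "\<dots> \<le> B * \<bar>G (z + X n) - G z\<bar>" by (rule mult_right_mono[OF B]) simp
      finally show "norm (F z * G (z + X n) - F z * G z) \<le> B * \<bar>G (z + X n) - G z\<bar>" .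
    qed
    also have "\<dots> = B * (LINT z|cellm D. \<bar>G (z + X n) - G z\<bar>)" by simp
    finally show "norm (corr D F G (X n) - corr D F G 0) \<le> B * (LINT z|cellm D. \<bar>G (z + X n) - G z\<bar>)" .
  qed
  then show ?thesis by (simp add: LIM_zero_iff)
qed

context weak_solution
begin

lemma corr_cont_V:
  assumes f: "tame j f" and j: "j \<le> 2" and c: "cutoff D c" and X: "X \<longlonglongrightarrow> 0"
  shows "(\<lambda>n. corr D (\<lambda>z. f z * c z) (\<lambda>z. V z $ i) (X n)) \<longlonglongrightarrow> corr D (\<lambda>z. f z * c z) (\<lambda>z. V z $ i) 0"
proof (rule corr_cont_32_3[where q = "\<lambda>z. sqrt \<bar>c z\<bar> * (1 + m z)", OF _ _ _ _ _ X])
  obtain B where B: "\<And>z. \<bar>c z\<bar> \<le> B" using c unfolding cutoff_def by blast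
  have ci: "integrable (cellm D) c" and [measurable]: "c \<in> borel_measurable borel" using c unfolding cutoff_def by auto
  show "paired D (\<lambda>z. f z * c z) (\<lambda>z. V z $ i)" by (rule paired_tame[OF f tame_V _ c]) (use j in simp)
  show "0 \<le> sqrt \<bar>c z\<bar> * (1 + m z)" for z using m_nonneg[of z] by simp
  show "\<bar>f z * c z\<bar> \<le> (sqrt \<bar>c z\<bar> * (1 + m z))\<^sup>2" for z
  proof -
    have "\<bar>f z\<bar> \<le> m z ^ j" by (rule tame_le[OF f])
    also have "\<dots> \<le> (1 + m z) ^ j" by (rule power_mono) (use m_nonneg in auto)
    also have "\<dots> \<le> (1 + m z) ^ 2" by (rule power_increasing) (use j m_nonneg in auto)
    finally have "\<bar>c z\<bar> * \<bar>f z\<bar> \<le> \<bar>c z\<bar> * (1 + m z)\<^sup>2" by (rule mult_left_mono) simp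
    then show ?thesis by (simp add: abs_mult power_mult_distrib mult.commute)
  qed
  show "integrable (cellm D) (\<lambda>z. (sqrt \<bar>c z\<bar> * (1 + m z)) ^ 3)"
  proof (rule Bochner_Integration.integrable_bound)
    show "integrable (cellm D) (\<lambda>z. 4 * sqrt B * (\<bar>c z\<bar> + B * m z ^ 3))" using ci m3_integrable by simp
    show "AE z in cellm D. norm ((sqrt \<bar>c z\<bar> * (1 + m z)) ^ 3) \<le> norm (4 * sqrt B * (\<bar>c z\<bar> + B * m z ^ 3))"
    proof (rule AE_I2)
      fix z
      have B0: "0 \<le> B" using B[of z] by linarith
      have "norm ((sqrt \<bar>c z\<bar> * (1 + m z)) ^ 3) = sqrt \<bar>c z\<bar> * (\<bar>c z\<bar> * (1 + m z) ^ 3)"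
        using m_nonneg[of z] by (simp add: power_mult_distrib power3_eq_cube abs_mult)
      also have "\<dots> \<le> sqrt B * (\<bar>c z\<bar> * (4 + 4 * m z ^ 3))"
        using cube_add_le[of 1 "m z"] m_nonneg[of z] B[of z] B0 by (intro mult_mono mult_left_mono) auto
      also have "\<dots> = 4 * sqrt B * (\<bar>c z\<bar> + \<bar>c z\<bar> * m z ^ 3)" by (simp add: algebra_simps)
      also have "\<dots> \<le> 4 * sqrt B * (\<bar>c z\<bar> + B * m z ^ 3)"
        using B[of z] B0 m_nonneg[of z] by (intro mult_left_mono add_left_mono mult_right_mono) auto
      also have "\<dots> \<le> norm (4 * sqrt B * (\<bar>c z\<bar> + B * m z ^ 3))" by simp
      finally show "norm ((sqrt \<bar>c z\<bar> * (1 + m z)) ^ 3) \<le> norm (4 * sqrt B * (\<bar>c z\<bar> + B * m z ^ 3))" .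
    qed
  qed simp
  show "integrable (cellm D) (\<lambda>z. \<bar>V z $ i\<bar> ^ 3)"
  proof (rule Bochner_Integration.integrable_bound[OF m3_integrable])
    show "AE z in cellm D. norm (\<bar>V z $ i\<bar> ^ 3) \<le> norm (m z ^ 3)"
      using power_mono[OF tame_le[OF tame_V], of _ i 3] m_nonneg by (intro AE_I2) (simp add: power_abs)
    show "(\<lambda>z. \<bar>V z $ i\<bar> ^ 3) \<in> borel_measurable (cellm D)" using tame_borel[OF tame_V[of i]] by simp
  qed
qed

text \<open>
  Here the factor of degree two is the shifted one; by \<open>corr_swap\<close> the shift is moved to the
  other factor, of class \<open>L\<^sup>3\<close>.
\<close>

lemma corr_cont_V':
  assumes f: "tame 2 f" and c: "cutoff D c" and X: "X \<longlonglongrightarrow> 0"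
  shows "(\<lambda>n. corr D (\<lambda>z. V z $ i * c z) f (X n)) \<longlonglongrightarrow> corr D (\<lambda>z. V z $ i * c z) f 0"
proof -
  obtain B where B: "\<And>z. \<bar>c z\<bar> \<le> B" using c unfolding cutoff_def by blast
  have [measurable]: "c \<in> borel_measurable borel" using c unfolding cutoff_def by auto
  have pr: "paired D (\<lambda>z. V z $ i * c z) f" by (rule paired_tame[OF tame_V f _ c]) simp
  have X': "(\<lambda>n. - X n) \<longlonglongrightarrow> 0" using tendsto_minus[OF X] by simp
  have "(\<lambda>n. corr D f (\<lambda>z. V z $ i * c z) (- X n)) \<longlonglongrightarrow> corr D f (\<lambda>z. V z $ i * c z) 0"
  proof (rule corr_cont_32_3[where q = m, OF paired_sym[OF pr] m_nonneg tame_le[OF f] m3_integrable _ X'])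
    show "integrable (cellm D) (\<lambda>z. \<bar>V z $ i * c z\<bar> ^ 3)"
    proof (rule Bochner_Integration.integrable_bound)
      show "integrable (cellm D) (\<lambda>z. (B * m z) ^ 3)" using m3_integrable by (simp add: power_mult_distrib)
      show "AE z in cellm D. norm (\<bar>V z $ i * c z\<bar> ^ 3) \<le> norm ((B * m z) ^ 3)"
      proof (rule AE_I2)
        fix z
        have "\<bar>V z $ i * c z\<bar> \<le> m z * B"
          unfolding abs_mult using tame_le[OF tame_V[of i], of z] B[of z] m_nonneg[of z] by (intro mult_mono) auto
        then have "\<bar>V z $ i * c z\<bar> ^ 3 \<le> (B * m z) ^ 3" by (intro power_mono) (auto simp: mult.commute)
        then show "norm (\<bar>V z $ i * c z\<bar> ^ 3) \<le> norm ((B * m z) ^ 3)" by simp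
      qed
      show "(\<lambda>z. \<bar>V z $ i * c z\<bar> ^ 3) \<in> borel_measurable (cellm D)" using tame_borel[OF tame_V[of i]] by simp
    qed
  qed
  then show ?thesis using corr_swap[OF pr] corr_swap[OF pr, of 0] by simp
qed

text \<open>
  The point-split form of the energy balance tested with \<open>\<psi>\<close>, multiplied by two.
\<close>

definition flux :: "(real \<times> (real ^ 'n) \<Rightarrow> real) \<Rightarrow> real \<times> (real ^ 'n) \<Rightarrow> real" where
  "flux \<psi> w = (\<Sum>i\<in>UNIV. corr D (\<lambda>z. V z $ i * pd t_dir \<psi> z) (\<lambda>z. V z $ i) w)
     + (\<Sum>i\<in>UNIV. \<Sum>k\<in>UNIV. corr D (\<lambda>z. V z $ i * V z $ k * pd (x_dir k) \<psi> z) (\<lambda>z. V z $ i) w)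
     + (\<Sum>i\<in>UNIV. corr D (\<lambda>z. P z * pd (x_dir i) \<psi> z) (\<lambda>z. V z $ i) w)
     + (\<Sum>i\<in>UNIV. corr D (\<lambda>z. V z $ i * pd (x_dir i) \<psi> z) P w)
     + (\<Sum>k\<in>UNIV. corr D (\<lambda>z. 1 * pd (x_dir k) \<psi> z) (\<lambda>z. V z $ k * N z) w) / 2
     - (\<Sum>k\<in>UNIV. corr D (\<lambda>z. V z $ k * pd (x_dir k) \<psi> z) N w) / 2"

definition defect :: "(real \<times> (real ^ 'n) \<Rightarrow> real) \<Rightarrow> 'n \<Rightarrow> real \<times> (real ^ 'n) \<Rightarrow> real" where
  "defect \<psi> k w = (LINT z|cellm D. \<psi> z * ((V (z + w) - V z) $ k * (norm (V (z + w) - V z))\<^sup>2))"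

lemma VN_integrable: "integrable (cellm D) (\<lambda>z. V z $ k * N z)"
proof (rule Bochner_Integration.integrable_bound[OF m3_integrable])
  show "AE z in cellm D. norm (V z $ k * N z) \<le> norm (m z ^ 3)"
    using tame_le[OF tame_VN[of k]] by (intro AE_I2) (auto intro: order_trans[OF _ abs_ge_self])
  show "(\<lambda>z. V z $ k * N z) \<in> borel_measurable (cellm D)" using tame_borel[OF tame_VN[of k]] by simp
qed

lemma flux_cont:
  assumes \<psi>: "test_function J D \<psi>" and X: "X \<longlonglongrightarrow> 0"
  shows "(\<lambda>n. flux \<psi> (X n)) \<longlonglongrightarrow> flux \<psi> 0"
proof -
  note ct = cutoff_test_function(2)[OF \<psi> t_dir_Basis]
  note cx = cutoff_test_function(2)[OF \<psi> x_dir_Basis]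
  have "(\<lambda>n. corr D (\<lambda>z. 1 * pd (x_dir k) \<psi> z) (\<lambda>z. V z $ k * N z) (X n))
      \<longlonglongrightarrow> corr D (\<lambda>z. 1 * pd (x_dir k) \<psi> z) (\<lambda>z. V z $ k * N z) 0" for k
  proof -
    obtain B where B: "\<And>z. \<bar>pd (x_dir k) \<psi> z\<bar> \<le> B" using cx[of k] unfolding cutoff_def by blast
    show ?thesis
      by (rule corr_cont_inf_1[where B = B, OF paired_tame[OF tame_1 tame_VN _ cx] _ VN_integrable X]) (use B in auto)
  qed
  then show ?thesis unfolding flux_def
    by (intro tendsto_diff tendsto_add tendsto_sum tendsto_divide tendsto_const
      corr_cont_V[OF tame_V _ ct X] corr_cont_V[OF tame_VV _ cx X] corr_cont_V[OF tame_P _ cx X]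
      corr_cont_V'[OF tame_P cx X] corr_cont_V'[OF tame_N cx X]) auto
qed

lemma N_eq: "N z = (\<Sum>i\<in>UNIV. V z $ i * V z $ i)"
  unfolding N_def power2_norm_eq_inner inner_vec_def by simp

text \<open>
  Polarisation, \<open>\<bar>v(z+w) - v(z)\<bar>\<^sup>2 = N(z+w) - 2 v(z) \<cdot> v(z+w) + N(z)\<close>.
\<close>

lemma defect_expand:
  assumes \<psi>: "test_function J D \<psi>"
  shows "defect \<psi> k w = corr D (\<lambda>z. 1 * \<psi> z) (\<lambda>z. V z $ k * N z) w
        - 2 * (\<Sum>i\<in>UNIV. corr D (\<lambda>z. V z $ i * \<psi> z) (\<lambda>z. V z $ i * V z $ k) w)
        + corr D (\<lambda>z. N z * \<psi> z) (\<lambda>z. V z $ k) w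
        - corr D (\<lambda>z. V z $ k * \<psi> z) N w
        + 2 * (\<Sum>i\<in>UNIV. corr D (\<lambda>z. V z $ i * V z $ k * \<psi> z) (\<lambda>z. V z $ i) w)
        - corr D (\<lambda>z. V z $ k * N z * \<psi> z) (\<lambda>z. 1) w"
proof -
  note c = cutoff_test_function(1)[OF \<psi>]
  have i1: "integrable (cellm D) (\<lambda>z. 1 * \<psi> z * (V (z + w) $ k * N (z + w)))"
    by (rule paired_integrable[OF paired_tame[OF tame_1 tame_VN _ c]]) simp
  have i2: "integrable (cellm D) (\<lambda>z. V z $ i * \<psi> z * (V (z + w) $ i * V (z + w) $ k))" for i
    by (rule paired_integrable[OF paired_tame[OF tame_V tame_VV _ c]]) simp
  have i3: "integrable (cellm D) (\<lambda>z. N z * \<psi> z * V (z + w) $ k)"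
    by (rule paired_integrable[OF paired_tame[OF tame_N tame_V _ c]]) simp
  have i4: "integrable (cellm D) (\<lambda>z. V z $ k * \<psi> z * N (z + w))"
    by (rule paired_integrable[OF paired_tame[OF tame_V tame_N _ c]]) simp
  have i5: "integrable (cellm D) (\<lambda>z. V z $ i * V z $ k * \<psi> z * V (z + w) $ i)" for i
    by (rule paired_integrable[OF paired_tame[OF tame_VV tame_V _ c]]) simp
  have i6: "integrable (cellm D) (\<lambda>z. V z $ k * N z * \<psi> z * 1)"
    by (rule paired_integrable[OF paired_tame[OF tame_VN tame_1 _ c]]) simp
  have "\<psi> z * ((V (z + w) - V z) $ k * (norm (V (z + w) - V z))\<^sup>2) =
      1 * \<psi> z * (V (z + w) $ k * N (z + w))
      - 2 * (\<Sum>i\<in>UNIV. V z $ i * \<psi> z * (V (z + w) $ i * V (z + w) $ k))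
      + N z * \<psi> z * V (z + w) $ k
      - V z $ k * \<psi> z * N (z + w)
      + 2 * (\<Sum>i\<in>UNIV. V z $ i * V z $ k * \<psi> z * V (z + w) $ i)
      - V z $ k * N z * \<psi> z * 1" for z
  proof -
    define S where "S = (\<Sum>i\<in>UNIV. V z $ i * V (z + w) $ i)"
    have n: "(norm (V (z + w) - V z))\<^sup>2 = N (z + w) - 2 * S + N z"
      unfolding S_def N_eq power2_norm_eq_inner inner_vec_def sum_distrib_left
      by (simp add: sum.distrib[symmetric] sum_subtractf[symmetric] algebra_simps)
    have s1: "(\<Sum>i\<in>UNIV. V z $ i * \<psi> z * (V (z + w) $ i * V (z + w) $ k)) = \<psi> z * V (z + w) $ k * S"
      unfolding S_def sum_distrib_left by (simp add: mult_ac)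
    have s2: "(\<Sum>i\<in>UNIV. V z $ i * V z $ k * \<psi> z * V (z + w) $ i) = \<psi> z * V z $ k * S"
      unfolding S_def sum_distrib_left by (simp add: mult_ac)
    show ?thesis unfolding n s1 s2 by (simp add: algebra_simps)
  qed
  then show ?thesis
    unfolding defect_def corr_def
    by (simp only:) (rule has_bochner_integral_integral_eq, intro has_bochner_integral_add has_bochner_integral_diff
      has_bochner_integral_sum has_bochner_integral_mult_right has_bochner_integral_integrable i1 i2 i3 i4 i5 i6)
qed

lemma balance:
  fixes \<psi> :: "real \<times> (real ^ 'n) \<Rightarrow> real"
  assumes \<psi>: "test_function {0<..<T} D \<psi>"
    and ok: "mollifiable {0<..<T} D \<psi> r0"
    and \<eta>: "kernel r \<eta>" "\<And>w. \<eta> (- w) = \<eta> w" and r: "0 < r" "r < 1/4" "r \<le> r0"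
  shows "(LINT w|lborel. \<eta> w * flux \<psi> w) = (\<Sum>k\<in>UNIV. LINT w|lborel. pd (x_dir k) \<eta> w * defect \<psi> k w) / 2"
    and "integrable lborel (\<lambda>w. \<eta> w * flux \<psi> w)"
    and "integrable lborel (\<lambda>w. pd (x_dir k) \<eta> w * defect \<psi> k w)"
proof -
  note c = cutoff_test_function(1)[OF \<psi>]
  note ct = cutoff_test_function(2)[OF \<psi> t_dir_Basis]
  note cx = cutoff_test_function(2)[OF \<psi> x_dir_Basis]
  note k\<eta> = kernel_pd[OF \<eta>(1) x_dir_Basis]
  have i1[simp]: "integrable lborel (\<lambda>w. \<eta> w * corr D (\<lambda>z. V z $ i * pd t_dir \<psi> z) (\<lambda>z. V z $ i) w)" for i
    by (rule smear_integrable[OF paired_tame[OF tame_V tame_V _ ct] \<eta>(1)]) simp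
  have i2[simp]: "integrable lborel (\<lambda>w. \<eta> w * corr D (\<lambda>z. V z $ i * V z $ k * pd (x_dir k) \<psi> z) (\<lambda>z. V z $ i) w)" for i k
    by (rule smear_integrable[OF paired_tame[OF tame_VV tame_V _ cx] \<eta>(1)]) simp
  have i3[simp]: "integrable lborel (\<lambda>w. \<eta> w * corr D (\<lambda>z. P z * pd (x_dir i) \<psi> z) (\<lambda>z. V z $ i) w)" for i
    by (rule smear_integrable[OF paired_tame[OF tame_P tame_V _ cx] \<eta>(1)]) simp
  have i4[simp]: "integrable lborel (\<lambda>w. \<eta> w * corr D (\<lambda>z. V z $ i * pd (x_dir i) \<psi> z) P w)" for i
    by (rule smear_integrable[OF paired_tame[OF tame_V tame_P _ cx] \<eta>(1)]) simp
  have i5[simp]: "integrable lborel (\<lambda>w. \<eta> w * corr D (\<lambda>z. 1 * pd (x_dir k) \<psi> z) (\<lambda>z. V z $ k * N z) w)" for k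
    by (rule smear_integrable[OF paired_tame[OF tame_1 tame_VN _ cx] \<eta>(1)]) simp
  have i6[simp]: "integrable lborel (\<lambda>w. \<eta> w * corr D (\<lambda>z. V z $ k * pd (x_dir k) \<psi> z) N w)" for k
    by (rule smear_integrable[OF paired_tame[OF tame_V tame_N _ cx] \<eta>(1)]) simp
  have fl: "\<eta> w * flux \<psi> w = (\<Sum>i\<in>UNIV. \<eta> w * corr D (\<lambda>z. V z $ i * pd t_dir \<psi> z) (\<lambda>z. V z $ i) w)
     + (\<Sum>i\<in>UNIV. \<Sum>k\<in>UNIV. \<eta> w * corr D (\<lambda>z. V z $ i * V z $ k * pd (x_dir k) \<psi> z) (\<lambda>z. V z $ i) w)
     + (\<Sum>i\<in>UNIV. \<eta> w * corr D (\<lambda>z. P z * pd (x_dir i) \<psi> z) (\<lambda>z. V z $ i) w)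
     + (\<Sum>i\<in>UNIV. \<eta> w * corr D (\<lambda>z. V z $ i * pd (x_dir i) \<psi> z) P w)
     + (\<Sum>k\<in>UNIV. \<eta> w * corr D (\<lambda>z. 1 * pd (x_dir k) \<psi> z) (\<lambda>z. V z $ k * N z) w) / 2
     - (\<Sum>k\<in>UNIV. \<eta> w * corr D (\<lambda>z. V z $ k * pd (x_dir k) \<psi> z) N w) / 2" for w
    unfolding flux_def sum_distrib_left[symmetric] by (simp only: ring_distribs times_divide_eq_right)
  show "integrable lborel (\<lambda>w. \<eta> w * flux \<psi> w)"
    unfolding fl by (intro Bochner_Integration.integrable_add Bochner_Integration.integrable_diff
      Bochner_Integration.integrable_sum integrable_divide i1 i2 i3 i4 i5 i6)
  have j1: "integrable lborel (\<lambda>w. pd (x_dir k) \<eta> w * corr D (\<lambda>z. 1 * \<psi> z) (\<lambda>z. V z $ k * N z) w)" for k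
    by (rule smear_integrable[OF paired_tame[OF tame_1 tame_VN _ c] k\<eta>]) simp
  have j2: "integrable lborel (\<lambda>w. pd (x_dir k) \<eta> w * corr D (\<lambda>z. V z $ i * \<psi> z) (\<lambda>z. V z $ i * V z $ k) w)" for i k
    by (rule smear_integrable[OF paired_tame[OF tame_V tame_VV _ c] k\<eta>]) simp
  have j3: "integrable lborel (\<lambda>w. pd (x_dir k) \<eta> w * corr D (\<lambda>z. N z * \<psi> z) (\<lambda>z. V z $ k) w)" for k
    by (rule smear_integrable[OF paired_tame[OF tame_N tame_V _ c] k\<eta>]) simp
  have j4: "integrable lborel (\<lambda>w. pd (x_dir k) \<eta> w * corr D (\<lambda>z. V z $ k * \<psi> z) N w)" for k
    by (rule smear_integrable[OF paired_tame[OF tame_V tame_N _ c] k\<eta>]) simp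
  have j5: "integrable lborel (\<lambda>w. pd (x_dir k) \<eta> w * corr D (\<lambda>z. V z $ i * V z $ k * \<psi> z) (\<lambda>z. V z $ i) w)" for i k
    by (rule smear_integrable[OF paired_tame[OF tame_VV tame_V _ c] k\<eta>]) simp
  have j6: "integrable lborel (\<lambda>w. pd (x_dir k) \<eta> w * corr D (\<lambda>z. V z $ k * N z * \<psi> z) (\<lambda>z. 1) w)" for k
    by (rule smear_integrable[OF paired_tame[OF tame_VN tame_1 _ c] k\<eta>]) simp
  have df: "pd (x_dir k) \<eta> w * defect \<psi> k w = pd (x_dir k) \<eta> w * corr D (\<lambda>z. 1 * \<psi> z) (\<lambda>z. V z $ k * N z) w
        - 2 * (\<Sum>i\<in>UNIV. pd (x_dir k) \<eta> w * corr D (\<lambda>z. V z $ i * \<psi> z) (\<lambda>z. V z $ i * V z $ k) w)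
        + pd (x_dir k) \<eta> w * corr D (\<lambda>z. N z * \<psi> z) (\<lambda>z. V z $ k) w
        - pd (x_dir k) \<eta> w * corr D (\<lambda>z. V z $ k * \<psi> z) N w
        + 2 * (\<Sum>i\<in>UNIV. pd (x_dir k) \<eta> w * corr D (\<lambda>z. V z $ i * V z $ k * \<psi> z) (\<lambda>z. V z $ i) w)
        - pd (x_dir k) \<eta> w * corr D (\<lambda>z. V z $ k * N z * \<psi> z) (\<lambda>z. 1) w" for k w
    unfolding defect_expand[OF \<psi>] sum_distrib_left[symmetric] by (simp only: ring_distribs mult.left_commute)
  show "integrable lborel (\<lambda>w. pd (x_dir k) \<eta> w * defect \<psi> k w)"
    unfolding df by (intro Bochner_Integration.integrable_add Bochner_Integration.integrable_diff
      Bochner_Integration.integrable_sum integrable_mult_right j1 j2 j3 j4 j5 j6)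
  show "(LINT w|lborel. \<eta> w * flux \<psi> w) = (\<Sum>k\<in>UNIV. LINT w|lborel. pd (x_dir k) \<eta> w * defect \<psi> k w) / 2"
  proof -
    note hb = has_bochner_integral_add has_bochner_integral_diff has_bochner_integral_sum
      has_bochner_integral_mult_right has_bochner_integral_divide_zero has_bochner_integral_integrable
    have 1: "(LINT w|lborel. \<eta> w * flux \<psi> w) = (\<Sum>i\<in>UNIV. smear D \<eta> (\<lambda>z. V z $ i * pd t_dir \<psi> z) (\<lambda>z. V z $ i))
     + (\<Sum>i\<in>UNIV. \<Sum>k\<in>UNIV. smear D \<eta> (\<lambda>z. V z $ i * V z $ k * pd (x_dir k) \<psi> z) (\<lambda>z. V z $ i))
     + (\<Sum>i\<in>UNIV. smear D \<eta> (\<lambda>z. P z * pd (x_dir i) \<psi> z) (\<lambda>z. V z $ i))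
     + (\<Sum>i\<in>UNIV. smear D \<eta> (\<lambda>z. V z $ i * pd (x_dir i) \<psi> z) P)
     + (\<Sum>k\<in>UNIV. smear D \<eta> (\<lambda>z. 1 * pd (x_dir k) \<psi> z) (\<lambda>z. V z $ k * N z)) / 2
     - (\<Sum>k\<in>UNIV. smear D \<eta> (\<lambda>z. V z $ k * pd (x_dir k) \<psi> z) N) / 2"
      unfolding fl smear_def
      by (rule has_bochner_integral_integral_eq) (intro hb i1 i2 i3 i4 i5 i6)
    have 2: "(LINT w|lborel. pd (x_dir k) \<eta> w * defect \<psi> k w) = smear D (pd (x_dir k) \<eta>) (\<lambda>z. 1 * \<psi> z) (\<lambda>z. V z $ k * N z)
        - 2 * (\<Sum>i\<in>UNIV. smear D (pd (x_dir k) \<eta>) (\<lambda>z. V z $ i * \<psi> z) (\<lambda>z. V z $ i * V z $ k))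
        + smear D (pd (x_dir k) \<eta>) (\<lambda>z. N z * \<psi> z) (\<lambda>z. V z $ k)
        - smear D (pd (x_dir k) \<eta>) (\<lambda>z. V z $ k * \<psi> z) N
        + 2 * (\<Sum>i\<in>UNIV. smear D (pd (x_dir k) \<eta>) (\<lambda>z. V z $ i * V z $ k * \<psi> z) (\<lambda>z. V z $ i))
        - smear D (pd (x_dir k) \<eta>) (\<lambda>z. V z $ k * N z * \<psi> z) (\<lambda>z. 1)" for k
      unfolding df smear_def
      by (rule has_bochner_integral_integral_eq) (intro hb j1 j2 j3 j4 j5 j6)
    show ?thesis unfolding 1 2 by (rule smeared_balance[OF \<psi> ok \<eta> r])
  qed
qed

text \<open>
  At \<open>w = 0\<close> the two cubic corrections with factor \<open>1/2\<close> cancel and the two pressure terms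
  coincide.
\<close>

lemma flux_0:
  assumes \<psi>: "test_function J D \<psi>"
  shows "flux \<psi> 0 = 2 * (LINT z|cellm D. N z / 2 * dt \<psi> z + (\<Sum>k\<in>UNIV. (N z / 2 + P z) * V z $ k * dx k \<psi> z))"
proof -
  note ct = cutoff_test_function(2)[OF \<psi> t_dir_Basis]
  note cx = cutoff_test_function(2)[OF \<psi> x_dir_Basis]
  have i1[simp]: "integrable (cellm D) (\<lambda>z. V z $ i * pd t_dir \<psi> z * V z $ i)" for i
    using paired_integrable[OF paired_tame[OF tame_V[of i] tame_V[of i] _ ct], where w = 0] by simp
  have i2[simp]: "integrable (cellm D) (\<lambda>z. V z $ i * V z $ k * pd (x_dir k) \<psi> z * V z $ i)" for i k
    using paired_integrable[OF paired_tame[OF tame_VV[of i k] tame_V[of i] _ cx], where w = 0] by simp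
  have i3[simp]: "integrable (cellm D) (\<lambda>z. P z * pd (x_dir i) \<psi> z * V z $ i)" for i
    using paired_integrable[OF paired_tame[OF tame_P tame_V[of i] _ cx], where w = 0] by simp
  have i4[simp]: "integrable (cellm D) (\<lambda>z. V z $ i * pd (x_dir i) \<psi> z * P z)" for i
    using paired_integrable[OF paired_tame[OF tame_V[of i] tame_P _ cx], where w = 0] by simp
  have i5[simp]: "integrable (cellm D) (\<lambda>z. pd (x_dir k) \<psi> z * (V z $ k * N z))" for k
    using paired_integrable[OF paired_tame[OF tame_1 tame_VN[of k] _ cx], where w = 0] by simp
  have i6[simp]: "integrable (cellm D) (\<lambda>z. V z $ k * pd (x_dir k) \<psi> z * N z)" for k
    using paired_integrable[OF paired_tame[OF tame_V[of k] tame_N _ cx], where w = 0] by simp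
  have pt: "2 * (N z / 2 * dt \<psi> z + (\<Sum>k\<in>UNIV. (N z / 2 + P z) * V z $ k * dx k \<psi> z)) =
      (\<Sum>i\<in>UNIV. V z $ i * pd t_dir \<psi> z * V z $ i)
     + (\<Sum>i\<in>UNIV. \<Sum>k\<in>UNIV. V z $ i * V z $ k * pd (x_dir k) \<psi> z * V z $ i)
     + (\<Sum>i\<in>UNIV. P z * pd (x_dir i) \<psi> z * V z $ i)
     + (\<Sum>i\<in>UNIV. V z $ i * pd (x_dir i) \<psi> z * P z)
     + (\<Sum>k\<in>UNIV. pd (x_dir k) \<psi> z * (V z $ k * N z)) / 2
     - (\<Sum>k\<in>UNIV. V z $ k * pd (x_dir k) \<psi> z * N z) / 2" for z
  proof -
    have a: "(\<Sum>i\<in>UNIV. V z $ i * pd t_dir \<psi> z * V z $ i) = N z * pd t_dir \<psi> z"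
      unfolding N_eq sum_distrib_right by (simp add: mult_ac)
    have b: "(\<Sum>i\<in>UNIV. \<Sum>k\<in>UNIV. V z $ i * V z $ k * pd (x_dir k) \<psi> z * V z $ i) = N z * (\<Sum>k\<in>UNIV. V z $ k * pd (x_dir k) \<psi> z)"
      unfolding N_eq sum_product by (simp add: mult_ac)
    have c: "(\<Sum>i\<in>UNIV. P z * pd (x_dir i) \<psi> z * V z $ i) = P z * (\<Sum>k\<in>UNIV. V z $ k * pd (x_dir k) \<psi> z)"
      "(\<Sum>i\<in>UNIV. V z $ i * pd (x_dir i) \<psi> z * P z) = P z * (\<Sum>k\<in>UNIV. V z $ k * pd (x_dir k) \<psi> z)"
      "(\<Sum>k\<in>UNIV. pd (x_dir k) \<psi> z * (V z $ k * N z)) = N z * (\<Sum>k\<in>UNIV. V z $ k * pd (x_dir k) \<psi> z)"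
      "(\<Sum>k\<in>UNIV. V z $ k * pd (x_dir k) \<psi> z * N z) = N z * (\<Sum>k\<in>UNIV. V z $ k * pd (x_dir k) \<psi> z)"
      "(\<Sum>k\<in>UNIV. (N z / 2 + P z) * V z $ k * dx k \<psi> z) = (N z / 2 + P z) * (\<Sum>k\<in>UNIV. V z $ k * pd (x_dir k) \<psi> z)"
      unfolding sum_distrib_left dx_eq_pd by (simp_all add: mult_ac)
    show ?thesis unfolding a b c dt_eq_pd by (simp add: algebra_simps)
  qed
  have "flux \<psi> 0 = (LINT z|cellm D. 2 * (N z / 2 * dt \<psi> z + (\<Sum>k\<in>UNIV. (N z / 2 + P z) * V z $ k * dx k \<psi> z)))"
    unfolding pt unfolding flux_def corr_def by simp
  then show ?thesis by (simp only: integral_mult_right_zero)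
qed

end

section \<open>An anisotropic bump\<close>

lemma flat_2_bounded:
  obtains C where "C > 0" "\<And>s. s \<le> 1 \<Longrightarrow> \<bar>flat 2 s\<bar> \<le> C"
proof -
  have "continuous_on {0..1} (flat 2)"
    using DERIV_isCont[OF flat_derivative] by (intro continuous_at_imp_continuous_on ballI)
  then have "bounded (flat 2 ` {0..1})"
    by (intro compact_imp_bounded compact_continuous_image) auto
  then obtain C where C: "C > 0" "\<forall>y\<in>flat 2 ` {0..1}. norm y \<le> C" unfolding bounded_pos by blast
  have "\<bar>flat 2 s\<bar> \<le> C" if "s \<le> 1" for s
  proof (cases "s \<ge> 0")
    case True
    then show ?thesis using C(2) that by auto
  qed (use C(1) in \<open>simp add: flat_def\<close>)
  then show ?thesis by (rule that[OF C(1)])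
qed

text \<open>
  One minus a quadratic form, written as a polynomial in the coordinates so that it is visibly
  smooth; see \<open>bump_arg_eq\<close> for its geometric form.
\<close>

definition bump_arg :: "real \<Rightarrow> real \<Rightarrow> real \<times> (real ^ 'n) \<Rightarrow> real" where
  "bump_arg \<delta> \<epsilon> z = 1 + ((- ((1/\<delta>)\<^sup>2)) * (fst z * fst z) + (- ((1/\<epsilon>)\<^sup>2)) * (\<Sum>i\<in>UNIV. snd z $ i * snd z $ i))"

definition bump :: "real \<Rightarrow> real \<Rightarrow> real \<times> (real ^ 'n) \<Rightarrow> real" where
  "bump \<delta> \<epsilon> z = flat 0 (bump_arg \<delta> \<epsilon> z)"

lemma bump_arg_eq: "bump_arg \<delta> \<epsilon> z = 1 - (fst z / \<delta>)\<^sup>2 - (norm (snd z) / \<epsilon>)\<^sup>2"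
  unfolding bump_arg_def power_divide power2_norm_eq_inner inner_vec_def
  by (simp add: power2_eq_square)

lemma smooth_bump_arg: "smooth (bump_arg \<delta> \<epsilon>)"
proof -
  have 1: "smooth (\<lambda>z :: real \<times> (real ^ 'n). fst z)" by (rule smooth_linear) (rule bounded_linear_fst)
  have 2: "smooth (\<lambda>z :: real \<times> (real ^ 'n). snd z $ i)" for i
    by (rule smooth_linear) (rule bounded_linear_compose[OF bounded_linear_vec_nth bounded_linear_snd])
  show ?thesis unfolding bump_arg_def[abs_def]
    by (intro smooth_add smooth_mult smooth_const smooth_sum 1 2) simp
qed

lemma smooth_bump: "smooth (bump \<delta> \<epsilon>)"
  unfolding bump_def[abs_def] by (intro smooth_flat_comp smooth_bump_arg)

lemma bump_even: "bump \<delta> \<epsilon> (- z) = bump \<delta> \<epsilon> z"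
  unfolding bump_def bump_arg_eq by simp

lemma bump_arg_pos:
  assumes "0 < \<delta>" "0 < \<epsilon>" "bump_arg \<delta> \<epsilon> z > 0"
  shows "\<bar>fst z\<bar> < \<delta>" "norm (snd z) < \<epsilon>"
proof -
  have a: "(fst z / \<delta>)\<^sup>2 + (norm (snd z) / \<epsilon>)\<^sup>2 < 1" using assms(3) unfolding bump_arg_eq by simp
  have "(fst z / \<delta>)\<^sup>2 < 1\<^sup>2" using a zero_le_power2[of "norm (snd z) / \<epsilon>"] unfolding one_power2 by linarith
  then have "\<bar>fst z / \<delta>\<bar> < 1" by (simp only: abs_square_less_1 one_power2)
  then show "\<bar>fst z\<bar> < \<delta>" using assms(1) by (simp add: abs_divide)
  have "(norm (snd z) / \<epsilon>)\<^sup>2 < 1" using a zero_le_power2[of "fst z / \<delta>"] by linarith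
  then have "\<bar>norm (snd z) / \<epsilon>\<bar> < 1" by (simp only: abs_square_less_1)
  then show "norm (snd z) < \<epsilon>" using assms(2) by (simp add: abs_divide)
qed

lemma bump_nonneg: "0 \<le> bump \<delta> \<epsilon> z"
  unfolding bump_def flat_def by simp

lemma bump_nz: "0 < \<delta> \<Longrightarrow> 0 < \<epsilon> \<Longrightarrow> bump \<delta> \<epsilon> z \<noteq> 0 \<Longrightarrow> \<bar>fst z\<bar> < \<delta> \<and> norm (snd z) < \<epsilon>"
  using bump_arg_pos[of \<delta> \<epsilon> z] unfolding bump_def flat_def by (auto split: if_splits)

lemma kernel_bump:
  assumes "0 < \<delta>" "\<delta> \<le> \<epsilon>" shows "kernel (2 * \<epsilon>) (bump \<delta> \<epsilon>)"
  unfolding kernel_def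
proof (intro conjI allI impI smooth_bump)
  fix z :: "real \<times> (real ^ 'a)" assume "norm z > 2 * \<epsilon>"
  moreover have "norm z \<le> \<bar>fst z\<bar> + norm (snd z)" using norm_Pair_le[of "fst z" "snd z"] by simp
  ultimately have "\<not> (\<bar>fst z\<bar> < \<delta> \<and> norm (snd z) < \<epsilon>)" using assms by linarith
  then show "bump \<delta> \<epsilon> z = 0" using bump_nz[of \<delta> \<epsilon> z] assms by linarith
qed

text \<open>
  On the box of half the widths the quadratic form is at most \<open>1/4 + 1/4\<close>.
\<close>

lemma bump_lower:
  fixes z :: "real \<times> (real ^ 'n)"
  assumes "0 < \<delta>" "0 < \<epsilon>" "\<bar>fst z\<bar> \<le> \<delta> / 2" "norm (snd z) \<le> \<epsilon> / 2"
  shows "exp (- 2) \<le> bump \<delta> \<epsilon> z"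
proof -
  have "\<bar>fst z / \<delta>\<bar> \<le> 1/2" "\<bar>norm (snd z) / \<epsilon>\<bar> \<le> 1/2" using assms by (simp_all add: abs_divide field_simps)
  then have "\<bar>fst z / \<delta>\<bar>\<^sup>2 \<le> (1/2)\<^sup>2" "\<bar>norm (snd z) / \<epsilon>\<bar>\<^sup>2 \<le> (1/2)\<^sup>2" by (intro power_mono; simp)+
  then have b: "1/2 \<le> bump_arg \<delta> \<epsilon> z" unfolding bump_arg_eq power2_abs by (simp add: power2_eq_square)
  then have "1 / bump_arg \<delta> \<epsilon> z \<le> 2" by (simp add: field_simps)
  then show ?thesis using b unfolding bump_def flat_def by simp
qed

lemma pd_bump:
  fixes z :: "real \<times> (real ^ 'n)"
  assumes \<delta>: "0 < \<delta>" "0 < \<epsilon>" and C: "\<And>s. s \<le> 1 \<Longrightarrow> \<bar>flat 2 s\<bar> \<le> C"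
  shows "\<bar>pd (x_dir k) (bump \<delta> \<epsilon>) z\<bar> \<le> 2 * C / \<epsilon> * indicator ({- \<delta>..\<delta>} \<times> ball 0 \<epsilon>) z"
proof -
  let ?g = "bump_arg \<delta> \<epsilon> z"
  have "((\<lambda>z. bump \<delta> \<epsilon> z) has_derivative (\<lambda>h. flat 2 ?g * pd h (bump_arg \<delta> \<epsilon>) z)) (at z)"
    using has_derivative_compose[OF smooth_derivative[OF smooth_bump_arg]
        flat_derivative[of 0, THEN has_field_derivative_imp_has_derivative], of \<delta> \<epsilon> z]
    unfolding bump_def[abs_def] by (simp add: numeral_2_eq_2)
  then have p1: "pd (x_dir k) (bump \<delta> \<epsilon>) z = flat 2 ?g * pd (x_dir k) (bump_arg \<delta> \<epsilon>) z" by (rule pdI)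
  have p2: "pd (x_dir k) (bump_arg \<delta> \<epsilon>) z = - 2 * (1/\<epsilon>)\<^sup>2 * snd z $ k"
  proof -
    have d1: "((\<lambda>z :: real \<times> (real ^ 'n). snd z $ i) has_derivative (\<lambda>h. snd h $ i)) (at z)" for i
      by (rule bounded_linear_imp_has_derivative) (rule bounded_linear_compose[OF bounded_linear_vec_nth bounded_linear_snd])
    have "(bump_arg \<delta> \<epsilon> has_derivative (\<lambda>h. (- ((1/\<delta>)\<^sup>2)) * (fst z * fst h + fst h * fst z)
        + (- ((1/\<epsilon>)\<^sup>2)) * (\<Sum>i\<in>UNIV. snd z $ i * snd h $ i + snd h $ i * snd z $ i))) (at z)"
      unfolding bump_arg_def[abs_def]
      by (rule has_derivative_eq_rhs, (rule has_derivative_add has_derivative_const has_derivative_mult_right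
          has_derivative_sum has_derivative_mult d1 bounded_linear_imp_has_derivative bounded_linear_fst)+) auto
    then have "pd (x_dir k) (bump_arg \<delta> \<epsilon>) z = (- ((1/\<delta>)\<^sup>2)) * (fst z * fst (x_dir k) + fst (x_dir k) * fst z)
        + (- ((1/\<epsilon>)\<^sup>2)) * (\<Sum>i\<in>UNIV. snd z $ i * snd (x_dir k) $ i + snd (x_dir k) $ i * snd z $ i)" by (rule pdI)
    also have "(\<Sum>i\<in>UNIV. snd z $ i * snd (x_dir k) $ i + snd (x_dir k) $ i * snd z $ i) = 2 * snd z $ k"
    proof -
      have "(\<Sum>i\<in>UNIV. snd z $ i * snd (x_dir k) $ i + snd (x_dir k) $ i * snd z $ i) = (\<Sum>i\<in>UNIV. if i = k then 2 * snd z $ i else 0)"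
        by (intro sum.cong) (auto simp: axis_def)
      then show ?thesis by simp
    qed
    finally show ?thesis by simp
  qed
  show ?thesis
  proof (cases "?g > 0")
    case True
    note b = bump_arg_pos[OF \<delta> True]
    have "?g \<le> 1" unfolding bump_arg_eq by simp
    have "\<bar>snd z $ k\<bar> \<le> \<epsilon>" using component_le_norm_cart[of "snd z" k] b(2) by linarith
    then have "\<bar>pd (x_dir k) (bump_arg \<delta> \<epsilon>) z\<bar> \<le> 2 * (1/\<epsilon>)\<^sup>2 * \<epsilon>"
      unfolding p2 abs_mult by (simp add: mult_left_mono)
    also have "\<dots> = 2 / \<epsilon>" using \<delta> by (simp add: power2_eq_square)
    finally have "\<bar>flat 2 ?g\<bar> * \<bar>pd (x_dir k) (bump_arg \<delta> \<epsilon>) z\<bar> \<le> C * (2 / \<epsilon>)"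
      using C[OF \<open>?g \<le> 1\<close>] by (intro mult_mono) auto
    moreover have "z \<in> {- \<delta>..\<delta>} \<times> ball 0 \<epsilon>" using b by (simp add: mem_Times_iff abs_less_iff)
    ultimately show ?thesis unfolding p1 abs_mult by (simp add: mult.commute)
  next
    case False
    then have "flat 2 ?g = 0" by (simp add: flat_def)
    moreover have "0 \<le> C" using C[of 0] by simp
    ultimately show ?thesis unfolding p1 using \<delta> by simp
  qed
qed

lemma emeasure_box_ball:
  "0 \<le> a \<Longrightarrow> emeasure lborel ({- a..a} \<times> B) = ennreal (2 * a) * emeasure lborel B"
  if [measurable]: "B \<in> sets borel" for B :: "(real ^ 'n) set"
  unfolding lborel_prod[symmetric] by (subst lborel.emeasure_pair_measure_Times) auto

section \<open>Cubic increments\<close>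

lemma sequential_LIM_D:
  fixes f :: "'a::real_normed_vector \<Rightarrow> real"
  assumes "\<And>X. X \<longlonglongrightarrow> 0 \<Longrightarrow> (\<lambda>n. f (X n)) \<longlonglongrightarrow> f 0" "e > 0"
  obtains d where "d > 0" "\<And>w. norm w < d \<Longrightarrow> \<bar>f w - f 0\<bar> < e"
proof -
  have "f \<midarrow>0\<rightarrow> f 0" unfolding LIMSEQ_SEQ_conv[symmetric] by (intro allI impI assms(1)) simp
  then obtain d where d: "d > 0" "\<forall>x. x \<noteq> 0 \<and> norm (x - 0) < d \<longrightarrow> norm (f x - f 0) < e"
    using LIM_D[OF \<open>f \<midarrow>0\<rightarrow> f 0\<close> assms(2)] by blast
  have "\<bar>f w - f 0\<bar> < e" if "norm w < d" for w
    using d(2)[rule_format, of w] that assms(2) by (cases "w = 0") auto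
  then show ?thesis by (rule that[OF d(1)])
qed

context weak_solution
begin

definition cube_incr :: "real \<times> (real ^ 'n) \<Rightarrow> real" where
  "cube_incr w = (LINT z|cellm D. norm (V (z + w) - V z) ^ 3)"

definition cube_incr_nn :: "real \<times> (real ^ 'n) \<Rightarrow> ennreal" where
  "cube_incr_nn w = (\<integral>\<^sup>+z. ennreal (norm (V (z + w) - V z) ^ 3) \<partial>cellm D)"

lemma cube_incr_integrable: "integrable (cellm D) (\<lambda>z. norm (V (z + w) - V z) ^ 3)"
  using cellm_shift_diff_cube[OF V_borel V_per V3, of w 0] by simp

lemma cube_incr_nn_eq: "cube_incr_nn w = ennreal (cube_incr w)"
  unfolding cube_incr_nn_def cube_incr_def by (rule nn_integral_eq_integral[OF cube_incr_integrable]) simp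

lemma cube_incr_nonneg: "0 \<le> cube_incr w"
  unfolding cube_incr_def by (rule Bochner_Integration.integral_nonneg) simp

lemma cube_incr_nn_borel[measurable]: "cube_incr_nn \<in> borel_measurable borel"
proof -
  interpret sigma_finite_measure "cellm D" by (rule sigma_finite_cellm)
  have "(\<lambda>w. \<integral>\<^sup>+z. ennreal (norm (V (z + w) - V z) ^ 3) \<partial>cellm D) \<in> borel_measurable borel"
    by (rule borel_measurable_nn_integral) measurable
  then show ?thesis unfolding cube_incr_nn_def[abs_def] .
qed

text \<open>
  Triangle inequality in \<open>L\<^sup>3\<close>, in the form suited to integrals of cubes. It separates a
  space-time shift into its temporal and its spatial part.
\<close>

lemma cube_incr_add: "cube_incr (w1 + w2) \<le> 4 * cube_incr w1 + 4 * cube_incr w2"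
proof -
  have sp: "x_periodic D (\<lambda>z. norm (V (z + w1) - V z) ^ 3)"
    unfolding x_periodic_def
  proof (intro allI ballI)
    fix z :: "real \<times> (real ^ 'n)" and k :: "real ^ 'n" assume k: "k \<in> periods D"
    have "z + (0, k) + w1 = z + w1 + (0, k)" by (simp add: algebra_simps)
    then show "norm (V (z + (0, k) + w1) - V (z + (0, k))) ^ 3 = norm (V (z + w1) - V z) ^ 3"
      by (simp only: x_periodicD[OF V_per k])
  qed
  note sh = cellm_shift[OF cube_incr_integrable sp, of w2]
  have "cube_incr (w1 + w2) \<le> (LINT z|cellm D. 4 * norm (V (z + w2 + w1) - V (z + w2)) ^ 3 + 4 * norm (V (z + w2) - V z) ^ 3)"
    unfolding cube_incr_def
  proof (rule integral_mono[OF cube_incr_integrable])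
    show "integrable (cellm D) (\<lambda>z. 4 * norm (V (z + w2 + w1) - V (z + w2)) ^ 3 + 4 * norm (V (z + w2) - V z) ^ 3)"
      using sh(1) cube_incr_integrable[of w2] by simp
    fix z
    have eq: "z + (w1 + w2) = z + w2 + w1" by (simp add: algebra_simps)
    have "norm (V (z + (w1 + w2)) - V z) ^ 3 \<le> (norm (V (z + w2 + w1) - V (z + w2)) + norm (V (z + w2) - V z)) ^ 3"
      unfolding eq using norm_triangle_ineq[of "V (z + w2 + w1) - V (z + w2)" "V (z + w2) - V z"]
      by (intro power_mono) simp_all
    also have "\<dots> \<le> 4 * norm (V (z + w2 + w1) - V (z + w2)) ^ 3 + 4 * norm (V (z + w2) - V z) ^ 3"
      by (rule cube_add_le) auto
    finally show "norm (V (z + (w1 + w2)) - V z) ^ 3 \<le> 4 * norm (V (z + w2 + w1) - V (z + w2)) ^ 3 + 4 * norm (V (z + w2) - V z) ^ 3" .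
  qed
  also have "\<dots> = 4 * cube_incr w1 + 4 * cube_incr w2"
    using sh cube_incr_integrable[of w2] unfolding cube_incr_def by simp
  finally show ?thesis .
qed

lemma cube_incr_tendsto:
  assumes X: "X \<longlonglongrightarrow> 0" shows "(\<lambda>n. cube_incr (X n)) \<longlonglongrightarrow> cube_incr 0"
proof -
  let ?n = "real CARD('n)"
  have Vi: "integrable (cellm D) (\<lambda>z. \<bar>V z $ i\<bar> ^ 3)" for i
  proof (rule Bochner_Integration.integrable_bound[OF V3])
    show "AE z in cellm D. norm (\<bar>V z $ i\<bar> ^ 3) \<le> norm (norm (V z) ^ 3)"
      using power_mono[OF component_le_norm_cart, of _ i 3] by (intro AE_I2) simp
    show "(\<lambda>z. \<bar>V z $ i\<bar> ^ 3) \<in> borel_measurable (cellm D)" using tame_borel[OF tame_V[of i]] by simp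
  qed
  have cube: "norm x ^ 3 \<le> (\<Sum>i\<in>UNIV. ?n ^ 3 * \<bar>x $ i\<bar> ^ 3)" for x :: "real ^ 'n"
  proof -
    obtain i where i: "\<And>j. \<bar>x $ j\<bar> \<le> \<bar>x $ i\<bar>"
    proof -
      have "Max (range (\<lambda>j. \<bar>x $ j\<bar>)) \<in> range (\<lambda>j. \<bar>x $ j\<bar>)" by (rule Max_in) auto
      then obtain i where "Max (range (\<lambda>j. \<bar>x $ j\<bar>)) = \<bar>x $ i\<bar>" by blast
      then have "\<bar>x $ j\<bar> \<le> \<bar>x $ i\<bar>" for j using Max_ge[of "range (\<lambda>j. \<bar>x $ j\<bar>)" "\<bar>x $ j\<bar>"] by simp
      then show ?thesis by (rule that)
    qed
    have "norm x \<le> (\<Sum>j\<in>UNIV. \<bar>x $ j\<bar>)" by (rule norm_le_l1_cart)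
    also have "\<dots> \<le> (\<Sum>j\<in>(UNIV::'n set). \<bar>x $ i\<bar>)" by (intro sum_mono i)
    also have "\<dots> = ?n * \<bar>x $ i\<bar>" by simp
    finally have "norm x ^ 3 \<le> (?n * \<bar>x $ i\<bar>) ^ 3" by (intro power_mono) auto
    also have "\<dots> = ?n ^ 3 * \<bar>x $ i\<bar> ^ 3" by (rule power_mult_distrib)
    also have "\<dots> \<le> (\<Sum>i\<in>UNIV. ?n ^ 3 * \<bar>x $ i\<bar> ^ 3)" by (rule member_le_sum) auto
    finally show ?thesis .
  qed
  have si: "integrable (cellm D) (\<lambda>z. \<bar>V (z + w) $ i - V z $ i\<bar> ^ 3)" for i w
    using cellm_shift_diff_cube[OF tame_borel[OF tame_V[of i]] tame_per[OF tame_V[of i]], of w 0] Vi by simp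
  have "(\<lambda>n. LINT z|cellm D. \<bar>V (z + X n) $ i - V z $ i\<bar> ^ 3) \<longlonglongrightarrow> 0" for i
    by (rule L3_trans_cont[OF tame_borel[OF tame_V] tame_per[OF tame_V] Vi X])
  then have "(\<lambda>n. \<Sum>i\<in>UNIV. ?n ^ 3 * (LINT z|cellm D. \<bar>V (z + X n) $ i - V z $ i\<bar> ^ 3)) \<longlonglongrightarrow> (\<Sum>i\<in>(UNIV::'n set). ?n ^ 3 * 0)"
    by (intro tendsto_sum tendsto_mult tendsto_const)
  then have lim: "(\<lambda>n. \<Sum>i\<in>UNIV. ?n ^ 3 * (LINT z|cellm D. \<bar>V (z + X n) $ i - V z $ i\<bar> ^ 3)) \<longlonglongrightarrow> 0" by simp
  have "(\<lambda>n. cube_incr (X n)) \<longlonglongrightarrow> 0"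
  proof (rule tendsto_sandwich[OF always_eventually always_eventually tendsto_const lim]; rule allI)
    fix n
    show "0 \<le> cube_incr (X n)" by (rule cube_incr_nonneg)
    have "cube_incr (X n) \<le> (LINT z|cellm D. (\<Sum>i\<in>UNIV. ?n ^ 3 * \<bar>(V (z + X n) - V z) $ i\<bar> ^ 3))"
      unfolding cube_incr_def by (rule integral_mono[OF cube_incr_integrable _ cube]) (use si in simp)
    also have "\<dots> = (\<Sum>i\<in>UNIV. ?n ^ 3 * (LINT z|cellm D. \<bar>V (z + X n) $ i - V z $ i\<bar> ^ 3))"
      using si by simp
    finally show "cube_incr (X n) \<le> (\<Sum>i\<in>UNIV. ?n ^ 3 * (LINT z|cellm D. \<bar>V (z + X n) $ i - V z $ i\<bar> ^ 3))" .
  qed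
  moreover have "cube_incr 0 = 0" unfolding cube_incr_def by simp
  ultimately show ?thesis by simp
qed

lemma defect_le:
  assumes M: "\<And>z. \<bar>\<psi> z\<bar> \<le> M" and [measurable]: "\<psi> \<in> borel_measurable borel"
  shows "\<bar>defect \<psi> k w\<bar> \<le> M * cube_incr w"
proof -
  have bd: "norm (\<psi> z * ((V (z + w) - V z) $ k * (norm (V (z + w) - V z))\<^sup>2)) \<le> M * norm (V (z + w) - V z) ^ 3" for z
  proof -
    have "\<bar>\<psi> z\<bar> * (\<bar>(V (z + w) - V z) $ k\<bar> * (norm (V (z + w) - V z))\<^sup>2) \<le> M * (norm (V (z + w) - V z) * (norm (V (z + w) - V z))\<^sup>2)"
      using M[of z] by (intro mult_mono mult_right_mono component_le_norm_cart) auto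
    then show ?thesis by (simp add: abs_mult power3_eq_cube power2_eq_square)
  qed
  have iQ: "integrable (cellm D) (\<lambda>z. M * norm (V (z + w) - V z) ^ 3)" using cube_incr_integrable by simp
  have "integrable (cellm D) (\<lambda>z. \<psi> z * ((V (z + w) - V z) $ k * (norm (V (z + w) - V z))\<^sup>2))"
  proof (rule Bochner_Integration.integrable_bound[OF iQ])
    have "(\<lambda>z. V z $ k) \<in> borel_measurable borel" by (rule tame_borel[OF tame_V])
    then have [measurable]: "(\<lambda>z. (V (z + w) - V z) $ k) \<in> borel_measurable borel" by simp
    show "(\<lambda>z. \<psi> z * ((V (z + w) - V z) $ k * (norm (V (z + w) - V z))\<^sup>2)) \<in> borel_measurable (cellm D)" by measurable
    show "AE z in cellm D. norm (\<psi> z * ((V (z + w) - V z) $ k * (norm (V (z + w) - V z))\<^sup>2)) \<le> norm (M * norm (V (z + w) - V z) ^ 3)"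
      by (rule AE_I2, rule order_trans[OF bd]) simp
  qed
  from Bochner_Integration.integral_norm_bound_integral[OF this iQ bd]
  show ?thesis unfolding defect_def cube_incr_def by simp
qed

end

section \<open>Vanishing of the energy defect\<close>

context weak_solution
begin

lemma nn_integral_box_ball:
  fixes f :: "real ^ 'n \<Rightarrow> ennreal"
  assumes [measurable]: "f \<in> borel_measurable borel" and a: "0 \<le> a"
  shows "(\<integral>\<^sup>+w. indicator ({- a..a} \<times> ball 0 \<epsilon>) w * f (snd w) \<partial>lborel) =
     ennreal (2 * a) * (\<integral>\<^sup>+h. indicator (ball 0 \<epsilon>) h * f h \<partial>lborel)"
proof -
  have [measurable]: "ball (0 :: real ^ 'n) \<epsilon> \<in> sets borel" by simp
  have "(\<integral>\<^sup>+w. indicator ({- a..a} \<times> ball 0 \<epsilon>) w * f (snd w) \<partial>(lborel :: (real \<times> (real ^ 'n)) measure))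
     = (\<integral>\<^sup>+w. indicator {- a..a} (fst w) * (indicator (ball 0 \<epsilon>) (snd w) * f (snd w)) \<partial>(lborel :: (real \<times> (real ^ 'n)) measure))"
    by (intro nn_integral_cong) (simp add: indicator_times mult.assoc)
  also have "\<dots> = (\<integral>\<^sup>+s. \<integral>\<^sup>+h. indicator {- a..a} (fst (s, h)) * (indicator (ball 0 \<epsilon>) (snd (s, h)) * f (snd (s, h))) \<partial>lborel \<partial>lborel)"
    unfolding lborel_prod[symmetric] by (rule lborel.nn_integral_fst[symmetric]) measurable
  also have "\<dots> = (\<integral>\<^sup>+s. indicator {- a..a} s * (\<integral>\<^sup>+h. indicator (ball 0 \<epsilon>) h * f h \<partial>lborel) \<partial>(lborel :: real measure))"
    by (intro nn_integral_cong) (simp add: nn_integral_cmult)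
  also have "\<dots> = ennreal (2 * a) * (\<integral>\<^sup>+h. indicator (ball 0 \<epsilon>) h * f h \<partial>lborel)"
    using a by (subst nn_integral_multc) auto
  finally show ?thesis .
qed

text \<open>
  By the balance, \<open>flux \<psi> 0\<close> times the mass \<open>J\<close> of the bump is, up to the oscillation of the flux
  over the support, the integral of the defect against the spatial gradient of the bump. That
  gradient is at most \<open>2 C / \<epsilon>\<close> on the box of widths \<open>\<delta>\<close> and \<open>\<epsilon>\<close>, and the measure of this box is
  comparable with \<open>J\<close>; the constant \<open>K\<close> collects the ratio and the number of directions. Thus
  \<open>\<bar>flux \<psi> 0\<bar>\<close> is at most a fixed multiple of the arbitrary number \<open>\<theta>\<close>.
\<close>

lemma flux_eq_0:
  fixes \<psi> :: "real \<times> (real ^ 'n) \<Rightarrow> real"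
  assumes \<psi>: "test_function {0<..<T} D \<psi>"
    and incr: "\<And>\<theta> e0. 0 < \<theta> \<Longrightarrow> 0 < e0 \<Longrightarrow> \<exists>\<epsilon>. 0 < \<epsilon> \<and> \<epsilon> < e0 \<and>
       (\<integral>\<^sup>+h. indicator (ball 0 \<epsilon>) h * cube_incr_nn (0, h) \<partial>lborel) \<le> ennreal (\<theta> * \<epsilon>) * emeasure lborel (ball (0 :: real ^ 'n) \<epsilon>)"
  shows "flux \<psi> 0 = 0"
proof -
  obtain r0 where r0: "r0 > 0" and ok: "mollifiable {0<..<T} D \<psi> r0"
    by (rule test_function_mollifiable[OF \<psi> open_greaterThanLessThan]) (rule that)
  obtain M0 where M0: "\<And>z. \<bar>\<psi> z\<bar> \<le> M0" using cutoff_test_function(1)[OF \<psi>] unfolding cutoff_def by blast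
  define M where "M = max M0 0"
  have M: "0 \<le> M" "\<And>z. \<bar>\<psi> z\<bar> \<le> M" using M0 unfolding M_def by (auto simp: le_max_iff_disj)
  have \<psi>b: "\<psi> \<in> borel_measurable borel" using cutoff_test_function(1)[OF \<psi>] unfolding cutoff_def by blast
  obtain C where C: "C > 0" "\<And>s. s \<le> 1 \<Longrightarrow> \<bar>flat 2 s\<bar> \<le> C" by (rule flat_2_bounded) (rule that)
  let ?n = "CARD('n)"
  define u where "u = unit_ball_vol (real ?n)"
  have u: "u > 0" unfolding u_def by simp
  have vol: "emeasure lborel (ball (0 :: real ^ 'n) r) = ennreal (u * r ^ ?n)"
    and cvol: "emeasure lborel (cball (0 :: real ^ 'n) r) = ennreal (u * r ^ ?n)" if "0 \<le> r" for r
    using emeasure_ball[OF that, of "0 :: real ^ 'n"] emeasure_cball[OF that, of "0 :: real ^ 'n"] unfolding u_def by simp_all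
  define K where "K = real ?n * 8 * C * M * 2 ^ ?n * exp 2"
  have K: "K \<ge> 0" unfolding K_def using C(1) M(1) by simp
  have main: "\<bar>flux \<psi> 0\<bar> \<le> \<theta> + K * (\<theta> + \<theta>)" if \<theta>: "\<theta> > 0" for \<theta>
  proof -
    obtain d1 where d1: "d1 > 0" "\<And>w. norm w < d1 \<Longrightarrow> \<bar>flux \<psi> w - flux \<psi> 0\<bar> < \<theta>"
      by (rule sequential_LIM_D[of "flux \<psi>", OF flux_cont[OF \<psi>] \<theta>]) (assumption, rule that)
    define e0 where "e0 = min \<theta> (min (1/8) (min (r0 / 2) (d1 / 2)))"
    have e0: "e0 > 0" unfolding e0_def using \<theta> r0 d1(1) by simp
    obtain \<epsilon> where \<epsilon>: "0 < \<epsilon>" "\<epsilon> < e0" and Qe: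
       "(\<integral>\<^sup>+h. indicator (ball 0 \<epsilon>) h * cube_incr_nn (0, h) \<partial>lborel) \<le> ennreal (\<theta> * \<epsilon>) * emeasure lborel (ball (0 :: real ^ 'n) \<epsilon>)"
      using incr[OF \<theta> e0] by blast
    have \<epsilon>': "\<epsilon> < \<theta>" "2 * \<epsilon> < 1/4" "2 * \<epsilon> \<le> r0" "2 * \<epsilon> \<le> d1" using \<epsilon>(2) unfolding e0_def by auto
    have "\<epsilon>\<^sup>2 > 0" using \<epsilon>(1) by simp
    obtain d2 where d2: "d2 > 0" "\<And>w. norm w < d2 \<Longrightarrow> \<bar>cube_incr w - cube_incr 0\<bar> < \<epsilon>\<^sup>2"
      by (rule sequential_LIM_D[of cube_incr, OF cube_incr_tendsto \<open>\<epsilon>\<^sup>2 > 0\<close>]) (assumption, rule that)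
    have Q0: "cube_incr 0 = 0" unfolding cube_incr_def by simp
    \<comment> \<open>the width in time is chosen after the width in space\<close>
    define \<delta> where "\<delta> = min \<epsilon> (d2 / 2)"
    have \<delta>: "0 < \<delta>" "\<delta> \<le> \<epsilon>" "\<delta> < d2" unfolding \<delta>_def using \<epsilon>(1) d2(1) by auto
    define \<eta> where "\<eta> = (bump \<delta> \<epsilon> :: real \<times> (real ^ 'n) \<Rightarrow> real)"
    have \<eta>: "kernel (2 * \<epsilon>) \<eta>" "\<And>w. \<eta> (- w) = \<eta> w" unfolding \<eta>_def by (rule kernel_bump[OF \<delta>(1,2)]) (rule bump_even)
    have r: "0 < 2 * \<epsilon>" "2 * \<epsilon> < 1/4" "2 * \<epsilon> \<le> r0" using \<epsilon>(1) \<epsilon>' by auto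
    have bal1: "(LINT w|lborel. \<eta> w * flux \<psi> w) = (\<Sum>k\<in>UNIV. LINT w|lborel. pd (x_dir k) \<eta> w * defect \<psi> k w) / 2"
      by (rule balance(1)[OF \<psi> ok \<eta> r])
    have bal2: "integrable lborel (\<lambda>w. \<eta> w * flux \<psi> w)"
      by (rule balance(2)[OF \<psi> ok \<eta> r])
    have bal3: "integrable lborel (\<lambda>w. pd (x_dir k) \<eta> w * defect \<psi> k w)" for k
      by (rule balance(3)[OF \<psi> ok \<eta> r])
    define J where "J = (LINT w|lborel. \<eta> w)"
    have i\<eta>: "integrable lborel \<eta>" by (rule kernel_integrable[OF \<eta>(1)])
    \<comment> \<open>the mass of the bump is bounded below by its integral over the box of half the widths\<close>
    have Jlow: "exp (- 2) * (\<delta> * (u * (\<epsilon> / 2) ^ ?n)) \<le> J"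
    proof -
      let ?B = "{- (\<delta>/2)..\<delta>/2} \<times> cball 0 (\<epsilon>/2) :: (real \<times> (real ^ 'n)) set"
      have "emeasure lborel ?B = ennreal (2 * (\<delta> / 2)) * emeasure lborel (cball (0 :: real ^ 'n) (\<epsilon>/2))"
        by (rule emeasure_box_ball) (use \<delta> in auto)
      also have "\<dots> = ennreal (\<delta> * (u * (\<epsilon> / 2) ^ ?n))"
        using cvol[of "\<epsilon>/2"] \<epsilon>(1) \<delta>(1) u by (simp add: ennreal_mult[symmetric])
      finally have em: "emeasure lborel ?B = ennreal (\<delta> * (u * (\<epsilon> / 2) ^ ?n))" .
      have [measurable]: "?B \<in> sets borel" by (intro borel_Times) auto
      have iB: "integrable lborel (\<lambda>w. exp (- 2) * indicator ?B w :: real)"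
        using em by (intro integrable_mult_right) (simp add: integrable_indicator_iff)
      have "exp (- 2) * (\<delta> * (u * (\<epsilon> / 2) ^ ?n)) = (LINT w|lborel. exp (- 2) * indicator ?B w)"
        using em \<delta>(1) u \<epsilon>(1) by (simp add: measure_def)
      also have "\<dots> \<le> J" unfolding J_def
      proof (rule integral_mono[OF iB i\<eta>])
        fix w :: "real \<times> (real ^ 'n)"
        show "exp (- 2) * indicator ?B w \<le> \<eta> w"
          using bump_lower[OF \<delta>(1) \<epsilon>(1), of w] bump_nonneg[of \<delta> \<epsilon> w] unfolding \<eta>_def
          by (cases "w \<in> ?B") (auto simp: mem_Times_iff)
      qed
      finally show ?thesis .
    qed
    have Jpos: "J > 0"
      by (rule less_le_trans[OF _ Jlow]) (use \<delta>(1) u \<epsilon>(1) in simp)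
    \<comment> \<open>the factor \<open>1/\<epsilon>\<close> from the gradient meets increments of size \<open>\<theta> \<epsilon>\<close> in space and \<open>\<epsilon>\<^sup>2\<close> in time\<close>
    have def: "\<bar>LINT w|lborel. pd (x_dir k) \<eta> w * defect \<psi> k w\<bar> \<le> 16 * C * M * \<delta> * (\<theta> + \<epsilon>) * (u * \<epsilon> ^ ?n)" for k
    proof -
      let ?B = "{- \<delta>..\<delta>} \<times> ball 0 \<epsilon> :: (real \<times> (real ^ 'n)) set"
      have [measurable]: "(\<lambda>h :: real ^ 'n. cube_incr_nn (0, h)) \<in> borel_measurable borel" by measurable
      have [measurable]: "(\<lambda>w :: real \<times> (real ^ 'n). cube_incr_nn (0, snd w)) \<in> borel_measurable borel"
        by (rule measurable_compose[OF _ cube_incr_nn_borel], rule borel_measurable_continuous_onI) (intro continuous_intros)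
      have pt: "ennreal (norm (pd (x_dir k) \<eta> w * defect \<psi> k w)) \<le>
          ennreal (2 * C / \<epsilon> * M) * (indicator ?B w * (4 * cube_incr_nn (0, snd w) + ennreal (4 * \<epsilon>\<^sup>2)))" for w
      proof (cases "w \<in> ?B")
        case False
        then have "pd (x_dir k) \<eta> w = 0" using pd_bump[OF \<delta>(1) \<epsilon>(1) C(2), of k w] unfolding \<eta>_def by simp
        then show ?thesis by simp
      next
        case True
        have a: "\<bar>pd (x_dir k) \<eta> w\<bar> \<le> 2 * C / \<epsilon>" using pd_bump[OF \<delta>(1) \<epsilon>(1) C(2), of k w] True unfolding \<eta>_def by simp
        have "(0, snd w) + (fst w, 0) = w" by (simp add: prod_eq_iff)
        then have "cube_incr w \<le> 4 * cube_incr (0, snd w) + 4 * cube_incr (fst w, 0)" using cube_incr_add[of "(0, snd w)" "(fst w, 0)"] by simp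
        moreover have "norm (fst w, 0 :: real ^ 'n) < d2"
          using True \<delta>(3) norm_Pair_le[of "fst w" "0 :: real ^ 'n"] by (simp add: mem_Times_iff) linarith
        then have "cube_incr (fst w, 0) \<le> \<epsilon>\<^sup>2" using d2(2)[of "(fst w, 0)"] Q0 by simp
        ultimately have q: "cube_incr w \<le> 4 * cube_incr (0, snd w) + 4 * \<epsilon>\<^sup>2" by simp
        have "norm (pd (x_dir k) \<eta> w * defect \<psi> k w) \<le> 2 * C / \<epsilon> * (M * (4 * cube_incr (0, snd w) + 4 * \<epsilon>\<^sup>2))"
          unfolding real_norm_def abs_mult
        proof (rule mult_mono[OF a])
          have "\<bar>defect \<psi> k w\<bar> \<le> M * cube_incr w" by (rule defect_le[OF M(2) \<psi>b])
          also have "\<dots> \<le> M * (4 * cube_incr (0, snd w) + 4 * \<epsilon>\<^sup>2)" by (rule mult_left_mono[OF q M(1)])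
          finally show "\<bar>defect \<psi> k w\<bar> \<le> M * (4 * cube_incr (0, snd w) + 4 * \<epsilon>\<^sup>2)" .
        qed (use C(1) \<epsilon>(1) in auto)
        also have "\<dots> = (2 * C / \<epsilon> * M) * (4 * cube_incr (0, snd w) + 4 * \<epsilon>\<^sup>2)" by simp
        finally have "ennreal (norm (pd (x_dir k) \<eta> w * defect \<psi> k w)) \<le> ennreal ((2 * C / \<epsilon> * M) * (4 * cube_incr (0, snd w) + 4 * \<epsilon>\<^sup>2))"
          by (rule ennreal_leI)
        also have "\<dots> = ennreal (2 * C / \<epsilon> * M) * (4 * cube_incr_nn (0, snd w) + ennreal (4 * \<epsilon>\<^sup>2))"
          unfolding cube_incr_nn_eq using C(1) \<epsilon>(1) M(1) cube_incr_nonneg[of "(0, snd w)"]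
          by (subst ennreal_mult) (auto simp: ennreal_plus ennreal_mult)
        finally show ?thesis using True by simp
      qed
      have "ennreal (norm (LINT w|lborel. pd (x_dir k) \<eta> w * defect \<psi> k w)) \<le> (\<integral>\<^sup>+w. ennreal (norm (pd (x_dir k) \<eta> w * defect \<psi> k w)) \<partial>lborel)"
        by (rule integral_norm_bound_ennreal[OF bal3])
      also have "\<dots> \<le> (\<integral>\<^sup>+w. ennreal (2 * C / \<epsilon> * M) * (indicator ?B w * (4 * cube_incr_nn (0, snd w) + ennreal (4 * \<epsilon>\<^sup>2))) \<partial>lborel)"
        by (rule nn_integral_mono) (rule pt)
      also have "\<dots> = ennreal (2 * C / \<epsilon> * M) * (\<integral>\<^sup>+w. indicator ?B w * (4 * cube_incr_nn (0, snd w) + ennreal (4 * \<epsilon>\<^sup>2)) \<partial>lborel)"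
      proof (rule nn_integral_cmult)
        have [measurable]: "?B \<in> sets borel" by (intro borel_Times) auto
        show "(\<lambda>w. indicator ?B w * (4 * cube_incr_nn (0, snd w) + ennreal (4 * \<epsilon>\<^sup>2))) \<in> borel_measurable lborel" by measurable
      qed
      also have "(\<integral>\<^sup>+w. indicator ?B w * (4 * cube_incr_nn (0, snd w) + ennreal (4 * \<epsilon>\<^sup>2)) \<partial>lborel)
          = ennreal (2 * \<delta>) * (\<integral>\<^sup>+h. indicator (ball 0 \<epsilon>) h * (4 * cube_incr_nn (0, h) + ennreal (4 * \<epsilon>\<^sup>2)) \<partial>lborel)"
        by (rule nn_integral_box_ball) (use \<delta> in auto)
      finally have A1: "ennreal (norm (LINT w|lborel. pd (x_dir k) \<eta> w * defect \<psi> k w)) \<le> ennreal (2 * C / \<epsilon> * M) *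
         (ennreal (2 * \<delta>) * (\<integral>\<^sup>+h. indicator (ball 0 \<epsilon>) h * (4 * cube_incr_nn (0, h) + ennreal (4 * \<epsilon>\<^sup>2)) \<partial>lborel))" .
      have "(\<integral>\<^sup>+h. indicator (ball 0 \<epsilon>) h * (4 * cube_incr_nn (0, h) + ennreal (4 * \<epsilon>\<^sup>2)) \<partial>lborel)
          = 4 * (\<integral>\<^sup>+h. indicator (ball 0 \<epsilon>) h * cube_incr_nn (0, h) \<partial>lborel) + ennreal (4 * \<epsilon>\<^sup>2) * emeasure lborel (ball (0 :: real ^ 'n) \<epsilon>)"
      proof -
        have [measurable]: "ball (0 :: real ^ 'n) \<epsilon> \<in> sets borel" by simp
        have "(\<integral>\<^sup>+h. indicator (ball 0 \<epsilon>) h * (4 * cube_incr_nn (0, h) + ennreal (4 * \<epsilon>\<^sup>2)) \<partial>(lborel :: (real ^ 'n) measure))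
          = (\<integral>\<^sup>+h. 4 * (indicator (ball 0 \<epsilon>) h * cube_incr_nn (0, h)) + ennreal (4 * \<epsilon>\<^sup>2) * indicator (ball 0 \<epsilon>) h \<partial>lborel)"
          by (intro nn_integral_cong) (auto simp: indicator_def)
        also have "\<dots> = (\<integral>\<^sup>+h. 4 * (indicator (ball 0 \<epsilon>) h * cube_incr_nn (0, h)) \<partial>lborel)
            + (\<integral>\<^sup>+h. ennreal (4 * \<epsilon>\<^sup>2) * indicator (ball 0 \<epsilon>) h \<partial>(lborel :: (real ^ 'n) measure))"
          by (rule nn_integral_add) measurable
        also have "(\<integral>\<^sup>+h. 4 * (indicator (ball 0 \<epsilon>) h * cube_incr_nn (0, h)) \<partial>lborel) = 4 * (\<integral>\<^sup>+h. indicator (ball 0 \<epsilon>) h * cube_incr_nn (0, h) \<partial>lborel)"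
          by (rule nn_integral_cmult) measurable
        also have "(\<integral>\<^sup>+h. ennreal (4 * \<epsilon>\<^sup>2) * indicator (ball 0 \<epsilon>) h \<partial>(lborel :: (real ^ 'n) measure)) = ennreal (4 * \<epsilon>\<^sup>2) * emeasure lborel (ball (0 :: real ^ 'n) \<epsilon>)"
          by (rule nn_integral_cmult_indicator) simp
        finally show ?thesis .
      qed
      also have "\<dots> \<le> 4 * (ennreal (\<theta> * \<epsilon>) * ennreal (u * \<epsilon> ^ ?n)) + ennreal (4 * \<epsilon>\<^sup>2) * ennreal (u * \<epsilon> ^ ?n)"
        using Qe \<epsilon>(1) unfolding vol[OF less_imp_le[OF \<epsilon>(1)]] by (intro add_mono mult_left_mono) auto
      also have "\<dots> = ennreal (4 * (\<theta> * \<epsilon>) * (u * \<epsilon> ^ ?n) + 4 * \<epsilon>\<^sup>2 * (u * \<epsilon> ^ ?n))"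
      proof -
        have e: "4 * (ennreal a * ennreal b) + ennreal c * ennreal b = ennreal (4 * a * b + c * b)"
          if "0 \<le> a" "0 \<le> b" "0 \<le> c" for a b c
          using that by (simp add: ennreal_plus ennreal_mult mult.assoc)
        show ?thesis by (rule e) (use \<theta> \<epsilon>(1) u in auto)
      qed
      finally have B1: "(\<integral>\<^sup>+h. indicator (ball 0 \<epsilon>) h * (4 * cube_incr_nn (0, h) + ennreal (4 * \<epsilon>\<^sup>2)) \<partial>(lborel :: (real ^ 'n) measure)) \<le>
         ennreal (4 * (\<theta> * \<epsilon>) * (u * \<epsilon> ^ ?n) + 4 * \<epsilon>\<^sup>2 * (u * \<epsilon> ^ ?n))" .
      have "ennreal (norm (LINT w|lborel. pd (x_dir k) \<eta> w * defect \<psi> k w)) \<le>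
         ennreal (2 * C / \<epsilon> * M) * (ennreal (2 * \<delta>) * ennreal (4 * (\<theta> * \<epsilon>) * (u * \<epsilon> ^ ?n) + 4 * \<epsilon>\<^sup>2 * (u * \<epsilon> ^ ?n)))"
        by (rule order_trans[OF A1 mult_left_mono[OF mult_left_mono[OF B1]]]) auto
      also have "\<dots> = ennreal (2 * C / \<epsilon> * M * (2 * \<delta> * (4 * (\<theta> * \<epsilon>) * (u * \<epsilon> ^ ?n) + 4 * \<epsilon>\<^sup>2 * (u * \<epsilon> ^ ?n))))"
      proof -
        have e: "ennreal a * (ennreal b * ennreal c) = ennreal (a * (b * c))" if "0 \<le> a" "0 \<le> b" "0 \<le> c" for a b c
          using that by (simp add: ennreal_mult)
        show ?thesis by (rule e) (use \<theta> \<epsilon>(1) u C(1) M(1) \<delta>(1) in auto)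
      qed
      also have "2 * C / \<epsilon> * M * (2 * \<delta> * (4 * (\<theta> * \<epsilon>) * (u * \<epsilon> ^ ?n) + 4 * \<epsilon>\<^sup>2 * (u * \<epsilon> ^ ?n))) = 16 * C * M * \<delta> * (\<theta> + \<epsilon>) * (u * \<epsilon> ^ ?n)"
      proof -
        have e: "4 * (\<theta> * \<epsilon>) * x + 4 * \<epsilon>\<^sup>2 * x = \<epsilon> * (4 * (\<theta> + \<epsilon>) * x)" for x
          by (simp add: power2_eq_square algebra_simps)
        show ?thesis unfolding e using \<epsilon>(1) by simp
      qed
      finally have fin: "ennreal (norm (LINT w|lborel. pd (x_dir k) \<eta> w * defect \<psi> k w)) \<le> ennreal (16 * C * M * \<delta> * (\<theta> + \<epsilon>) * (u * \<epsilon> ^ ?n))" .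
      show ?thesis
      proof -
        have "0 \<le> 16 * C * M * \<delta> * (\<theta> + \<epsilon>) * (u * \<epsilon> ^ ?n)" using \<theta> \<epsilon>(1) u C(1) M(1) \<delta>(1) by simp
        from fin[unfolded ennreal_le_iff[OF this]] show ?thesis by simp
      qed
    qed
    \<comment> \<open>the flux is frozen at the origin, by continuity\<close>
    have fr: "\<bar>flux \<psi> 0 * J - (LINT w|lborel. \<eta> w * flux \<psi> w)\<bar> \<le> \<theta> * J"
    proof -
      have i0: "integrable lborel (\<lambda>w. \<eta> w * flux \<psi> 0)" using i\<eta> by (rule integrable_mult_left)
      have "(LINT w|lborel. \<eta> w * flux \<psi> 0) = flux \<psi> 0 * J"
        unfolding J_def mult.commute[of "flux \<psi> 0"] by (rule integral_mult_left_zero)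
      then have "flux \<psi> 0 * J - (LINT w|lborel. \<eta> w * flux \<psi> w) = (LINT w|lborel. \<eta> w * flux \<psi> 0 - \<eta> w * flux \<psi> w)"
        using Bochner_Integration.integral_diff[OF i0 bal2] by linarith
      also have "norm \<dots> \<le> (LINT w|lborel. \<theta> * \<eta> w)"
      proof (rule Bochner_Integration.integral_norm_bound_integral)
        show "integrable lborel (\<lambda>w. \<eta> w * flux \<psi> 0 - \<eta> w * flux \<psi> w)"
          by (rule Bochner_Integration.integrable_diff[OF i0 bal2])
        show "integrable lborel (\<lambda>w. \<theta> * \<eta> w)" using i\<eta> by simp
        fix w
        show "norm (\<eta> w * flux \<psi> 0 - \<eta> w * flux \<psi> w) \<le> \<theta> * \<eta> w"
        proof (cases "\<eta> w = 0")
          case False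
          then have "\<bar>fst w\<bar> < \<delta> \<and> norm (snd w) < \<epsilon>" unfolding \<eta>_def by (rule bump_nz[OF \<delta>(1) \<epsilon>(1)])
          then have "norm w < d1" using norm_Pair_le[of "fst w" "snd w"] \<delta>(2) \<epsilon>'(4) by simp
          then have "\<bar>flux \<psi> 0 - flux \<psi> w\<bar> \<le> \<theta>" using d1(2)[of w] by simp
          then have "\<eta> w * \<bar>flux \<psi> 0 - flux \<psi> w\<bar> \<le> \<eta> w * \<theta>"
            by (rule mult_left_mono) (simp add: \<eta>_def bump_nonneg)
          moreover have "0 \<le> \<eta> w" by (simp add: \<eta>_def bump_nonneg)
          ultimately show ?thesis by (simp add: right_diff_distrib[symmetric] abs_mult mult.commute)
        qed simp
      qed
      also have "\<dots> = \<theta> * J" unfolding J_def by simp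
      finally show ?thesis by simp
    qed
    have "\<bar>LINT w|lborel. \<eta> w * flux \<psi> w\<bar> \<le> (\<Sum>k\<in>(UNIV :: 'n set). 16 * C * M * \<delta> * (\<theta> + \<epsilon>) * (u * \<epsilon> ^ ?n)) / 2"
    proof -
      have "\<bar>\<Sum>k\<in>UNIV. LINT w|lborel. pd (x_dir k) \<eta> w * defect \<psi> k w\<bar> \<le> (\<Sum>k\<in>(UNIV :: 'n set). 16 * C * M * \<delta> * (\<theta> + \<epsilon>) * (u * \<epsilon> ^ ?n))"
        by (rule order_trans[OF sum_abs]) (intro sum_mono def)
      then show ?thesis unfolding bal1 by linarith
    qed
    also have "\<dots> = K * (\<theta> + \<epsilon>) * (exp (- 2) * (\<delta> * (u * (\<epsilon> / 2) ^ ?n)))"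
    proof -
      have e: "exp 2 * exp (- 2) = (1 :: real)" by (simp add: exp_minus_inverse)
      have p: "2 ^ ?n * (\<epsilon> / 2) ^ ?n = \<epsilon> ^ ?n" by (simp add: power_mult_distrib[symmetric])
      have "K * (\<theta> + \<epsilon>) * (exp (- 2) * (\<delta> * (u * (\<epsilon> / 2) ^ ?n)))
        = real ?n * 8 * C * M * (\<theta> + \<epsilon>) * \<delta> * u * (2 ^ ?n * (\<epsilon> / 2) ^ ?n) * (exp 2 * exp (- 2))"
        unfolding K_def by (simp only: mult_ac)
      also have "\<dots> = (\<Sum>k\<in>(UNIV :: 'n set). 16 * C * M * \<delta> * (\<theta> + \<epsilon>) * (u * \<epsilon> ^ ?n)) / 2"
        unfolding e p by simp
      finally show ?thesis by (rule sym)
    qed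
    also have "\<dots> \<le> K * (\<theta> + \<epsilon>) * J"
      by (rule mult_left_mono[OF Jlow]) (use K \<theta> \<epsilon>(1) in simp)
    also have "\<dots> \<le> K * (\<theta> + \<theta>) * J"
      using K \<epsilon>'(1) Jpos by (intro mult_right_mono mult_left_mono) auto
    finally have "\<bar>flux \<psi> 0 * J\<bar> \<le> \<theta> * J + K * (\<theta> + \<theta>) * J" using fr by linarith
    then have "\<bar>flux \<psi> 0\<bar> * J \<le> (\<theta> + K * (\<theta> + \<theta>)) * J" using Jpos by (simp add: abs_mult distrib_right)
    then show ?thesis using Jpos by simp
  qed
  show ?thesis
  proof (rule ccontr)
    assume "flux \<psi> 0 \<noteq> 0"
    then have p: "\<bar>flux \<psi> 0\<bar> > 0" by simp
    define \<theta> where "\<theta> = \<bar>flux \<psi> 0\<bar> / (2 * (1 + 2 * K))"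
    have \<theta>: "\<theta> > 0" unfolding \<theta>_def using p K by (intro divide_pos_pos) auto
    have "\<bar>flux \<psi> 0\<bar> \<le> \<theta> * (1 + 2 * K)" using main[OF \<theta>] by (simp add: algebra_simps)
    also have "\<dots> = \<bar>flux \<psi> 0\<bar> / 2"
    proof -
      have "1 + 2 * K \<noteq> 0" using K by linarith
      then show ?thesis unfolding \<theta>_def by (simp add: divide_simps)
    qed
    finally show False using p by simp
  qed
qed

end

section \<open>From the quotient metric to Euclidean balls\<close>

lemma periods_separated:
  fixes k l :: "real ^ 'n"
  assumes "k \<in> periods D" "l \<in> periods D" "norm (k - l) < 1"
  shows "k = l"
proof (cases D)
  case Torus
  have "k $ i - l $ i = 0" for i
  proof -
    have "k $ i - l $ i \<in> \<int>" using assms(1,2) Torus by auto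
    moreover have "\<bar>k $ i - l $ i\<bar> < 1" using component_le_norm_cart[of "k - l" i] assms(3) by simp
    ultimately show ?thesis by (rule Ints_nonzero_abs_less1)
  qed
  then show ?thesis by (simp add: vec_eq_iff)
qed (use assms in auto)

lemma fst_snd_borel:
  "(fst :: 'a::euclidean_space \<times> 'b::euclidean_space \<Rightarrow> 'a) \<in> borel_measurable borel"
  "(snd :: 'a::euclidean_space \<times> 'b::euclidean_space \<Rightarrow> 'b) \<in> borel_measurable borel"
  by (intro borel_measurable_continuous_onI continuous_intros)+

text \<open>
  Multiplication by the unit time interval turns integrals over space into integrals over
  space-time, so that the unfolding in space-time also serves for functions of space alone.
\<close>

lemma nn_integral_unit_slab:
  fixes g :: "real ^ 'n \<Rightarrow> ennreal"
  assumes [measurable]: "g \<in> borel_measurable borel"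
  shows "(\<integral>\<^sup>+z. indicator {0..1} (fst z) * g (snd z) \<partial>(lborel :: (real \<times> (real ^ 'n)) measure)) = (\<integral>\<^sup>+y. g y \<partial>lborel)"
proof -
  have "(\<integral>\<^sup>+z. indicator {0..1} (fst z) * g (snd z) \<partial>(lborel :: (real \<times> (real ^ 'n)) measure))
     = (\<integral>\<^sup>+s. \<integral>\<^sup>+y. indicator {0..1} (fst (s, y)) * g (snd (s, y)) \<partial>lborel \<partial>(lborel :: real measure))"
    unfolding lborel_prod[symmetric] by (rule lborel.nn_integral_fst[symmetric]) measurable
  also have "\<dots> = (\<integral>\<^sup>+s. indicator {0..1} s * (\<integral>\<^sup>+y. g y \<partial>lborel) \<partial>(lborel :: real measure))"
    by (intro nn_integral_cong) (simp add: nn_integral_cmult)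
  also have "\<dots> = (\<integral>\<^sup>+y. g y \<partial>lborel)" by (subst nn_integral_multc) auto
  finally show ?thesis .
qed

text \<open>
  For \<open>\<epsilon> \<le> 1/2\<close> the ball of radius \<open>\<epsilon>\<close> in the quotient is an isometric copy of the Euclidean
  one: two distinct translates of a point by periods are at distance at least \<open>1\<close> and cannot both lie
  in the open ball.
\<close>

lemma nn_integral_dball:
  fixes f :: "real ^ 'n \<Rightarrow> ennreal" and x :: "real ^ 'n"
  assumes [measurable]: "f \<in> borel_measurable borel" and p: "\<And>y k. k \<in> periods D \<Longrightarrow> f (y + k) = f y" and \<epsilon>: "\<epsilon> \<le> 1/2"
  shows "(\<integral>\<^sup>+y\<in>dball D x \<epsilon>. f y \<partial>lborel) = (\<integral>\<^sup>+y. indicator (ball x \<epsilon>) y * f y \<partial>lborel)"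
    and "dball D x \<epsilon> \<in> sets borel"
proof -
  define U where "U = {y. \<exists>k\<in>periods D. dist x (y + k) < \<epsilon>}"
  have "U = (\<Union>k\<in>periods D. {y. dist x (y + k) < \<epsilon>})" unfolding U_def by auto
  moreover have "open \<dots>" by (intro open_UN ballI open_Collect_less continuous_intros)
  ultimately have [measurable]: "U \<in> sets borel" by simp
  have dU: "dball D x \<epsilon> = cell D \<inter> U" unfolding dball_def U_def by auto
  then show "dball D x \<epsilon> \<in> sets borel" by simp
  have [measurable]: "ball x \<epsilon> \<in> sets borel" by simp
  note fst_snd_borel[measurable]
  let ?H = "\<lambda>z :: real \<times> (real ^ 'n). indicator {0..1} (fst z) * (indicator (ball x \<epsilon>) (snd z) * f (snd z)) :: ennreal"
  have cnt: "(\<integral>\<^sup>+k. indicator (ball x \<epsilon>) (y + k) \<partial>count_space (periods D)) = (indicator U y :: ennreal)" for y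
  proof (cases "y \<in> U")
    case True
    then obtain k where k: "k \<in> periods D" "dist x (y + k) < \<epsilon>" unfolding U_def by blast
    have "(\<integral>\<^sup>+l. indicator (ball x \<epsilon>) (y + l) \<partial>count_space (periods D)) = (\<integral>\<^sup>+l. (indicator {k} l :: ennreal) \<partial>count_space (periods D))"
    proof (rule nn_integral_cong)
      fix l :: "real ^ 'n" assume "l \<in> space (count_space (periods D))"
      then have l: "l \<in> periods D" by simp
      have "y + l \<in> ball x \<epsilon> \<longleftrightarrow> l = k"
      proof
        assume "y + l \<in> ball x \<epsilon>"
        then have "dist (y + l) (y + k) < 1" using dist_triangle3[of "y + l" "y + k" x] k(2) \<epsilon> by simp
        then have "norm (l - k) < 1" by (simp add: dist_norm)
        then show "l = k" by (rule periods_separated[OF l k(1)])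
      qed (use k in simp)
      then show "indicator (ball x \<epsilon>) (y + l) = (indicator {k} l :: ennreal)" by (simp add: indicator_def)
    qed
    also have "\<dots> = 1" using k(1) by (subst nn_integral_indicator) auto
    finally show ?thesis using True by simp
  next
    case False
    have "(\<integral>\<^sup>+l. indicator (ball x \<epsilon>) (y + l) \<partial>count_space (periods D)) = (\<integral>\<^sup>+l. (0 :: ennreal) \<partial>count_space (periods D :: (real ^ 'n) set))"
    proof (rule nn_integral_cong)
      fix l :: "real ^ 'n" assume "l \<in> space (count_space (periods D))"
      then have "y + l \<notin> ball x \<epsilon>" using False unfolding U_def by auto
      then show "indicator (ball x \<epsilon>) (y + l) = (0 :: ennreal)" by simp
    qed
    then show ?thesis using False by simp
  qed
  have "(\<integral>\<^sup>+y. indicator (ball x \<epsilon>) y * f y \<partial>lborel) = (\<integral>\<^sup>+z. ?H z \<partial>lborel)"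
    by (rule nn_integral_unit_slab[symmetric]) measurable
  also have "\<dots> = (\<integral>\<^sup>+z. (\<integral>\<^sup>+k. ?H (z + (0, k)) \<partial>count_space (periods D)) \<partial>cellm D)"
    by (rule nn_integral_unfold[symmetric]) measurable
  also have "\<dots> = (\<integral>\<^sup>+z. indicator {0..1} (fst z) * (indicator U (snd z) * f (snd z)) \<partial>cellm D)"
  proof (rule nn_integral_cong)
    fix z :: "real \<times> (real ^ 'n)"
    have "(\<integral>\<^sup>+k. ?H (z + (0, k)) \<partial>count_space (periods D)) =
        (\<integral>\<^sup>+k. (indicator {0..1} (fst z) * f (snd z)) * indicator (ball x \<epsilon>) (snd z + k) \<partial>count_space (periods D))"
      by (intro nn_integral_cong) (simp add: p mult_ac)
    also have "\<dots> = indicator {0..1} (fst z) * f (snd z) * indicator U (snd z)"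
      by (simp add: nn_integral_cmult cnt)
    finally show "(\<integral>\<^sup>+k. ?H (z + (0, k)) \<partial>count_space (periods D)) = indicator {0..1} (fst z) * (indicator U (snd z) * f (snd z))"
      by (simp add: mult_ac)
  qed
  also have "\<dots> = (\<integral>\<^sup>+z. indicator (UNIV \<times> cell D) z * (indicator {0..1} (fst z) * (indicator U (snd z) * f (snd z))) \<partial>(lborel :: (real \<times> (real ^ 'n)) measure))"
    by (rule nn_integral_cellm) measurable
  also have "\<dots> = (\<integral>\<^sup>+z. indicator {0..1} (fst z) * (f (snd z) * indicator (dball D x \<epsilon>) (snd z)) \<partial>(lborel :: (real \<times> (real ^ 'n)) measure))"
    unfolding dU by (intro nn_integral_cong) (auto simp: indicator_def mem_Times_iff)
  also have "\<dots> = (\<integral>\<^sup>+y. f y * indicator (dball D x \<epsilon>) y \<partial>lborel)"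
    by (rule nn_integral_unit_slab) (simp add: dU)
  finally show "(\<integral>\<^sup>+y\<in>dball D x \<epsilon>. f y \<partial>lborel) = (\<integral>\<^sup>+y. indicator (ball x \<epsilon>) y * f y \<partial>lborel)" by simp
qed

lemma emeasure_dball:
  fixes x :: "real ^ 'n"
  assumes "0 \<le> \<epsilon>" "\<epsilon> \<le> 1/2"
  shows "emeasure lborel (dball D x \<epsilon>) = emeasure lborel (ball (0 :: real ^ 'n) \<epsilon>)"
proof -
  have "emeasure lborel (dball D x \<epsilon>) = emeasure lborel (ball x \<epsilon>)"
    using nn_integral_dball[of "\<lambda>y. 1" D \<epsilon> x] assms(2) by simp
  also have "\<dots> = emeasure lborel (ball (0 :: real ^ 'n) \<epsilon>)"
    using emeasure_ball[OF assms(1), of x] emeasure_ball[OF assms(1), of "0 :: real ^ 'n"] by simp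
  finally show ?thesis .
qed

text \<open>
  A periodic function is determined by its values on the strip, and there are only countably
  many translates to be glued together.
\<close>

lemma periodic_borel:
  fixes F :: "real \<times> (real ^ 'n) \<Rightarrow> 'b::topological_space"
  assumes p: "x_periodic D F" and [measurable]: "W \<in> borel_measurable borel" and eq: "\<And>z. z \<in> UNIV \<times> cell D \<Longrightarrow> F z = W z"
  shows "F \<in> borel_measurable borel"
proof (rule measurableI)
  fix B :: "'b set" assume [measurable]: "B \<in> sets borel"
  have "F -` B \<inter> space borel = (\<Union>k\<in>periods D. {z. z + (0, k) \<in> UNIV \<times> cell D \<and> W (z + (0, k)) \<in> B})"
  proof (intro set_eqI iffI)
    fix z assume z: "z \<in> F -` B \<inter> space borel"
    obtain k where k: "k \<in> periods D" "snd z + k \<in> cell D"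
      by (rule cell_unique[of D "snd z"]) (rule that)
    have "W (z + (0, k)) = F z" using eq[of "z + (0, k)"] x_periodicD[OF p k(1), of z] k(2) by (simp add: mem_Times_iff)
    then show "z \<in> (\<Union>k\<in>periods D. {z. z + (0, k) \<in> UNIV \<times> cell D \<and> W (z + (0, k)) \<in> B})"
      using z k by (intro UN_I[OF k(1)]) (simp add: mem_Times_iff)
  next
    fix z assume "z \<in> (\<Union>k\<in>periods D. {z. z + (0, k) \<in> UNIV \<times> cell D \<and> W (z + (0, k)) \<in> B})"
    then obtain k where k: "k \<in> periods D" "z + (0, k) \<in> UNIV \<times> cell D" "W (z + (0, k)) \<in> B"
      by (elim UN_E CollectE conjE) (rule that)
    have "F z = W (z + (0, k))" using eq[OF k(2)] x_periodicD[OF p k(1), of z] by simp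
    then show "z \<in> F -` B \<inter> space borel" using k(3) by simp
  qed
  also have "\<dots> \<in> sets borel"
  proof (rule sets.countable_UN''[OF countable_periods])
    fix k :: "real ^ 'n" assume "k \<in> periods D"
    have "{z \<in> space borel. z + (0, k) \<in> UNIV \<times> cell D \<and> W (z + (0, k)) \<in> B} \<in> sets borel" by measurable
    then show "{z. z + (0, k) \<in> UNIV \<times> cell D \<and> W (z + (0, k)) \<in> B} \<in> sets borel" by simp
  qed
  finally show "F -` B \<inter> space borel \<in> sets borel" .
qed simp

lemma Lp_on_cong: "(\<And>z. z \<in> A \<Longrightarrow> f z = g z) \<Longrightarrow> Lp_on q A f \<longleftrightarrow> Lp_on q A g"
proof -
  assume eq: "\<And>z. z \<in> A \<Longrightarrow> f z = g z"
  have "indicator A z *\<^sub>R f z = indicator A z *\<^sub>R g z"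
    "indicator A z *\<^sub>R norm (f z) powr q = indicator A z *\<^sub>R norm (g z) powr q" for z
    using eq[of z] by (cases "z \<in> A"; simp)+
  then show ?thesis unfolding Lp_on_def set_borel_measurable_def set_integrable_def by (simp only:)
qed

lemma integrable_vecI:
  fixes f :: "'a \<Rightarrow> real ^ 'n"
  assumes "\<And>i. integrable M (\<lambda>z. f z $ i)"
  shows "integrable M f"
proof -
  have "integrable M (\<lambda>z. \<Sum>i\<in>UNIV. (f z $ i) *\<^sub>R axis i (1 :: real))" using assms by simp
  moreover have "(\<Sum>i\<in>UNIV. (f z $ i) *\<^sub>R axis i (1 :: real)) = f z" for z
    using basis_expansion[of "f z"] by (simp add: scalar_mult_eq_scaleR)
  ultimately show ?thesis by simp
qed

context cubic_fields
begin

lemma Lp_on_1_compact: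
  fixes g :: "real \<times> (real ^ 'n) \<Rightarrow> 'b::euclidean_space"
  assumes [measurable]: "g \<in> borel_measurable borel" and K: "compact K" and bd: "\<And>z. norm (g z) \<le> c * (1 + m z ^ 3)"
  shows "Lp_on 1 (K \<inter> (UNIV \<times> cell D)) g"
proof -
  have [measurable]: "K \<in> sets borel" using K by (rule borel_compact)
  let ?A = "K \<inter> (UNIV \<times> cell D)"
  have [measurable]: "?A \<in> sets borel" by measurable
  have c: "0 \<le> c"
  proof -
    have "0 \<le> c * (1 + m 0 ^ 3)" using bd[of 0] norm_ge_zero order_trans by blast
    moreover have "0 < 1 + m 0 ^ 3" using m_nonneg[of 0] by (simp add: add_pos_nonneg)
    ultimately show ?thesis by (simp add: zero_le_mult_iff)
  qed
  have "integrable lborel (\<lambda>z. indicator (UNIV \<times> cell D) z *\<^sub>R m z ^ 3)"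
    using m3_integrable by (subst (asm) integrable_cellm) auto
  moreover have "integrable lborel (\<lambda>z. indicator K z :: real)"
    using emeasure_compact_finite[OF K] by (simp add: integrable_indicator_iff)
  ultimately have i: "integrable lborel (\<lambda>z. c * (indicator K z + indicator (UNIV \<times> cell D) z *\<^sub>R m z ^ 3))" by simp
  have "integrable lborel (\<lambda>z. indicator ?A z *\<^sub>R norm (g z) powr 1)"
  proof (rule Bochner_Integration.integrable_bound[OF i])
    show "AE z in lborel. norm (indicator ?A z *\<^sub>R norm (g z) powr 1) \<le> norm (c * (indicator K z + indicator (UNIV \<times> cell D) z *\<^sub>R m z ^ 3))"
    proof (rule AE_I2)
      fix z
      show "norm (indicator ?A z *\<^sub>R norm (g z) powr 1) \<le> norm (c * (indicator K z + indicator (UNIV \<times> cell D) z *\<^sub>R m z ^ 3))"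
      proof (cases "z \<in> ?A")
        case True
        then show ?thesis using order_trans[OF bd[of z] abs_ge_self] by simp
      qed simp
    qed
    show "(\<lambda>z. indicator ?A z *\<^sub>R norm (g z) powr 1) \<in> borel_measurable lborel" by measurable
  qed
  then show ?thesis unfolding Lp_on_def set_borel_measurable_def set_integrable_def by simp
qed

end

context weak_solution
begin

text \<open>
  The points of the ball around \<open>x\<close> are written as \<open>x + h\<close>. The denominator does not depend on
  \<open>x\<close> and can be taken out of the integral, after which the order of integration is exchanged.
\<close>

lemma cubic_increment_eq:
  fixes v :: "real \<times> (real ^ 'n) \<Rightarrow> real ^ 'n"
  assumes V: "\<And>t x. V (t, x) = (if 0 < t \<and> t < T then v (t, x) else 0)" and \<epsilon>: "0 < \<epsilon>" "\<epsilon> \<le> 1/2"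
  shows "cubic_increment T D v \<epsilon> = (\<integral>\<^sup>+h. indicator (ball 0 \<epsilon>) h * cube_incr_nn (0, h) \<partial>lborel) / emeasure lborel (ball (0 :: real ^ 'n) \<epsilon>)"
proof -
  let ?\<mu> = "emeasure lborel (ball (0 :: real ^ 'n) \<epsilon>)"
  have [measurable]: "ball (0 :: real ^ 'n) \<epsilon> \<in> sets borel" by simp
  interpret c: sigma_finite_measure "cellm D" by (rule sigma_finite_cellm)
  interpret pair_sigma_finite "lborel :: (real ^ 'n) measure" "cellm D" ..
  define inc where "inc z h = ennreal (norm (V (z + (0, h)) - V z) ^ 3)" for z h
  have cm: "(\<lambda>p. fst p + (0, snd p) :: real \<times> (real ^ 'n)) \<in> borel_measurable borel"
    by (rule borel_measurable_continuous_onI) (intro continuous_intros)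
  have im: "(\<lambda>p. inc (fst p) (snd p)) \<in> borel_measurable borel"
  proof -
    have [measurable]: "(\<lambda>p :: (real \<times> (real ^ 'n)) \<times> (real ^ 'n). V (fst p + (0, snd p))) \<in> borel_measurable borel"
      by (rule measurable_compose[OF cm V_borel])
    have [measurable]: "(\<lambda>p :: (real \<times> (real ^ 'n)) \<times> (real ^ 'n). V (fst p)) \<in> borel_measurable borel"
      by (rule measurable_compose[OF _ V_borel], rule borel_measurable_continuous_onI) (intro continuous_intros)
    show ?thesis unfolding inc_def by measurable
  qed
  have im1[measurable]: "(\<lambda>(z, h). inc z h) \<in> borel_measurable (borel \<Otimes>\<^sub>M borel)"
    using im by (simp add: borel_prod case_prod_unfold)
  define G where "G z = (\<integral>\<^sup>+h. indicator (ball 0 \<epsilon>) h * inc z h \<partial>lborel)" for z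
  have Gm[measurable]: "G \<in> borel_measurable borel"
    unfolding G_def[abs_def] by (rule lborel.borel_measurable_nn_integral) measurable
  have inner: "(\<integral>\<^sup>+y\<in>dball D x \<epsilon>. ennreal (norm (v (t, x) - v (t, y)) ^ 3) \<partial>lborel) / emeasure lborel (dball D x \<epsilon>) = G (t, x) / ?\<mu>"
    if t: "0 < t" "t < T" for t x
  proof -
    have [measurable]: "ball x \<epsilon> \<in> sets borel" by simp
    have Vm[measurable]: "(\<lambda>y. V (t, y)) \<in> borel_measurable borel"
      by (rule measurable_compose[OF _ V_borel], rule borel_measurable_continuous_onI) (intro continuous_intros)
    have Vp: "V (t, y + k) = V (t, y)" if "k \<in> periods D" for y k
      using x_periodicD[OF V_per that, of "(t, y)"] by simp
    have "(\<integral>\<^sup>+y\<in>dball D x \<epsilon>. ennreal (norm (v (t, x) - v (t, y)) ^ 3) \<partial>lborel)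
      = (\<integral>\<^sup>+y\<in>dball D x \<epsilon>. ennreal (norm (V (t, x) - V (t, y)) ^ 3) \<partial>lborel)" using V t by simp
    also have "\<dots> = (\<integral>\<^sup>+y. indicator (ball x \<epsilon>) y * ennreal (norm (V (t, x) - V (t, y)) ^ 3) \<partial>lborel)"
      by (rule nn_integral_dball(1)) (use Vm Vp \<epsilon> in auto)
    also have "\<dots> = (\<integral>\<^sup>+h. indicator (ball x \<epsilon>) (h + x) * ennreal (norm (V (t, x) - V (t, h + x)) ^ 3) \<partial>lborel)"
      by (rule lborel_shift(3)[symmetric]) measurable
    also have "\<dots> = G (t, x)"
      unfolding G_def inc_def
      by (intro nn_integral_cong) (auto simp: indicator_def dist_norm norm_minus_commute add.commute)
    finally show ?thesis using emeasure_dball[of \<epsilon> D x] \<epsilon> by simp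
  qed
  have G0: "G (t, x) = 0" if "\<not> (0 < t \<and> t < T)" for t x
  proof -
    have "V (t, y) = 0" for y using that by (simp only: V if_False)
    then show ?thesis unfolding G_def inc_def by simp
  qed
  have "cubic_increment T D v \<epsilon> = (\<integral>\<^sup>+t. \<integral>\<^sup>+x. indicator (UNIV \<times> cell D) (t, x) * (G (t, x) / ?\<mu>) \<partial>lborel \<partial>lborel)"
    unfolding cubic_increment_def
  proof (rule nn_integral_cong)
    fix t :: real
    show "(\<integral>\<^sup>+x\<in>cell D. (\<integral>\<^sup>+y\<in>dball D x \<epsilon>. ennreal (norm (v (t, x) - v (t, y)) ^ 3) \<partial>lborel) / emeasure lborel (dball D x \<epsilon>) \<partial>lborel) * indicator {0<..<T} t
       = (\<integral>\<^sup>+x. indicator (UNIV \<times> cell D) (t, x) * (G (t, x) / ?\<mu>) \<partial>lborel)"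
    proof (cases "0 < t \<and> t < T")
      case True
      then show ?thesis using inner[of t] by (auto simp: indicator_def intro!: nn_integral_cong)
    next
      case False
      then show ?thesis using G0[OF False] by simp
    qed
  qed
  also have "\<dots> = (\<integral>\<^sup>+z. indicator (UNIV \<times> cell D) z * (G z / ?\<mu>) \<partial>(lborel \<Otimes>\<^sub>M lborel))"
    by (rule lborel.nn_integral_fst) (simp add: borel_prod lborel_prod, measurable)
  also have "\<dots> = (\<integral>\<^sup>+z. G z / ?\<mu> \<partial>cellm D)"
    unfolding lborel_prod by (rule nn_integral_cellm[symmetric]) measurable
  also have "\<dots> = (\<integral>\<^sup>+z. G z \<partial>cellm D) / ?\<mu>" by (rule nn_integral_divide) simp
  also have "(\<integral>\<^sup>+z. G z \<partial>cellm D) = (\<integral>\<^sup>+h. (\<integral>\<^sup>+z. indicator (ball 0 \<epsilon>) h * inc z h \<partial>cellm D) \<partial>lborel)"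
    unfolding G_def by (rule Fubini') measurable
  also have "\<dots> = (\<integral>\<^sup>+h. indicator (ball 0 \<epsilon>) h * cube_incr_nn (0, h) \<partial>lborel)"
  proof (rule nn_integral_cong)
    fix h :: "real ^ 'n"
    have "(\<lambda>z. V (z + (0, h))) \<in> borel_measurable borel" by measurable
    then show "(\<integral>\<^sup>+z. indicator (ball 0 \<epsilon>) h * inc z h \<partial>cellm D) = indicator (ball 0 \<epsilon>) h * cube_incr_nn (0, h)"
      unfolding cube_incr_nn_def inc_def by (intro nn_integral_cmult) simp
  qed
  finally show ?thesis .
qed

text \<open>
  A vanishing lower limit provides arbitrarily small radii at which the increment is small
  relative to the radius.
\<close>

lemma increments_small:
  fixes v :: "real \<times> (real ^ 'n) \<Rightarrow> real ^ 'n"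
  assumes V: "\<And>t x. V (t, x) = (if 0 < t \<and> t < T then v (t, x) else 0)"
    and L: "Liminf (at_right 0) (\<lambda>\<epsilon>. cubic_increment T D v \<epsilon> / ennreal \<epsilon>) = 0"
    and \<theta>: "0 < \<theta>" "0 < e0"
  shows "\<exists>\<epsilon>. 0 < \<epsilon> \<and> \<epsilon> < e0 \<and>
       (\<integral>\<^sup>+h. indicator (ball 0 \<epsilon>) h * cube_incr_nn (0, h) \<partial>lborel) \<le> ennreal (\<theta> * \<epsilon>) * emeasure lborel (ball (0 :: real ^ 'n) \<epsilon>)"
proof -
  have "\<not> eventually (\<lambda>\<epsilon>. ennreal \<theta> \<le> cubic_increment T D v \<epsilon> / ennreal \<epsilon>) (at_right 0)"
  proof
    assume "eventually (\<lambda>\<epsilon>. ennreal \<theta> \<le> cubic_increment T D v \<epsilon> / ennreal \<epsilon>) (at_right 0)"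
    then have "ennreal \<theta> \<le> Liminf (at_right 0) (\<lambda>\<epsilon>. cubic_increment T D v \<epsilon> / ennreal \<epsilon>)" by (rule Liminf_bounded)
    then show False using L \<theta>(1) by simp
  qed
  then have "\<not> (\<forall>\<epsilon>>0. \<epsilon> < min e0 (1/2) \<longrightarrow> ennreal \<theta> \<le> cubic_increment T D v \<epsilon> / ennreal \<epsilon>)"
    unfolding eventually_at_right_field not_ex de_Morgan_conj by (elim allE[of _ "min e0 (1/2)"]) (use \<theta>(2) in simp)
  then obtain \<epsilon> where \<epsilon>: "0 < \<epsilon>" "\<epsilon> < min e0 (1/2)" "\<not> ennreal \<theta> \<le> cubic_increment T D v \<epsilon> / ennreal \<epsilon>"
    by blast
  let ?\<mu> = "emeasure lborel (ball (0 :: real ^ 'n) \<epsilon>)"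
  let ?I = "\<integral>\<^sup>+h. indicator (ball 0 \<epsilon>) h * cube_incr_nn (0, h) \<partial>(lborel :: (real ^ 'n) measure)"
  have \<mu>: "?\<mu> \<noteq> 0" "?\<mu> \<noteq> top" using emeasure_ball[of \<epsilon> "0 :: real ^ 'n"] \<epsilon>(1) by (auto simp: ennreal_eq_0_iff not_le)
  have e: "ennreal \<epsilon> \<noteq> 0" "ennreal \<epsilon> \<noteq> top" using \<epsilon>(1) by auto
  have "?I / ?\<mu> / ennreal \<epsilon> \<le> ennreal \<theta>" using \<epsilon> cubic_increment_eq[OF V, of \<epsilon>] by simp
  then have "?I / ?\<mu> / ennreal \<epsilon> * ennreal \<epsilon> * ?\<mu> \<le> ennreal \<theta> * ennreal \<epsilon> * ?\<mu>" by (intro mult_right_mono) auto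
  moreover have "?I / ?\<mu> / ennreal \<epsilon> * ennreal \<epsilon> * ?\<mu> = ?I"
    using e \<mu> by (simp add: ennreal_divide_times ennreal_divide_self less_top)
  ultimately show ?thesis using \<epsilon> \<theta> by (intro exI[of _ \<epsilon>]) (simp add: ennreal_mult)
qed

end

theorem theorem2p2:
  fixes D :: domain
    and T :: real
    and v\<^sub>0 :: "real ^ 'n \<Rightarrow> real ^ 'n"
    and v :: "real \<times> (real ^ 'n) \<Rightarrow> real ^ 'n"
    and p :: "real \<times> (real ^ 'n) \<Rightarrow> real"
  assumes "T > 0"
    and "periodic D v\<^sub>0"
    and "\<And>t. periodic D (\<lambda>x. v (t, x))"
    and "\<And>t. periodic D (\<lambda>x. p (t, x))"
    and "Lp_on 2 (cell D) v\<^sub>0"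
    and "Linf_L2 T D v"
    and "Lp_on 3 ({0<..<T} \<times> cell D) v"
    and "Lp_on (3/2) ({0<..<T} \<times> cell D) p"
    and "weak_euler_solution T D v\<^sub>0 v p"
    and "Liminf (at_right 0) (\<lambda>\<epsilon>. cubic_increment T D v \<epsilon> / ennreal \<epsilon>) = 0"
  shows "weak_conservation_law T D
           (\<lambda>z. (norm (v z))\<^sup>2 / 2)
           (\<lambda>z. ((norm (v z))\<^sup>2 / 2 + p z) *\<^sub>R v z)"
proof -
  define V where "V z = (if 0 < fst z \<and> fst z < T then v z else 0)" for z
  define P where "P z = (if 0 < fst z \<and> fst z < T then p z else 0)" for z
  let ?A = "{0<..<T} \<times> cell D :: (real \<times> (real ^ 'n)) set"
  let ?S = "UNIV \<times> cell D :: (real \<times> (real ^ 'n)) set"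
  have v_per: "x_periodic D v" and p_per: "x_periodic D p" using assms(3,4) unfolding x_periodic_iff_periodic by blast+
  have V_per: "x_periodic D V"
    unfolding x_periodic_def by (intro allI ballI) (simp add: V_def x_periodicD[OF v_per])
  have P_per: "x_periodic D P"
    unfolding x_periodic_def by (intro allI ballI) (simp add: P_def x_periodicD[OF p_per])
  have VS: "indicator ?S z *\<^sub>R V z = indicator ?A z *\<^sub>R v z" for z
    unfolding V_def by (auto simp: indicator_def mem_Times_iff)
  have PS: "indicator ?S z *\<^sub>R P z = indicator ?A z *\<^sub>R p z" for z
    unfolding P_def by (auto simp: indicator_def mem_Times_iff)
  have V_borel: "V \<in> borel_measurable borel"
  proof (rule periodic_borel[OF V_per])
    show "(\<lambda>z. indicator ?A z *\<^sub>R v z) \<in> borel_measurable borel"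
      using assms(7) unfolding Lp_on_def set_borel_measurable_def by simp
    show "V z = indicator ?A z *\<^sub>R v z" if "z \<in> ?S" for z using VS[of z] that by simp
  qed
  have P_borel: "P \<in> borel_measurable borel"
  proof (rule periodic_borel[OF P_per])
    show "(\<lambda>z. indicator ?A z *\<^sub>R p z) \<in> borel_measurable borel"
      using assms(8) unfolding Lp_on_def set_borel_measurable_def by simp
    show "P z = indicator ?A z *\<^sub>R p z" if "z \<in> ?S" for z using PS[of z] that by simp
  qed
  have V3: "integrable (cellm D) (\<lambda>z. norm (V z) ^ 3)"
  proof (subst integrable_cellm)
    have "indicator ?A z *\<^sub>R norm (v z) powr 3 = indicator ?S z *\<^sub>R norm (V z) ^ 3" for z
      unfolding V_def by (cases "v z = 0") (auto simp: indicator_def mem_Times_iff)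
    then show "integrable lborel (\<lambda>z. indicator ?S z *\<^sub>R norm (V z) ^ 3)"
      using assms(7) unfolding Lp_on_def set_integrable_def by simp
  qed (use V_borel in simp)
  have P32: "integrable (cellm D) (\<lambda>z. sqrt \<bar>P z\<bar> ^ 3)"
  proof (subst integrable_cellm)
    have s: "sqrt \<bar>x\<bar> ^ 3 = \<bar>x\<bar> powr (3/2)" for x :: real
    proof (cases "x = 0")
      case False
      then have "\<bar>x\<bar> powr (3/2) = (\<bar>x\<bar> powr (1/2)) powr 3" by (simp add: powr_powr)
      then show ?thesis using False by (simp add: powr_half_sqrt)
    qed simp
    have "indicator ?A z *\<^sub>R norm (p z) powr (3/2) = indicator ?S z *\<^sub>R sqrt \<bar>P z\<bar> ^ 3" for z
      unfolding s unfolding P_def by (auto simp: indicator_def mem_Times_iff)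
    then show "integrable lborel (\<lambda>z. indicator ?S z *\<^sub>R sqrt \<bar>P z\<bar> ^ 3)"
      using assms(8) unfolding Lp_on_def set_integrable_def by simp
  qed (use P_borel in simp)
  interpret cubic_fields D V P by unfold_locales (fact V_borel P_borel V_per P_per V3 P32)+
  \<comment> \<open>the given formulation is an identity between vectors integrated over \<open>(0,T) \<times> cell D\<close>; its components
    are integrals over the strip because \<open>V\<close> and \<open>P\<close> vanish at other times\<close>
  have weak: "weak_solution D V P T"
  proof unfold_locales
    fix \<phi> :: "real \<times> (real ^ 'n) \<Rightarrow> real" and i
    assume \<phi>: "test_function {0<..<T} D \<phi>"
    have \<phi>T: "test_function {..<T} D \<phi>" and \<phi>0: "\<phi> (0, x) = 0" for x
    proof -
      obtain K where K: "smooth \<phi>" "x_periodic D \<phi>" "compact K" "K \<subseteq> {0<..<T} \<times> UNIV" "\<And>z. z \<notin> periodic_hull D K \<Longrightarrow> \<phi> z = 0"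
        using \<phi> unfolding test_function_iff by (elim conjE exE) (rule that, auto)
      have "K \<subseteq> {..<T} \<times> UNIV" using K(4) by auto
      then show "test_function {..<T} D \<phi>" unfolding test_function_iff
        by (intro conjI exI[of _ K] K allI impI)
      have "(0, x) \<notin> periodic_hull D K" unfolding periodic_hull_def using K(4) by auto
      then show "\<phi> (0, x) = 0" by (rule K(5))
    qed
    define F where "F z = dt \<phi> z *\<^sub>R v z + (\<Sum>k\<in>UNIV. (v z $ k * dx k \<phi> z) *\<^sub>R v z) + p z *\<^sub>R grad \<phi> z" for z
    define c where "c i z = V z $ i * dt \<phi> z + (\<Sum>k\<in>UNIV. V z $ i * V z $ k * dx k \<phi> z) + P z * dx i \<phi> z" for i z
    have ci: "integrable (cellm D) (c i)" for i
      unfolding c_def[abs_def] dt_eq_pd dx_eq_pd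
      by (intro Bochner_Integration.integrable_add Bochner_Integration.integrable_sum
        integrable_tame_pd[OF \<phi> tame_V _ t_dir_Basis] integrable_tame_pd[OF \<phi> tame_VV _ x_dir_Basis]
        integrable_tame_pd[OF \<phi> tame_P _ x_dir_Basis]) simp_all
    then have cb: "c i \<in> borel_measurable borel" for i using borel_measurable_integrable[OF ci[of i]] by simp
    have Fc: "(indicator ?A z *\<^sub>R F z) $ i = indicator ?S z *\<^sub>R c i z" for z i
      unfolding F_def c_def V_def P_def grad_def
      by (auto simp: indicator_def mem_Times_iff mult_ac sum_distrib_left intro!: sum.cong)
    have iF: "integrable lborel (\<lambda>z. indicator ?A z *\<^sub>R F z)"
      by (rule integrable_vecI) (use ci integrable_cellm[OF cb] in \<open>simp only: Fc\<close>)
    have "(LINT z:?A|lborel. F z) + (LINT x:cell D|lborel. \<phi> (0, x) *\<^sub>R v\<^sub>0 x) = 0"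
      using assms(9) \<phi>T unfolding weak_euler_solution_def F_def by blast
    then have "(LINT z|lborel. indicator ?A z *\<^sub>R F z) = 0"
      unfolding set_lebesgue_integral_def by (simp add: \<phi>0)
    then have "(LINT z|lborel. (indicator ?A z *\<^sub>R F z) $ i) = 0"
      using integral_bounded_linear[OF bounded_linear_vec_nth iF, of i] by simp
    then have "(LINT z|cellm D. c i z) = 0" unfolding Fc integral_cellm[OF cb] .
    then show "(LINT z|cellm D. V z $ i * dt \<phi> z + (\<Sum>k\<in>UNIV. V z $ i * V z $ k * dx k \<phi> z) + P z * dx i \<phi> z) = 0"
      unfolding c_def .
  next
    fix \<phi> :: "real \<times> (real ^ 'n) \<Rightarrow> real"
    assume \<phi>: "test_function {0<..<T} D \<phi>"
    have i: "integrable (cellm D) (\<lambda>z. \<Sum>k\<in>UNIV. V z $ k * dx k \<phi> z)"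
      unfolding dx_eq_pd by (intro Bochner_Integration.integrable_sum integrable_tame_pd[OF \<phi> tame_V _ x_dir_Basis]) simp
    have "(LINT z:?A|lborel. (\<Sum>k\<in>UNIV. v z $ k * dx k \<phi> z)) = 0"
      using assms(9) \<phi> unfolding weak_euler_solution_def weakly_div_free_def by blast
    moreover have "indicator ?A z *\<^sub>R (\<Sum>k\<in>UNIV. v z $ k * dx k \<phi> z) = indicator ?S z *\<^sub>R (\<Sum>k\<in>UNIV. V z $ k * dx k \<phi> z)" for z
      unfolding V_def by (auto simp: indicator_def mem_Times_iff)
    ultimately show "(LINT z|cellm D. (\<Sum>k\<in>UNIV. V z $ k * dx k \<phi> z)) = 0"
      using borel_measurable_integrable[OF i] unfolding set_lebesgue_integral_def
      by (subst integral_cellm) simp_all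
  qed
  interpret weak_solution D V P T by (rule weak)
  have Vtx: "V (t, x) = (if 0 < t \<and> t < T then v (t, x) else 0)" for t x unfolding V_def by simp
  define e where "e z = N z / 2" for z
  define q where "q z = (N z / 2 + P z) *\<^sub>R V z" for z
  have e_eq: "(norm (v z))\<^sup>2 / 2 = e z" and q_eq: "((norm (v z))\<^sup>2 / 2 + p z) *\<^sub>R v z = q z"
    if "fst z \<in> {0<..<T}" for z
    using that unfolding e_def q_def N_def V_def P_def by auto
  have N_borel[measurable]: "N \<in> borel_measurable borel" by (rule tame_borel[OF tame_N])
  have mle: "m z ^ j \<le> 1 + m z ^ 3" if "j \<le> 3" for j z
    using pow_mult_le[of "m z" 0 j 0] m_nonneg[of z] that by simp
  have eK: "Lp_on 1 (K \<inter> (UNIV \<times> cell D)) e" if "compact K" for K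
  proof (rule Lp_on_1_compact[OF _ that, where c = 1])
    show "e \<in> borel_measurable borel" unfolding e_def[abs_def] by measurable
    show "norm (e z) \<le> 1 * (1 + m z ^ 3)" for z
      using tame_le[OF tame_N, of z] mle[of 2 z] unfolding e_def by simp
  qed
  have qK: "Lp_on 1 (K \<inter> (UNIV \<times> cell D)) q" if "compact K" for K
  proof (rule Lp_on_1_compact[OF _ that, where c = 2])
    show "q \<in> borel_measurable borel" unfolding q_def[abs_def] by measurable
    show "norm (q z) \<le> 2 * (1 + m z ^ 3)" for z
    proof -
      have "\<bar>N z / 2 + P z\<bar> \<le> 2 * m z ^ 2" using tame_le[OF tame_N, of z] tame_le[OF tame_P, of z] by linarith
      moreover have "norm (V z) \<le> m z" unfolding m_def by simp
      ultimately have "norm (q z) \<le> (2 * m z ^ 2) * m z"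
        unfolding q_def norm_scaleR by (intro mult_mono) auto
      also have "\<dots> \<le> 2 * (1 + m z ^ 3)" by (simp add: power2_eq_square power3_eq_cube)
      finally show ?thesis .
    qed
  qed
  show ?thesis
    unfolding weak_conservation_law_def
  proof (intro conjI allI impI)
    show "Lp_loc 1 {0<..<T} D (\<lambda>z. (norm (v z))\<^sup>2 / 2)"
      unfolding Lp_loc_def
    proof (intro allI impI)
      fix K :: "(real \<times> (real ^ 'n)) set" assume K: "compact K \<and> K \<subseteq> {0<..<T} \<times> UNIV"
      have "Lp_on 1 (K \<inter> (UNIV \<times> cell D)) (\<lambda>z. (norm (v z))\<^sup>2 / 2) \<longleftrightarrow> Lp_on 1 (K \<inter> (UNIV \<times> cell D)) e"
        by (rule Lp_on_cong, rule e_eq) (use K in auto)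
      then show "Lp_on 1 (K \<inter> (UNIV \<times> cell D)) (\<lambda>z. (norm (v z))\<^sup>2 / 2)" using eK K by blast
    qed
    show "Lp_loc 1 {0<..<T} D (\<lambda>z. ((norm (v z))\<^sup>2 / 2 + p z) *\<^sub>R v z)"
      unfolding Lp_loc_def
    proof (intro allI impI)
      fix K :: "(real \<times> (real ^ 'n)) set" assume K: "compact K \<and> K \<subseteq> {0<..<T} \<times> UNIV"
      have "Lp_on 1 (K \<inter> (UNIV \<times> cell D)) (\<lambda>z. ((norm (v z))\<^sup>2 / 2 + p z) *\<^sub>R v z) \<longleftrightarrow> Lp_on 1 (K \<inter> (UNIV \<times> cell D)) q"
        by (rule Lp_on_cong, rule q_eq) (use K in auto)
      then show "Lp_on 1 (K \<inter> (UNIV \<times> cell D)) (\<lambda>z. ((norm (v z))\<^sup>2 / 2 + p z) *\<^sub>R v z)" using qK K by blast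
    qed
    fix \<phi> :: "real \<times> (real ^ 'n) \<Rightarrow> real"
    assume \<phi>: "test_function {0<..<T} D \<phi>"
    let ?G = "\<lambda>z. N z / 2 * dt \<phi> z + (\<Sum>k\<in>UNIV. (N z / 2 + P z) * V z $ k * dx k \<phi> z)"
    have "flux \<phi> 0 = 0"
      by (rule flux_eq_0[OF \<phi>]) (rule increments_small[OF Vtx assms(10)])
    then have G0: "(LINT z|cellm D. ?G z) = 0" using flux_0[OF \<phi>] by simp
    have Gb: "?G \<in> borel_measurable borel"
    proof -
      have [measurable]: "dt \<phi> \<in> borel_measurable borel" "dx k \<phi> \<in> borel_measurable borel" for k
        using cutoff_test_function(2)[OF \<phi> t_dir_Basis] cutoff_test_function(2)[OF \<phi> x_dir_Basis]
        unfolding cutoff_def dt_eq_pd dx_eq_pd by blast+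
      have [measurable]: "(\<lambda>z. V z $ k) \<in> borel_measurable borel" for k by (rule tame_borel[OF tame_V])
      show ?thesis by measurable
    qed
    have "indicator ?A z *\<^sub>R ((norm (v z))\<^sup>2 / 2 * dt \<phi> z + (\<Sum>k\<in>UNIV. (((norm (v z))\<^sup>2 / 2 + p z) *\<^sub>R v z) $ k * dx k \<phi> z))
        = indicator ?S z *\<^sub>R ?G z" for z
      unfolding N_def V_def P_def by (auto simp: indicator_def mem_Times_iff)
    then show "(LINT z:?A|lborel. (norm (v z))\<^sup>2 / 2 * dt \<phi> z + (\<Sum>k\<in>UNIV. (((norm (v z))\<^sup>2 / 2 + p z) *\<^sub>R v z) $ k * dx k \<phi> z)) = 0"
      using G0 unfolding set_lebesgue_integral_def integral_cellm[OF Gb] by (simp only:)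
  qed
qed

end
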